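(* Let $F:\mathbb{R}^m\to\mathbb{R}^{m'}$ be $C^2$ such that $f=\|F\|^2$ satisfies the Lojasiewicz gradient inequality at each of its critical points, and let $\{x_n\}$ be a sequence constructed by Backtracking New Q-Newton's method SE with $0<\tau<1$. 1) If $\mu(x^* )(1+\tau)<1$ for every critical point $x^*$ of $f$, then either $\lim_{n\to\infty}\|x_n\|=\infty$ or $\{x_n\}$ converges to a critical point of $f$. 2) If $F$ is a polynomial map, then there exists $\tau_0>0$ (depending on $F$) such that for every $0<\tau<\tau_0$ the condition in 1) holds; consequently, for such $\tau$, either $\lim_{n\to\infty}\|x_n\|=\infty$ or $\{x_n\}$ converges to a critical point of $f$.
   Context: $\mathrm{minsp}(A)$ is the minimum absolute value of the eigenvalues of a real symmetric matrix $A$; for invertible symmetric $A$, $pr_{A,\pm}$ are the orthogonal projections onto the spans of eigenvectors with positive/negative eigenvalues; $H(x)=JF(x)$. Backtracking New Q-Newton's method SE with distinct parameters $\delta_0,\dots,\delta_m>0$, $\tau>0$, $\kappa=\frac12\min_{i\ne j}|\delta_i-\delta_j|$: given $x_k$, if $H(x_k)^\intercal F(x_k)=0$ set $x_{k+1}=x_k$. Otherwise, if $\mathrm{minsp}(\nabla^2 f(x_k))>\|F(x_k)\|^\tau$, take the smallest $j$ with $\mathrm{minsp}(\nabla^2f(x_k)+\delta_j\|F(x_k)\|I)\ge\kappa\|F(x_k)\|$ and $A_k=\nabla^2f(x_k)+\delta_j\|F(x_k)\|I$; else take the smallest $j$ with $\mathrm{minsp}(\nabla^2f(x_k)+\delta_j\|F(x_k)\|^\tau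 I)\ge\kappa\|F(x_k)\|^\tau$ and $A_k=\nabla^2f(x_k)+\delta_j\|F(x_k)\|^\tau I$. Set $v_k=A_k^{-1}H(x_k)^\intercal F(x_k)$, $w_k=pr_{A_k,+}v_k-pr_{A_k,-}v_k$, $\widehat{w_k}=w_k/\max\{1,\|w_k\|\}$, $\gamma_k$ the largest $\gamma\in\{2^{-n}:n\ge0\}$ with $f(x_k-\gamma\widehat{w_k})-f(x_k)\le-\gamma\langle\widehat{w_k},H(x_k)^\intercal F(x_k)\rangle$, and $x_{k+1}=x_k-\gamma_k\widehat{w_k}$. A $C^1$ function $g$ satisfies the Lojasiewicz gradient inequality at $x^*$ if there exist a neighbourhood $U$ of $x^*$, $0<\mu<1$, $C>0$ with $|g(x)-g(x^* )|^\mu\le C\|\nabla g(x)\|$ for all $x\in U$. For a critical point $x^*$ of $f$, $\mu(x^* ):=\inf\{\mu:$ there exist a neighbourhood $U$ of $x^*$ and $C>0$ with $|f(x)-f(x^* )|^\mu\le C\|\nabla f(x)\|$ for all $x\in U\}$. *)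

theory Defs
  imports "HOL-Analysis.Analysis"
begin

definition jac :: "(real^'m \<Rightarrow> real^'k) \<Rightarrow> real^'m \<Rightarrow> real^'m^'k" where
  "jac F x = matrix (frechet_derivative F (at x))"

definition grad :: "(real^'m \<Rightarrow> real) \<Rightarrow> real^'m \<Rightarrow> real^'m" where
  "grad g x = (\<chi> i. frechet_derivative g (at x) (axis i 1))"

definition hess :: "(real^'m \<Rightarrow> real) \<Rightarrow> real^'m \<Rightarrow> real^'m^'m" where
  "hess g x = matrix (frechet_derivative (grad g) (at x))"

definition C2_map :: "(real^'m \<Rightarrow> real^'k) \<Rightarrow> bool" where
  "C2_map F \<longleftrightarrow> (\<forall>x. F differentiable (at x)) \<and>
     (\<forall>x. (jac F) differentiable (at x)) \<and>
     (\<forall>v. continuous_on UNIV (\<lambda>x. frechet_derivative (jac F) (at x) v))"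

definition sqnorm_fun :: "(real^'m \<Rightarrow> real^'k) \<Rightarrow> real^'m \<Rightarrow> real" where
  "sqnorm_fun F x = (norm (F x))\<^sup>2"

definition critical_point :: "(real^'m \<Rightarrow> real) \<Rightarrow> real^'m \<Rightarrow> bool" where
  "critical_point g x \<longleftrightarrow> grad g x = 0"

definition lojasiewicz_at :: "(real^'m \<Rightarrow> real) \<Rightarrow> real^'m \<Rightarrow> bool" where
  "lojasiewicz_at g xs \<longleftrightarrow> (\<exists>U \<mu> C. open U \<and> xs \<in> U \<and> 0 < \<mu> \<and> \<mu> < 1 \<and> C > 0 \<and>
      (\<forall>x\<in>U. \<bar>g x - g xs\<bar> powr \<mu> \<le> C * norm (grad g x)))"

definition loj_exponent :: "(real^'m \<Rightarrow> real) \<Rightarrow> real^'m \<Rightarrow> real" where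
  "loj_exponent g xs = Inf {\<mu>. 0 < \<mu> \<and> \<mu> < 1 \<and> (\<exists>U C. open U \<and> xs \<in> U \<and> C > 0 \<and>
      (\<forall>x\<in>U. \<bar>g x - g xs\<bar> powr \<mu> \<le> C * norm (grad g x)))}"

definition eigenvalues_of :: "real^'n^'n \<Rightarrow> real set" where
  "eigenvalues_of A = {l. \<exists>v. v \<noteq> 0 \<and> A *v v = l *\<^sub>R v}"

definition minsp :: "real^'n^'n \<Rightarrow> real" where
  "minsp A = Min (abs ` eigenvalues_of A)"

definition orth_proj :: "(real^'n) set \<Rightarrow> real^'n \<Rightarrow> real^'n" where
  "orth_proj S v = (THE u. u \<in> S \<and> (\<forall>s\<in>S. (v - u) \<bullet> s = 0))"

definition pos_eigenspace :: "real^'n^'n \<Rightarrow> (real^'n) set" where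
  "pos_eigenspace A = span {v. \<exists>l>0. A *v v = l *\<^sub>R v}"

definition neg_eigenspace :: "real^'n^'n \<Rightarrow> (real^'n) set" where
  "neg_eigenspace A = span {v. \<exists>l<0. A *v v = l *\<^sub>R v}"

definition pr_pos :: "real^'n^'n \<Rightarrow> real^'n \<Rightarrow> real^'n" where
  "pr_pos A v = orth_proj (pos_eigenspace A) v"

definition pr_neg :: "real^'n^'n \<Rightarrow> real^'n \<Rightarrow> real^'n" where
  "pr_neg A v = orth_proj (neg_eigenspace A) v"

definition bnqn_kappa :: "nat \<Rightarrow> (nat \<Rightarrow> real) \<Rightarrow> real" where
  "bnqn_kappa m \<delta> = Min {\<bar>\<delta> i - \<delta> j\<bar> | i j. i \<le> m \<and> j \<le> m \<and> i \<noteq> j} / 2"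

definition bnqn_A :: "(real^'m \<Rightarrow> real^'k) \<Rightarrow> (nat \<Rightarrow> real) \<Rightarrow> real \<Rightarrow> real^'m \<Rightarrow> real^'m^'m" where
  "bnqn_A F \<delta> \<tau> x =
     (let m = CARD('m); \<kappa> = bnqn_kappa m \<delta>; Hf = hess (sqnorm_fun F) x; nF = norm (F x) in
      if minsp Hf > nF powr \<tau> then
        (let j = (LEAST j. j \<le> m \<and> minsp (Hf + (\<delta> j * nF) *\<^sub>R mat 1) \<ge> \<kappa> * nF)
         in Hf + (\<delta> j * nF) *\<^sub>R mat 1)
      else
        (let j = (LEAST j. j \<le> m \<and> minsp (Hf + (\<delta> j * nF powr \<tau>) *\<^sub>R mat 1) \<ge> \<kappa> * nF powr \<tau>)
         in Hf + (\<delta> j * nF powr \<tau>) *\<^sub>R mat 1))"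

definition bnqn_step :: "(real^'m \<Rightarrow> real^'k) \<Rightarrow> (nat \<Rightarrow> real) \<Rightarrow> real \<Rightarrow> real^'m \<Rightarrow> real^'m" where
  "bnqn_step F \<delta> \<tau> x =
     (let g = transpose (jac F x) *v F x in
      if g = 0 then x
      else
        (let A = bnqn_A F \<delta> \<tau> x;
             v = matrix_inv A *v g;
             w = pr_pos A v - pr_neg A v;
             wh = (1 / max 1 (norm w)) *\<^sub>R w;
             f = sqnorm_fun F;
             n = (LEAST n::nat. f (x - ((1/2)^n) *\<^sub>R wh) - f x \<le> - ((1/2)^n) * (wh \<bullet> g))
         in x - ((1/2)^n) *\<^sub>R wh))"

definition bnqn_sequence :: "(real^'m \<Rightarrow> real^'k) \<Rightarrow> (nat \<Rightarrow> real) \<Rightarrow> real \<Rightarrow> (nat \<Rightarrow> real^'m) \<Rightarrow> bool" where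
  "bnqn_sequence F \<delta> \<tau> x \<longleftrightarrow> (\<forall>k. x (Suc k) = bnqn_step F \<delta> \<tau> (x k))"

definition bnqn_params :: "nat \<Rightarrow> (nat \<Rightarrow> real) \<Rightarrow> real \<Rightarrow> bool" where
  "bnqn_params m \<delta> \<tau> \<longleftrightarrow> (\<forall>j\<le>m. \<delta> j > 0) \<and> inj_on \<delta> {0..m} \<and> \<tau> > 0"

inductive poly_fun :: "(real^'m \<Rightarrow> real) \<Rightarrow> bool" where
  const: "poly_fun (\<lambda>x. c)"
| coord: "poly_fun (\<lambda>x. x $ i)"
| add: "poly_fun p \<Longrightarrow> poly_fun q \<Longrightarrow> poly_fun (\<lambda>x. p x + q x)"
| mult: "poly_fun p \<Longrightarrow> poly_fun q \<Longrightarrow> poly_fun (\<lambda>x. p x * q x)"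

definition poly_map :: "(real^'m \<Rightarrow> real^'k) \<Rightarrow> bool" where
  "poly_map F \<longleftrightarrow> (\<forall>i. poly_fun (\<lambda>x. F x $ i))"

end

theory Submission
  imports Defs
begin

text \<open>Write \<open>f = norm F ^ 2\<close> and \<open>g\<close> for half its gradient.

  Convergence: the reflected direction \<open>w\<close> satisfies \<open>w \<bullet> g \<ge> minsp A * norm w ^ 2\<close>, and the choice of the
  shift gives \<open>minsp A \<ge> c * norm F powr \<tau> = c * f powr (\<tau>/2)\<close>, so each step decreases \<open>f\<close> by at least a
  multiple of \<open>f powr (\<tau>/2) * norm g * norm (x' - x)\<close>. Near a cluster point with Lojasiewicz exponent \<open>\<mu>\<close>
  this is the usual length estimate with exponent \<open>\<theta> = \<mu> + \<tau>/2\<close>, and \<open>\<mu> * (1 + \<tau>) < 1\<close> together with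
  \<open>\<tau> < 1\<close> forces \<open>\<theta> < 1\<close>.

  Uniform exponents: the relation "some \<open>x\<close> in the ball of radius \<open>r\<close> around \<open>a\<close> has
  \<open>(f x - f a)^2 = s\<close> and squared gradient norm \<open>h\<close>" is semialgebraic in \<open>(a, r, s, h)\<close>, so by elimination of \<open>x\<close> it
  depends only on the signs of finitely many polynomials. Along \<open>h = s powr e\<close> these signs are
  eventually constant, locally uniformly in \<open>e\<close>, away from a finite set of slopes of Newton polygons that does
  not depend on \<open>a\<close> and \<open>r\<close>. Hence an exponent below \<open>1\<close> at \<open>a\<close> can be lowered to a bound below \<open>1\<close> that is common to all
  critical points.\<close>

section \<open>Sign diagrams of real polynomials\<close>

text \<open>The obstacle in the polynomial case is that \<open>f\<close> may have infinitely many
  critical points, so exponents that are each below 1 could still accumulate at 1. What prevents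
  this is an order of quantifiers: the exponents \<open>e\<close> at which two monomials in
  \<open>s\<close> and \<open>h\<close> become comparable along \<open>h = s powr e\<close> depend
  only on which monomials occur, while \<open>a\<close> and \<open>r\<close> enter through the
  coefficients alone. Squares of the value difference, the gradient norm and the radius keep the
  relation polynomial.

  Quantifiers are eliminated without counting roots. Two parameter values are compared through an
  increasing bijection \<open>\<phi>\<close> of the line such that every polynomial involved has at
  \<open>y\<close> the sign that its counterpart has at \<open>\<phi> y\<close>: the sign diagrams
  agree in order, though the roots may lie elsewhere. A witness \<open>y\<close> for one parameter
  value is then transported to the witness \<open>\<phi> y\<close> for the other. It remains to show
  that finitely many polynomial sign conditions on the parameters guarantee such a
  \<open>\<phi>\<close>, which is an induction on the degree through derivatives and
  remainders.\<close>

definition order_auto :: "(real \<Rightarrow> real) \<Rightarrow> bool" where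
  "order_auto \<phi> \<longleftrightarrow> strict_mono \<phi> \<and> surj \<phi>"

lemma order_auto_id: "order_auto (\<lambda>x. x)"
  by (auto simp: order_auto_def strict_mono_def)

lemma order_auto_comp: "order_auto \<phi> \<Longrightarrow> order_auto \<psi> \<Longrightarrow> order_auto (\<lambda>x. \<phi> (\<psi> x))"
  unfolding order_auto_def strict_mono_def surj_def by metis

lemma order_auto_less_iff: "order_auto \<phi> \<Longrightarrow> \<phi> x < \<phi> y \<longleftrightarrow> x < y"
  by (simp add: order_auto_def strict_mono_less)

lemma order_auto_eq_iff: "order_auto \<phi> \<Longrightarrow> \<phi> x = \<phi> y \<longleftrightarrow> x = y"
  by (simp add: order_auto_def strict_mono_eq)

lemma order_auto_surj: "order_auto \<phi> \<Longrightarrow> \<exists>x. y = \<phi> x"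
  unfolding order_auto_def surj_def by blast

lemma order_auto_move_between:
  fixes a b u v :: real
  assumes "a < u" "u < b" "a < v" "v < b"
  shows "\<exists>\<eta>. order_auto \<eta> \<and> \<eta> u = v \<and> (\<forall>s. s \<le> a \<or> b \<le> s \<longrightarrow> \<eta> s = s)"
proof -
  \<comment> \<open>Piecewise linear: slope \<open>k\<close> takes \<open>[a, u]\<close> onto
    \<open>[a, v]\<close>, slope \<open>l\<close> takes \<open>[u, b]\<close> onto
    \<open>[v, b]\<close>, and the identity is used outside.\<close>
  define k where "k = (v - a) / (u - a)"
  define l where "l = (b - v) / (b - u)"
  have k: "k > 0" "k * (u - a) = v - a" and l: "l > 0" "l * (b - u) = b - v"
    using assms by (auto simp: k_def l_def)
  define \<eta> where "\<eta> t = (if t \<le> a then t else if t \<le> u then a + k * (t - a)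
    else if t \<le> b then b - l * (b - t) else t)" for t
  have "strict_mono \<eta>"
  proof (rule strict_monoI)
    fix s t :: real assume st: "s < t"
    have K: "k * x < k * y" "l * x < l * y" if "x < y" for x y
      using k l that by auto
    have K': "k * x \<le> k * y" "l * x \<le> l * y" if "x \<le> y" for x y
      using k l that by auto
    show "\<eta> s < \<eta> t"
      unfolding \<eta>_def using st k(2) l(2) K[OF st] assms K(1)[of a t] K(2)[of u t] K(2)[of s b]
        K'(1)[of s u] K'(1)[of t u] K(2)[of t b] K'(2)[of t b] K'(2)[of s b]
      by (auto simp: algebra_simps split: if_splits)
  qed
  moreover have "surj \<eta>"
  proof (rule surjI)
    fix y
    show "\<eta> (if y \<le> a then y else if y \<le> v then a + (y - a) / k
      else if y \<le> b then b - (b - y) / l else y) = y"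
    proof -
      have 1: "a + (y - a) / k \<le> u" if "y \<le> v"
        using k that by (simp add: field_simps)
      have 2: "a + (y - a) / k > a" if "y > a"
        using k that by (simp add: field_simps)
      have 3: "b - (b - y) / l > u" if "y > v"
        using l that by (simp add: field_simps)
      have 4: "b - (b - y) / l \<le> b" if "y \<le> b"
        using l that by (simp add: field_simps)
      show ?thesis
        unfolding \<eta>_def using 1 2 3 4 k l assms by (auto simp: not_le divide_less_0_iff)
    qed
  qed
  moreover have "\<eta> u = v" "\<forall>s. s \<le> a \<or> b \<le> s \<longrightarrow> \<eta> s = s"
    unfolding \<eta>_def using k l assms by auto
  ultimately show ?thesis unfolding order_auto_def by blast
qed

lemma finite_gap_below:
  fixes m :: real assumes "finite S" shows "\<exists>a<m. \<forall>s\<in>S. s < m \<longrightarrow> s \<le> a"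
proof -
  have "finite (insert (m - 1) {s \<in> S. s < m})" using assms by auto
  then show ?thesis
    by (intro exI[of _ "Max (insert (m - 1) {s \<in> S. s < m})"]) auto
qed

lemma finite_gap_above:
  fixes m :: real assumes "finite S" shows "\<exists>b>m. \<forall>s\<in>S. s > m \<longrightarrow> s \<ge> b"
proof -
  have "finite (insert (m + 1) {s \<in> S. s > m})" using assms by auto
  then show ?thesis
    by (intro exI[of _ "Min (insert (m + 1) {s \<in> S. s > m})"]) auto
qed

text \<open>Serves to relocate the image of one root while the images already in place, the members
  of \<open>S\<close>, do not move.\<close>

lemma order_auto_move:
  fixes u v :: real
  assumes "finite S" "\<And>s. s \<in> S \<Longrightarrow> s < min u v \<or> max u v < s"
  shows "\<exists>\<eta>. order_auto \<eta> \<and> \<eta> u = v \<and> (\<forall>s\<in>S. \<eta> s = s)"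
proof -
  obtain a where a: "a < min u v" "\<forall>s\<in>S. s < min u v \<longrightarrow> s \<le> a"
    using finite_gap_below[OF assms(1)] by blast
  obtain b where b: "b > max u v" "\<forall>s\<in>S. s > max u v \<longrightarrow> s \<ge> b"
    using finite_gap_above[OF assms(1)] by blast
  obtain \<eta> where "order_auto \<eta>" "\<eta> u = v" "\<forall>s. s \<le> a \<or> b \<le> s \<longrightarrow> \<eta> s = s"
    using order_auto_move_between[of a u b v] a(1) b(1) by auto
  then show ?thesis using a b assms(2) by blast
qed

lemma poly_root_between:
  fixes q :: "real poly"
  assumes "a < b" "sgn (poly q a) \<noteq> sgn (poly q b)" "poly q a \<noteq> 0" "poly q b \<noteq> 0"
  shows "\<exists>x. a < x \<and> x < b \<and> poly q x = 0"
  using assms poly_IVT_pos[of a b q] poly_IVT_neg[of a b q]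
  by (auto simp: sgn_if split: if_splits)

text \<open>Away from roots, a change of sign would put a root \<open>r\<close> strictly between
  \<open>y\<close> and \<open>\<eta> y\<close>; but \<open>\<eta>\<close> is increasing and fixes
  \<open>r\<close>, so it cannot carry \<open>y\<close> across \<open>r\<close>.\<close>

lemma sgn_poly_order_auto:
  fixes q :: "real poly"
  assumes \<eta>: "order_auto \<eta>" and fix_roots: "\<And>r. poly q r = 0 \<Longrightarrow> \<eta> r = r"
  shows "sgn (poly q (\<eta> y)) = sgn (poly q y)"
proof (rule ccontr)
  assume neq: "\<not> ?thesis"
  have y: "poly q y \<noteq> 0" using neq fix_roots by force
  have "poly q (\<eta> y) \<noteq> 0"
    using fix_roots[of "\<eta> y"] order_auto_eq_iff[OF \<eta>, of "\<eta> y" y] y by auto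
  moreover have "\<eta> y \<noteq> y" using neq by auto
  ultimately obtain r where "poly q r = 0" "y < r \<and> r < \<eta> y \<or> \<eta> y < r \<and> r < y"
    using poly_root_between[of y "\<eta> y" q] poly_root_between[of "\<eta> y" y q] y neq
    by (metis linorder_neqE)
  then show False
    using fix_roots[of r] order_auto_less_iff[OF \<eta>, of y r] order_auto_less_iff[OF \<eta>, of r y] by auto
qed

lemma poly_sgn_at_top:
  fixes p :: "real poly"
  assumes "p \<noteq> 0"
  shows "\<exists>M. \<forall>x\<ge>M. sgn (poly p x) = sgn (lead_coeff p)"
proof (cases "lead_coeff p > 0")
  case True
  then show ?thesis using poly_pinfty_gt_lc[of p] by (metis less_le_trans sgn_pos)
next
  case False
  then have "lead_coeff (-p) > 0" using assms by (simp add: less_le)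
  from poly_pinfty_gt_lc[OF this] show ?thesis
    using \<open>lead_coeff (-p) > 0\<close>
    by (metis (no_types, lifting) lead_coeff_minus less_le_trans neg_0_less_iff_less poly_minus sgn_neg)
qed

lemma poly_sgn_at_bot:
  fixes p :: "real poly"
  assumes "p \<noteq> 0"
  shows "\<exists>M. \<forall>x\<le>M. sgn (poly p x) = (-1) ^ degree p * sgn (lead_coeff p)"
proof -
  define q where "q = pcompose p [:0, -1:]"
  have lq: "lead_coeff q = lead_coeff p * (-1) ^ degree p"
    unfolding q_def by (subst lead_coeff_comp) auto
  then have "q \<noteq> 0" using assms by auto
  then obtain M where M: "\<forall>x\<ge>M. sgn (poly q x) = sgn (lead_coeff q)"
    using poly_sgn_at_top by blast
  have "sgn (poly p x) = (-1) ^ degree p * sgn (lead_coeff p)" if "x \<le> -M" for x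
  proof -
    have "poly p x = poly q (-x)" by (simp add: q_def poly_pcompose)
    moreover have "sgn (poly q (-x)) = sgn (lead_coeff q)" using M that by auto
    ultimately show ?thesis
      unfolding lq by (cases "even (degree p)") (auto simp: sgn_mult)
  qed
  then show ?thesis by blast
qed

lemma poly_sgn_diff_const:
  fixes p :: "real poly"
  assumes "\<And>x. a < x \<Longrightarrow> x < b \<Longrightarrow> sgn (poly (pderiv p) x) = \<sigma>" "a \<le> s" "s < t" "t \<le> b"
  shows "sgn (poly p t - poly p s) = \<sigma>"
proof -
  obtain x where x: "s < x" "x < t" "poly p t - poly p s = (t - s) * poly (pderiv p) x"
    using poly_MVT[OF assms(3), of p] by blast
  then have "sgn (poly p t - poly p s) = sgn (poly (pderiv p) x)"
    using assms(3) by (simp add: sgn_mult)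
  then show ?thesis using assms x by auto
qed

text \<open>\<open>u\<close>, \<open>v\<close>, \<open>w\<close> are values of a strictly monotone
  function at increasing arguments, and \<open>\<sigma>\<close> is its direction. If
  \<open>u\<close> lies strictly on the \<open>- \<sigma>\<close> side, then \<open>w\<close> has
  not crossed 0 and \<open>v\<close> is still on that side; otherwise \<open>v\<close> has already
  moved strictly to the side of \<open>\<sigma>\<close>.\<close>

lemma sgn_between_no_sign_change:
  fixes u v w \<sigma> :: real
  assumes "\<bar>\<sigma>\<bar> = 1" "sgn (v - u) = \<sigma>" "sgn (w - v) = \<sigma>" "\<not> (sgn u = - \<sigma> \<and> sgn w = \<sigma>)"
  shows "sgn v = (if sgn u = - \<sigma> then - \<sigma> else \<sigma>)"
proof -
  have "\<sigma> = 1 \<or> \<sigma> = -1" using assms(1) by linarith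
  then show ?thesis using assms(2-4) by (elim disjE) (auto simp: sgn_if split: if_splits)
qed

text \<open>Between consecutive roots of the polynomials already matched (its derivative among them), \<open>p\<close> is
  strictly monotone, so it has at most one root there, and whether it has one is decided by its signs at the
  endpoints.\<close>

lemma extend_sign_matching:
  fixes p p' :: "real poly" and A :: "(real poly \<times> real poly) set"
  assumes finA: "finite A" and \<phi>: "order_auto \<phi>"
    and sg: "\<And>q q' y. (q, q') \<in> A \<Longrightarrow> sgn (poly q y) = sgn (poly q' (\<phi> y))"
    and der: "(pderiv p, pderiv p') \<in> A"
    and deg: "degree p = degree p'" and lc: "sgn (lead_coeff p) = sgn (lead_coeff p')"
    and rem: "\<And>q q' x. (q, q') \<in> A \<Longrightarrow> q \<noteq> 0 \<Longrightarrow> poly q x = 0 \<Longrightarrow> sgn (poly p x) = sgn (poly p' (\<phi> x))"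
  shows "\<exists>\<psi>. order_auto \<psi> \<and> (\<forall>(q, q')\<in>insert (p, p') A. \<forall>y. sgn (poly q y) = sgn (poly q' (\<psi> y)))"
proof (cases "degree p = 0")
  case True
  have "sgn (poly p y) = sgn (poly p' (\<phi> y))" for y
    using True lc deg by (auto elim!: degree_eq_zeroE)
  then show ?thesis using \<phi> sg by blast
next
  case False
  then have dp: "pderiv p \<noteq> 0" by (simp add: pderiv_eq_0_iff)
  have p0: "p \<noteq> 0" "p' \<noteq> 0" using False deg by auto
  obtain T1 where T1: "\<And>x. x \<ge> T1 \<Longrightarrow> sgn (poly p x) = sgn (lead_coeff p)"
    using poly_sgn_at_top[OF p0(1)] by blast
  obtain T2 where T2: "\<And>x. x \<ge> T2 \<Longrightarrow> sgn (poly p' x) = sgn (lead_coeff p')"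
    using poly_sgn_at_top[OF p0(2)] by blast
  obtain B1 where B1: "\<And>x. x \<le> B1 \<Longrightarrow> sgn (poly p x) = (-1) ^ degree p * sgn (lead_coeff p)"
    using poly_sgn_at_bot[OF p0(1)] by blast
  obtain B2 where B2: "\<And>x. x \<le> B2 \<Longrightarrow> sgn (poly p' x) = (-1) ^ degree p' * sgn (lead_coeff p')"
    using poly_sgn_at_bot[OF p0(2)] by blast
  \<comment> \<open>The thresholds for \<open>p'\<close> are pulled back through
    \<open>\<phi>\<close>, so that \<open>T\<close> and \<open>B\<close> can stand for plus and
    minus infinity on both sides at once.\<close>
  obtain T2' B2' where TB: "T2 = \<phi> T2'" "B2 = \<phi> B2'" using order_auto_surj[OF \<phi>] by metis
  define T where "T = max T1 T2'"
  define B where "B = min B1 B2'"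
  define X where "X = insert T (insert B (\<Union>q\<in>fst ` A - {0}. {x. poly q x = 0}))"
  have finX: "finite X"
    unfolding X_def using finA by (auto intro!: finite_UN_I poly_roots_finite)
  have inX: "x \<in> X" if "(q, q') \<in> A" "q \<noteq> 0" "poly q x = 0" for q q' x
    using that unfolding X_def by force
  have BT: "B \<in> X" "T \<in> X" by (auto simp: X_def)
  have le: "\<phi> x \<le> \<phi> y \<longleftrightarrow> x \<le> y" for x y
    using order_auto_less_iff[OF \<phi>, of y x] by (meson not_le)
  have top: "sgn (poly p y) = sgn (poly p' z)" if "y \<ge> T" "z \<ge> \<phi> T" for y z
  proof -
    have "z \<ge> T2" using that(2) le[of T2' T] TB by (auto simp: T_def)
    then show ?thesis using T1[of y] T2[of z] that lc by (auto simp: T_def)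
  qed
  have bot: "sgn (poly p y) = sgn (poly p' z)" if "y \<le> B" "z \<le> \<phi> B" for y z
  proof -
    have "z \<le> B2" using that(2) le[of B B2'] TB by (auto simp: B_def)
    then show ?thesis using B1[of y] B2[of z] that lc deg by (auto simp: B_def)
  qed
  have onX: "sgn (poly p x) = sgn (poly p' (\<phi> x))" if "x \<in> X" for x
    using that top[of T "\<phi> T"] bot[of B "\<phi> B"] unfolding X_def by (auto dest: rem)
  \<comment> \<open>Any automorphism that agrees with \<open>\<phi>\<close> on \<open>X\<close>
    still matches the members of \<open>A\<close>: followed by the inverse of \<open>\<phi>\<close>
    it fixes their roots and so preserves their signs. This leaves freedom inside the gaps of
    \<open>X\<close>.\<close>
  have keep: "sgn (poly q y) = sgn (poly q' (\<psi> y))"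
    if \<psi>: "order_auto \<psi>" "\<And>x. x \<in> X \<Longrightarrow> \<psi> x = \<phi> x" and qA: "(q, q') \<in> A" for \<psi> q q' y
  proof (cases "q = 0")
    case True
    then have "poly q' z = 0" for z
      using sg[OF qA] order_auto_surj[OF \<phi>, of z] by (metis poly_0 sgn_0 sgn_eq_0_iff)
    then show ?thesis using True by simp
  next
    case False
    define \<eta> where "\<eta> z = inv \<phi> (\<psi> z)" for z
    have \<phi>\<eta>: "\<phi> (\<eta> z) = \<psi> z" for z
      using \<phi> by (simp add: \<eta>_def order_auto_def surj_f_inv_f)
    have "order_auto \<eta>"
      unfolding order_auto_def
    proof
      show "strict_mono \<eta>"
        by (rule strict_monoI)
          (metis \<phi>\<eta> order_auto_less_iff[OF \<phi>] order_auto_less_iff[OF \<psi>(1)])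
      show "surj \<eta>"
        unfolding surj_def by (metis \<phi>\<eta> order_auto_eq_iff[OF \<phi>] order_auto_surj[OF \<psi>(1)])
    qed
    moreover have "\<eta> r = r" if "poly q r = 0" for r
    proof -
      have "r \<in> X" using inX[OF qA False that] .
      then show ?thesis using \<psi>(2) \<phi>\<eta>[of r] order_auto_eq_iff[OF \<phi>] by metis
    qed
    ultimately have "sgn (poly q (\<eta> y)) = sgn (poly q y)" by (rule sgn_poly_order_auto)
    then show ?thesis using sg[OF qA, of "\<eta> y"] \<phi>\<eta> by simp
  qed
  have gap: "\<exists>a b. a \<in> X \<and> b \<in> X \<and> a < y \<and> y < b \<and> (\<forall>x\<in>X. \<not> (a < x \<and> x < b))"
    if y: "y \<notin> X" "B < y" "y < T" for y
  proof -
    let ?L = "{x\<in>X. x < y}" and ?U = "{x\<in>X. y < x}"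
    have L: "finite ?L" "?L \<noteq> {}" and U: "finite ?U" "?U \<noteq> {}"
      using finX y BT by auto
    have "Max ?L \<in> ?L" "Min ?U \<in> ?U" using Max_in[OF L] Min_in[OF U] by auto
    moreover have "\<not> (Max ?L < x \<and> x < Min ?U)" if "x \<in> X" for x
      using that Max_ge[OF L(1), of x] Min_le[OF U(1), of x] y(1) by (metis (mono_tags, lifting) linorder_neqE_linordered_idom mem_Collect_eq not_le)
    ultimately show ?thesis by blast
  qed
  \<comment> \<open>The pair of derivatives lies in \<open>A\<close>, so one sign
    \<open>\<sigma>\<close> governs the monotonicity of \<open>p\<close> on a gap and that of
    \<open>p'\<close> on the image of the gap.\<close>
  have mono: "\<exists>\<sigma>. \<bar>\<sigma>\<bar> = 1 \<and> (\<forall>s t. a \<le> s \<and> s < t \<and> t \<le> b \<longrightarrow> sgn (poly p t - poly p s) = \<sigma>)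
      \<and> (\<forall>s t. \<phi> a \<le> s \<and> s < t \<and> t \<le> \<phi> b \<longrightarrow> sgn (poly p' t - poly p' s) = \<sigma>)"
    if ab: "a < b" "\<forall>x\<in>X. \<not> (a < x \<and> x < b)" for a b
  proof -
    define m where "m = (a + b) / 2"
    define \<sigma> where "\<sigma> = sgn (poly (pderiv p) m)"
    have m: "a < m" "m < b" using ab(1) by (auto simp: m_def)
    have nz: "poly (pderiv p) x \<noteq> 0" if "a < x" "x < b" for x
      using ab(2) that inX[OF der dp] by blast
    have s1: "sgn (poly (pderiv p) x) = \<sigma>" if x: "a < x" "x < b" for x
    proof (rule ccontr)
      assume "sgn (poly (pderiv p) x) \<noteq> \<sigma>"
      then have "\<exists>z. (m < z \<and> z < x \<or> x < z \<and> z < m) \<and> poly (pderiv p) z = 0"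
        using poly_root_between[of m x "pderiv p"] poly_root_between[of x m "pderiv p"] nz[OF x] nz[OF m]
        unfolding \<sigma>_def by (metis linorder_neqE_linordered_idom)
      then show False using nz x m by force
    qed
    have s2: "sgn (poly (pderiv p') z) = \<sigma>" if z: "\<phi> a < z" "z < \<phi> b" for z
    proof -
      obtain x where x: "z = \<phi> x" using order_auto_surj[OF \<phi>] by blast
      then have "a < x" "x < b" using z order_auto_less_iff[OF \<phi>] by auto
      then show ?thesis using s1 sg[OF der, of x] x by auto
    qed
    have "\<bar>\<sigma>\<bar> = 1" using nz[OF m] by (simp add: \<sigma>_def abs_sgn_eq)
    then show ?thesis
      using poly_sgn_diff_const[of a b p \<sigma>, OF s1] poly_sgn_diff_const[of "\<phi> a" "\<phi> b" p' \<sigma>, OF s2]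
      by blast
  qed
  \<comment> \<open>Induction over the roots of \<open>p\<close>: each new root outside
    \<open>X\<close> is sent to a root of \<open>p'\<close> in the image of its gap, while
    \<open>X\<close> and the earlier roots keep their images.\<close>
  have match: "\<exists>\<psi>. order_auto \<psi> \<and> (\<forall>x\<in>X. \<psi> x = \<phi> x) \<and> (\<forall>z\<in>Z. poly p' (\<psi> z) = 0)"
    if "finite Z" "\<forall>z\<in>Z. poly p z = 0" for Z
    using that
  proof (induction Z rule: finite_induct)
    case empty
    then show ?case using \<phi> by auto
  next
    case (insert z Z)
    then obtain \<psi> where \<psi>: "order_auto \<psi>" "\<forall>x\<in>X. \<psi> x = \<phi> x" "\<forall>z\<in>Z. poly p' (\<psi> z) = 0"
      by auto
    have pz: "poly p z = 0" using insert by auto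
    show ?case
    proof (cases "z \<in> X")
      case True
      then have "poly p' (\<psi> z) = 0" using \<psi>(2) onX[OF True] pz by (simp add: sgn_0_0)
      then show ?thesis using \<psi> by blast
    next
      case False
      have "z \<noteq> T" "z \<noteq> B" using False BT by auto
      moreover have "\<not> z \<ge> T"
        using T1[of z] pz p0 by (auto simp: T_def sgn_0_0)
      moreover have "\<not> z \<le> B"
        using B1[of z] pz p0 by (auto simp: B_def sgn_0_0)
      ultimately obtain a b where ab: "a \<in> X" "b \<in> X" "a < z" "z < b" "\<forall>x\<in>X. \<not> (a < x \<and> x < b)"
        using gap[of z] False by fastforce
      obtain \<sigma> where \<sigma>: "\<bar>\<sigma>\<bar> = 1"
        "\<And>s t. a \<le> s \<Longrightarrow> s < t \<Longrightarrow> t \<le> b \<Longrightarrow> sgn (poly p t - poly p s) = \<sigma>"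
        using mono[of a b] ab by force
      have "sgn (poly p b) = \<sigma>" "sgn (- poly p a) = \<sigma>"
        using \<sigma>(2)[of a z] \<sigma>(2)[of z b] pz ab by auto
      then have "sgn (poly p' (\<phi> b)) = \<sigma>" "sgn (poly p' (\<phi> a)) = - \<sigma>"
        using onX[OF ab(1)] onX[OF ab(2)] by (auto simp: sgn_minus)
      then have "sgn (poly p' (\<phi> a)) \<noteq> sgn (poly p' (\<phi> b))" "poly p' (\<phi> a) \<noteq> 0" "poly p' (\<phi> b) \<noteq> 0"
        using \<sigma>(1) by auto
      moreover have "\<phi> a < \<phi> b" using order_auto_less_iff[OF \<phi>] ab by auto
      ultimately obtain z' where z': "\<phi> a < z'" "z' < \<phi> b" "poly p' z' = 0"
        using poly_root_between[of "\<phi> a" "\<phi> b" p'] by blast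
      have \<psi>z: "\<phi> a < \<psi> z" "\<psi> z < \<phi> b"
        using \<psi>(2) ab order_auto_less_iff[OF \<psi>(1)] by metis+
      define S where "S = \<psi> ` (X \<union> Z)"
      \<comment> \<open>By strict monotonicity a gap contains at most one root of \<open>p\<close>,
        so no point that has to stay fixed blocks the way from \<open>\<psi> z\<close> to
        \<open>z'\<close>.\<close>
      have S: "s < min (\<psi> z) z' \<or> max (\<psi> z) z' < s" if sS: "s \<in> S" for s
      proof -
        have "\<not> (\<phi> a < s \<and> s < \<phi> b)"
        proof
          assume H: "\<phi> a < s \<and> s < \<phi> b"
          obtain t where t: "t \<in> X \<union> Z" "s = \<psi> t" using sS by (auto simp: S_def)
          have "a < t" "t < b"
            using H t \<psi>(2) ab order_auto_less_iff[OF \<psi>(1)] by metis+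
          then have "t \<in> Z" using t ab by auto
          then have "poly p t = 0" "t \<noteq> z" using insert by auto
          then show False
            using \<sigma>(2)[of t z] \<sigma>(2)[of z t] pz \<sigma>(1) \<open>a < t\<close> \<open>t < b\<close> ab
            by (cases "t < z") auto
        qed
        then show ?thesis using \<psi>z z' by auto
      qed
      have "finite S" using finX insert by (auto simp: S_def)
      from order_auto_move[OF this S] obtain \<eta> where \<eta>: "order_auto \<eta>" "\<eta> (\<psi> z) = z'" "\<forall>s\<in>S. \<eta> s = s"
        by blast
      have "\<eta> (\<psi> t) = \<psi> t" if "t \<in> X \<union> Z" for t
        using \<eta>(3) that unfolding S_def by blast
      then have "\<forall>t\<in>X. \<eta> (\<psi> t) = \<phi> t" "\<forall>t\<in>insert z Z. poly p' (\<eta> (\<psi> t)) = 0"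
        using \<psi>(2,3) z'(3) \<eta>(2) by (metis UnI1, metis UnI2 insertE)
      then show ?thesis
        using order_auto_comp[OF \<eta>(1) \<psi>(1)] by blast
    qed
  qed
  obtain \<psi> where \<psi>: "order_auto \<psi>" "\<forall>x\<in>X. \<psi> x = \<phi> x" "\<And>z. poly p z = 0 \<Longrightarrow> poly p' (\<psi> z) = 0"
    using match[OF poly_roots_finite[OF p0(1)]] by blast
  have "sgn (poly p y) = sgn (poly p' (\<psi> y))" for y
  proof -
    have TX: "\<psi> T = \<phi> T" "\<psi> B = \<phi> B" using \<psi>(2) BT by auto
    consider "y \<in> X" | "y \<ge> T" | "y \<le> B" | "y \<notin> X" "B < y" "y < T" by linarith
    then show ?thesis
    proof cases
      case 1
      then show ?thesis using \<psi>(2) onX by auto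
    next
      case 2
      then have "\<psi> y \<ge> \<phi> T" using order_auto_less_iff[OF \<psi>(1), of y T] TX by auto
      then show ?thesis using 2 top by blast
    next
      case 3
      then have "\<psi> y \<le> \<phi> B" using order_auto_less_iff[OF \<psi>(1), of B y] TX by auto
      then show ?thesis using 3 bot by blast
    next
      case 4
      obtain a b where ab: "a \<in> X" "b \<in> X" "a < y" "y < b" "\<forall>x\<in>X. \<not> (a < x \<and> x < b)"
        using gap[of y] 4 by blast
      obtain \<sigma> where \<sigma>: "\<bar>\<sigma>\<bar> = 1"
        "\<And>s t. a \<le> s \<Longrightarrow> s < t \<Longrightarrow> t \<le> b \<Longrightarrow> sgn (poly p t - poly p s) = \<sigma>"
        "\<And>s t. \<phi> a \<le> s \<Longrightarrow> s < t \<Longrightarrow> t \<le> \<phi> b \<Longrightarrow> sgn (poly p' t - poly p' s) = \<sigma>"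
        using mono[of a b] ab by force
      have \<psi>y: "\<phi> a < \<psi> y" "\<psi> y < \<phi> b"
        using \<psi>(2) ab order_auto_less_iff[OF \<psi>(1)] by metis+
      have E: "sgn (poly p a) = sgn (poly p' (\<phi> a))" "sgn (poly p b) = sgn (poly p' (\<phi> b))"
        using onX ab by auto
      show ?thesis
      proof (cases "\<exists>z. a < z \<and> z < b \<and> poly p z = 0")
        case True
        then obtain z where z: "a < z" "z < b" "poly p z = 0" by blast
        have \<psi>z: "\<phi> a < \<psi> z" "\<psi> z < \<phi> b" "poly p' (\<psi> z) = 0"
          using \<psi>(2,3) z ab order_auto_less_iff[OF \<psi>(1)] by metis+
        show ?thesis
          using \<sigma>(2)[of y z] \<sigma>(2)[of z y] \<sigma>(3)[of "\<psi> y" "\<psi> z"] \<sigma>(3)[of "\<psi> z" "\<psi> y"] z \<psi>z \<psi>y ab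
            order_auto_less_iff[OF \<psi>(1), of y z] order_auto_less_iff[OF \<psi>(1), of z y]
          by (cases y z rule: linorder_cases) (auto simp: sgn_if split: if_splits)
      next
        case False
        have nosc: "\<not> (sgn (poly p a) = - \<sigma> \<and> sgn (poly p b) = \<sigma>)"
        proof
          assume *: "sgn (poly p a) = - \<sigma> \<and> sgn (poly p b) = \<sigma>"
          have "\<sigma> \<noteq> 0" using \<sigma>(1) by auto
          with * have "sgn (poly p a) \<noteq> sgn (poly p b)" "poly p a \<noteq> 0" "poly p b \<noteq> 0"
            by auto
          then show False using False poly_root_between[of a b p] ab by force
        qed
        have "sgn (poly p y) = (if sgn (poly p a) = - \<sigma> then - \<sigma> else \<sigma>)"
          using sgn_between_no_sign_change[OF \<sigma>(1) _ _ nosc] \<sigma>(2)[of a y] \<sigma>(2)[of y b] ab by simp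
        moreover have "sgn (poly p' (\<psi> y)) = (if sgn (poly p' (\<phi> a)) = - \<sigma> then - \<sigma> else \<sigma>)"
          using sgn_between_no_sign_change[OF \<sigma>(1) _ _ nosc[unfolded E]]
            \<sigma>(3)[of "\<phi> a" "\<psi> y"] \<sigma>(3)[of "\<psi> y" "\<phi> b"] \<psi>y by simp
        ultimately show ?thesis using E by simp
      qed
    qed
  qed
  then show ?thesis using \<psi>(1) keep[OF \<psi>(1)] \<psi>(2) by blast
qed

section \<open>Elimination of quantifiers\<close>

text \<open>Polynomial functions of an assignment of reals to variables of an arbitrary type.
  Binding a variable is then the function update \<open>\<rho>(v := y)\<close>.\<close>

inductive env_poly :: "(('v \<Rightarrow> real) \<Rightarrow> real) \<Rightarrow> bool" where
  env_const: "env_poly (\<lambda>\<rho>. c)"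
| env_var: "env_poly (\<lambda>\<rho>. \<rho> v)"
| env_add: "env_poly p \<Longrightarrow> env_poly q \<Longrightarrow> env_poly (\<lambda>\<rho>. p \<rho> + q \<rho>)"
| env_mult: "env_poly p \<Longrightarrow> env_poly q \<Longrightarrow> env_poly (\<lambda>\<rho>. p \<rho> * q \<rho>)"

lemma env_diff: "env_poly p \<Longrightarrow> env_poly q \<Longrightarrow> env_poly (\<lambda>\<rho>. p \<rho> - q \<rho>)"
  using env_add[OF _ env_mult[OF env_const[of "-1"]], of p q] by simp

lemma env_if: "env_poly p \<Longrightarrow> env_poly q \<Longrightarrow> env_poly (\<lambda>\<rho>. if b then p \<rho> else q \<rho>)"
  by (cases b) auto

lemma env_sum: "(\<And>i. i \<in> I \<Longrightarrow> env_poly (f i)) \<Longrightarrow> env_poly (\<lambda>\<rho>. \<Sum>i\<in>I. f i \<rho>)"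
  by (induction I rule: infinite_finite_induct) (auto intro: env_const env_add)

lemma env_power: "env_poly p \<Longrightarrow> env_poly (\<lambda>\<rho>. p \<rho> ^ n)"
  by (induction n) (auto intro: env_const env_mult)

text \<open>\<open>d\<close> is a formal degree: the actual degree may drop at some parameters.\<close>

definition param_poly :: "nat \<Rightarrow> (('v \<Rightarrow> real) \<Rightarrow> real poly) \<Rightarrow> bool" where
  "param_poly d q \<longleftrightarrow> (\<forall>\<rho>. degree (q \<rho>) \<le> d) \<and> (\<forall>j. env_poly (\<lambda>\<rho>. coeff (q \<rho>) j))"

lemma param_poly_mono: "param_poly d q \<Longrightarrow> d \<le> d' \<Longrightarrow> param_poly d' q"
  unfolding param_poly_def using le_trans by blast

lemma param_poly_add: "param_poly d p \<Longrightarrow> param_poly d q \<Longrightarrow> param_poly d (\<lambda>\<rho>. p \<rho> + q \<rho>)"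
  unfolding param_poly_def by (auto intro: env_add degree_add_le)

lemma param_poly_diff: "param_poly d p \<Longrightarrow> param_poly d q \<Longrightarrow> param_poly d (\<lambda>\<rho>. p \<rho> - q \<rho>)"
  unfolding param_poly_def by (auto intro: env_diff degree_diff_le)

lemma param_poly_mult:
  assumes "param_poly d p" "param_poly e q"
  shows "param_poly (d + e) (\<lambda>\<rho>. p \<rho> * q \<rho>)"
proof -
  have "degree (p \<rho> * q \<rho>) \<le> d + e" for \<rho>
    using assms degree_mult_le[of "p \<rho>" "q \<rho>"] unfolding param_poly_def
    by (meson add_mono le_trans)
  then show ?thesis
    using assms unfolding param_poly_def coeff_mult by (auto intro!: env_sum env_mult)
qed

lemma param_poly_monom: "env_poly c \<Longrightarrow> param_poly n (\<lambda>\<rho>. monom (c \<rho>) n)"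
  unfolding param_poly_def by (auto simp: degree_monom_le intro: env_const env_if)

lemma param_poly_pderiv: "param_poly (Suc d) q \<Longrightarrow> param_poly d (\<lambda>\<rho>. pderiv (q \<rho>))"
  unfolding param_poly_def coeff_pderiv
  by (auto simp: degree_pderiv le_diff_conv intro: env_mult env_const)

lemma param_poly_cutoff: "param_poly d q \<Longrightarrow> param_poly e (\<lambda>\<rho>. poly_cutoff (Suc e) (q \<rho>))"
  unfolding param_poly_def coeff_poly_cutoff
  by (auto simp: coeff_poly_cutoff intro!: degree_le env_const env_if)

text \<open>Singles out the variable to be eliminated; the dependence on the others goes into the
  coefficients.\<close>

lemma param_poly_of_env_poly:
  assumes "env_poly p"
  shows "\<exists>d q. param_poly d q \<and> (\<forall>\<rho> y. p (\<rho>(v := y)) = poly (q \<rho>) y)"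
  using assms
proof induction
  case (env_const c)
  show ?case
    using param_poly_monom[OF env_poly.env_const[of c], of 0]
    by (intro exI[of _ 0] exI[of _ "\<lambda>\<rho>. monom c 0"]) (simp add: poly_monom)
next
  case (env_var w)
  show ?case
  proof (cases "w = v")
    case True
    then show ?thesis
      using param_poly_monom[OF env_poly.env_const[of 1], of 1]
      by (intro exI[of _ 1] exI[of _ "\<lambda>\<rho>. monom 1 1"]) (simp add: poly_monom)
  next
    case False
    then show ?thesis
      using param_poly_monom[OF env_poly.env_var[of w], of 0]
      by (intro exI[of _ 0] exI[of _ "\<lambda>\<rho>. monom (\<rho> w) 0"]) (simp add: poly_monom)
  qed
next
  case (env_add p1 p2)
  then obtain d q e r where *: "param_poly d q" "\<forall>\<rho> y. p1 (\<rho>(v := y)) = poly (q \<rho>) y"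
    "param_poly e r" "\<forall>\<rho> y. p2 (\<rho>(v := y)) = poly (r \<rho>) y" by blast
  then have "param_poly (max d e) (\<lambda>\<rho>. q \<rho> + r \<rho>)"
    by (auto intro!: param_poly_add elim: param_poly_mono)
  then show ?case using * by (metis poly_add)
next
  case (env_mult p1 p2)
  then obtain d q e r where *: "param_poly d q" "\<forall>\<rho> y. p1 (\<rho>(v := y)) = poly (q \<rho>) y"
    "param_poly e r" "\<forall>\<rho> y. p2 (\<rho>(v := y)) = poly (r \<rho>) y" by blast
  then show ?case using param_poly_mult[OF *(1,3)] by (metis poly_mult)
qed

text \<open>A pseudo-remainder in which \<open>p\<close> is only ever multiplied by squares of the leading coefficient of
  \<open>q\<close>, so that its sign at the roots of \<open>q\<close> is that of \<open>p\<close>.\<close>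

definition root_remainder ::
  "(('v \<Rightarrow> real) \<Rightarrow> real poly) \<Rightarrow> (('v \<Rightarrow> real) \<Rightarrow> real poly) \<Rightarrow> nat \<Rightarrow> (('v \<Rightarrow> real) \<Rightarrow> real poly) \<Rightarrow> bool" where
  "root_remainder p q k r \<longleftrightarrow> (\<forall>\<rho> x. degree (q \<rho>) = k \<longrightarrow> poly (q \<rho>) x = 0 \<longrightarrow>
     sgn (poly (p \<rho>) x) = sgn (poly (r \<rho>) x))"

text \<open>Division one degree at a time: while the formal degree of \<open>p\<close> exceeds
  \<open>e\<close>, its coefficient of degree \<open>Suc D\<close> is cancelled against the leading
  coefficient \<open>l\<close> of \<open>q\<close>. At a root of \<open>q\<close> the subtracted
  multiple vanishes, and the factor \<open>l * l\<close> is positive.\<close>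

lemma root_remainder_exists:
  assumes q: "param_poly dq q" and p: "param_poly D p"
  shows "\<exists>r. param_poly e r \<and> root_remainder p q (Suc e) r"
  using p
proof (induction D arbitrary: p)
  case 0
  then show ?case using param_poly_mono[of 0 p e] by (auto simp: root_remainder_def)
next
  case (Suc D)
  show ?case
  proof (cases "Suc D \<le> e")
    case True
    then show ?thesis using Suc.prems param_poly_mono[of "Suc D" p e] by (auto simp: root_remainder_def)
  next
    case False
    define l where "l \<rho> = coeff (q \<rho>) (Suc e)" for \<rho>
    define c where "c \<rho> = coeff (p \<rho>) (Suc D)" for \<rho>
    define t where "t \<rho> = monom (l \<rho> * l \<rho>) 0 * p \<rho> - monom (l \<rho> * c \<rho>) (D - e) * q \<rho>" for \<rho>
    \<comment> \<open>Where \<open>degree (q \<rho>) = Suc e\<close>, the cutoff removes only zero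
      coefficients; at other parameters it merely enforces the formal degree that the induction
      needs.\<close>
    define p1 where "p1 \<rho> = poly_cutoff (Suc D) (t \<rho>)" for \<rho>
    have lc: "env_poly l" "env_poly c"
      using q Suc.prems unfolding l_def c_def param_poly_def by auto
    have "param_poly (max (0 + Suc D) ((D - e) + dq)) t"
      unfolding t_def
      by (intro param_poly_diff; rule param_poly_mono[OF param_poly_mult], rule param_poly_monom)
        (use q Suc.prems lc in \<open>auto intro: env_mult\<close>)
    then have p1: "param_poly D p1" unfolding p1_def by (rule param_poly_cutoff)
    then obtain r where r: "param_poly e r" "root_remainder p1 q (Suc e) r"
      using Suc.IH by blast
    have "sgn (poly (p \<rho>) x) = sgn (poly (p1 \<rho>) x)"
      if d: "degree (q \<rho>) = Suc e" and x: "poly (q \<rho>) x = 0" for \<rho> x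
    proof -
      have l0: "l \<rho> \<noteq> 0" using d unfolding l_def by (metis degree_0 leading_coeff_0_iff nat.distinct(1))
      have "coeff (t \<rho>) j = 0" if "j \<ge> Suc D" for j
      proof (cases "j = Suc D")
        case True
        have "Suc D - (D - e) = Suc e" using False by auto
        then show ?thesis using True by (simp add: t_def coeff_monom_mult l_def c_def)
      next
        case neq: False
        then have "degree (p \<rho>) < j" "degree (q \<rho>) < j - (D - e)"
          using that d False Suc.prems le_less_trans[of "degree (p \<rho>)" "Suc D" j]
          by (auto simp: param_poly_def)
        then have "coeff (p \<rho>) j = 0" "coeff (q \<rho>) (j - (D - e)) = 0"
          by (auto intro!: coeff_eq_0)
        then show ?thesis by (simp add: t_def coeff_monom_mult)
      qed
      then have "p1 \<rho> = t \<rho>" unfolding p1_def by (auto simp: poly_eq_iff coeff_poly_cutoff)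
      then have "poly (p1 \<rho>) x = l \<rho> * l \<rho> * poly (p \<rho>) x"
        by (simp add: t_def x poly_monom)
      moreover have "sgn (l \<rho>) * sgn (l \<rho>) = 1" using l0 by (simp add: sgn_if)
      ultimately show ?thesis by (simp add: sgn_mult)
    qed
    then show ?thesis using r by (auto simp: root_remainder_def)
  qed
qed

text \<open>A remainder for the degree \<open>Suc k\<close> has formal degree at most
  \<open>k\<close>, so taking remainders modulo remainders comes to an end. One remainder is kept
  for each \<open>k\<close>, because the actual degree of \<open>q\<close> varies with the
  parameter.\<close>

lemma remainder_closure:
  assumes "finite P" "\<And>p. p \<in> P \<Longrightarrow> param_poly D p"
  shows "finite T \<Longrightarrow> (\<And>q. q \<in> T \<Longrightarrow> param_poly e q) \<Longrightarrow>
    \<exists>B. finite B \<and> T \<subseteq> B \<and> (\<forall>q\<in>B. param_poly e q) \<and>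
      (\<forall>p\<in>P. \<forall>q\<in>B. \<forall>k. \<exists>r\<in>B. root_remainder p q (Suc k) r)"
proof (induction e arbitrary: T)
  case 0
  \<comment> \<open>Formal degree 0 excludes \<open>degree (q \<rho>) = Suc k\<close>, so the
    condition is vacuous.\<close>
  have "root_remainder p q (Suc k) q" if "q \<in> T" for p q k
    using 0(2)[OF that] by (auto simp: root_remainder_def param_poly_def)
  then show ?case using 0 by blast
next
  case (Suc e)
  define rm where "rm p q k = (SOME r. param_poly k r \<and> root_remainder p q (Suc k) r)" for p q :: "('a \<Rightarrow> real) \<Rightarrow> real poly" and k
  have rm: "param_poly k (rm p q k)" "root_remainder p q (Suc k) (rm p q k)" if "p \<in> P" "q \<in> T" for p q k
    using someI_ex[OF root_remainder_exists[OF Suc.prems(2)[OF that(2)] assms(2)[OF that(1)], of k]]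
    unfolding rm_def by auto
  define R where "R = (\<lambda>(p, q, k). rm p q k) ` (P \<times> T \<times> {..e})"
  have "finite R" using assms(1) Suc.prems(1) by (auto simp: R_def)
  moreover have "param_poly e r" if "r \<in> R" for r
    using that rm(1) param_poly_mono by (fastforce simp: R_def)
  ultimately obtain B where B: "finite B" "R \<subseteq> B" "\<forall>q\<in>B. param_poly e q"
    "\<forall>p\<in>P. \<forall>q\<in>B. \<forall>k. \<exists>r\<in>B. root_remainder p q (Suc k) r"
    using Suc.IH by metis
  have "\<exists>r\<in>T \<union> B. root_remainder p q (Suc k) r" if pq: "p \<in> P" "q \<in> T" for p q k
  proof (cases "k \<le> e")
    case True
    then have "rm p q k \<in> R" unfolding R_def using pq by force
    then have "rm p q k \<in> B" using B(2) by blast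
    then show ?thesis using rm(2)[OF pq] by blast
  next
    case False
    then have "degree (q \<rho>) \<noteq> Suc k" for \<rho>
      using Suc.prems(2)[OF pq(2)] by (metis Suc_le_mono param_poly_def)
    then show ?thesis using pq by (auto simp: root_remainder_def)
  qed
  then show ?case
    using B Suc.prems param_poly_mono[of e _ "Suc e"]
    by (intro exI[of _ "T \<union> B"]) (auto; blast)
qed

lemma degree_cong_zeros:
  assumes "\<And>j. coeff a j = 0 \<longleftrightarrow> coeff b j = 0"
  shows "degree a = degree b"
  using assms by (simp add: degree_def)

text \<open>The induction step adds to \<open>T\<close> the derivatives and the iterated remainders, all of smaller formal degree,
  matches those first, and then restores the members of \<open>T\<close> one at a time.\<close>

theorem sign_matching_exists:
  "finite T \<Longrightarrow> (\<And>q. q \<in> T \<Longrightarrow> param_poly d q) \<Longrightarrow>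
    \<exists>C. finite C \<and> (\<forall>c\<in>C. env_poly c) \<and>
      (\<forall>\<rho> \<rho>'. (\<forall>c\<in>C. sgn (c \<rho>) = sgn (c \<rho>')) \<longrightarrow>
        (\<exists>\<phi>. order_auto \<phi> \<and> (\<forall>q\<in>T. \<forall>y. sgn (poly (q \<rho>) y) = sgn (poly (q \<rho>') (\<phi> y)))))"
proof (induction d arbitrary: T)
  case 0
  define C where "C = (\<lambda>q \<rho>. coeff (q \<rho>) 0) ` T"
  have "finite C" "\<forall>c\<in>C. env_poly c" using 0 by (auto simp: C_def param_poly_def)
  moreover have "sgn (poly (q \<rho>) y) = sgn (poly (q \<rho>') y)"
    if "\<forall>c\<in>C. sgn (c \<rho>) = sgn (c \<rho>')" "q \<in> T" for \<rho> \<rho>' q y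
  proof -
    have "degree (q \<rho>) = 0" "degree (q \<rho>') = 0" using 0(2)[OF that(2)] by (auto simp: param_poly_def)
    then have "poly (q \<rho>) y = coeff (q \<rho>) 0" "poly (q \<rho>') y = coeff (q \<rho>') 0"
      by (auto elim!: degree_eq_zeroE)
    then show ?thesis using that by (auto simp: C_def)
  qed
  ultimately show ?case
    by (intro exI[of _ C] conjI allI impI exI[of _ "\<lambda>x. x"] order_auto_id ballI) auto
next
  case (Suc d)
  define rm where "rm p q k = (SOME r. param_poly k r \<and> root_remainder p q (Suc k) r)" for p q :: "('a \<Rightarrow> real) \<Rightarrow> real poly" and k
  have rm: "param_poly k (rm p q k)" "root_remainder p q (Suc k) (rm p q k)" if "p \<in> T" "q \<in> T" for p q k
    using someI_ex[OF root_remainder_exists[OF Suc.prems(2)[OF that(2)] Suc.prems(2)[OF that(1)], of k]]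
    unfolding rm_def by auto
  define T0 where "T0 = (\<lambda>q \<rho>. pderiv (q \<rho>)) ` T \<union> (\<lambda>(p, q, k). rm p q k) ` (T \<times> T \<times> {..d})"
  have T0: "finite T0" using Suc.prems(1) by (auto simp: T0_def)
  have T0d: "param_poly d r" if "r \<in> T0" for r
    using that unfolding T0_def
  proof
    assume "r \<in> (\<lambda>q \<rho>. pderiv (q \<rho>)) ` T"
    then show ?thesis using param_poly_pderiv[OF Suc.prems(2)] by auto
  next
    assume "r \<in> (\<lambda>(p, q, k). rm p q k) ` (T \<times> T \<times> {..d})"
    then show ?thesis using param_poly_mono[OF rm(1)] by auto
  qed
  obtain B where B: "finite B" "T0 \<subseteq> B" "\<And>q. q \<in> B \<Longrightarrow> param_poly d q"
    "\<And>p q k. p \<in> T \<Longrightarrow> q \<in> B \<Longrightarrow> \<exists>r\<in>B. root_remainder p q (Suc k) r"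
    using remainder_closure[OF Suc.prems T0 T0d] by metis
  have closed: "\<exists>r\<in>B. root_remainder p q (Suc k) r" if "p \<in> T" "q \<in> T \<union> B" "k \<le> d" for p q k
  proof (cases "q \<in> B")
    case False
    then have "rm p q k \<in> T0" unfolding T0_def using that by force
    then have "rm p q k \<in> B" using B(2) by blast
    then show ?thesis using rm(2) that False by blast
  qed (use B(4) that in blast)
  obtain C0 where C0: "finite C0" "\<forall>c\<in>C0. env_poly c"
    "\<And>\<rho> \<rho>'. (\<forall>c\<in>C0. sgn (c \<rho>) = sgn (c \<rho>')) \<Longrightarrow>
        (\<exists>\<phi>. order_auto \<phi> \<and> (\<forall>q\<in>B. \<forall>y. sgn (poly (q \<rho>) y) = sgn (poly (q \<rho>') (\<phi> y))))"
    using Suc.IH[OF B(1,3)] by metis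
  \<comment> \<open>The signs of all coefficients are recorded as well: they determine, at each
    parameter, the actual degrees and the signs of the leading coefficients.\<close>
  define C where "C = C0 \<union> (\<lambda>(q, j) \<rho>. coeff (q \<rho>) j) ` ((T \<union> B) \<times> {..Suc d})"
  have TBd: "param_poly (Suc d) q" if "q \<in> T \<union> B" for q
    using that B(3) Suc.prems(2) param_poly_mono by (metis UnE le_SucI order_refl)
  have "finite C" using C0 B Suc.prems by (auto simp: C_def)
  moreover have "\<forall>c\<in>C. env_poly c" using C0 TBd by (fastforce simp: C_def param_poly_def)
  moreover have "\<exists>\<phi>. order_auto \<phi> \<and> (\<forall>q\<in>T. \<forall>y. sgn (poly (q \<rho>) y) = sgn (poly (q \<rho>') (\<phi> y)))"
    if agree: "\<forall>c\<in>C. sgn (c \<rho>) = sgn (c \<rho>')" for \<rho> \<rho>'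
  proof -
    have coeffs: "sgn (coeff (q \<rho>) j) = sgn (coeff (q \<rho>') j)" if q: "q \<in> T \<union> B" for q j
    proof (cases "j \<le> Suc d")
      case True
      then have "(\<lambda>\<rho>. coeff (q \<rho>) j) \<in> C" using q by (force simp: C_def)
      then show ?thesis using agree[THEN bspec, of "\<lambda>\<rho>. coeff (q \<rho>) j"] by simp
    next
      case False
      then have "coeff (q \<rho>) j = 0" "coeff (q \<rho>') j = 0"
        using TBd[OF q] unfolding param_poly_def by (metis coeff_eq_0 le_less_trans not_le)+
      then show ?thesis by simp
    qed
    have deg: "degree (q \<rho>) = degree (q \<rho>')" if "q \<in> T \<union> B" for q
      by (rule degree_cong_zeros) (metis coeffs[OF that] sgn_eq_0_iff)
    \<comment> \<open>The derivatives, and the remainders modulo members of \<open>T\<close> as well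
      as of \<open>B\<close>, all lie in \<open>B\<close>, so the members of \<open>T\<close> can be
      added in any order.\<close>
    have "\<exists>\<phi>. order_auto \<phi> \<and> (\<forall>q\<in>T1 \<union> B. \<forall>y. sgn (poly (q \<rho>) y) = sgn (poly (q \<rho>') (\<phi> y)))"
      if "finite T1" "T1 \<subseteq> T" for T1
      using that
    proof (induction T1 rule: finite_induct)
      case empty
      then show ?case using C0(3) agree by (auto simp: C_def)
    next
      case (insert p T1)
      then obtain \<phi> where \<phi>: "order_auto \<phi>"
        "\<And>q y. q \<in> T1 \<union> B \<Longrightarrow> sgn (poly (q \<rho>) y) = sgn (poly (q \<rho>') (\<phi> y))" by auto
      define A where "A = (\<lambda>q. (q \<rho>, q \<rho>')) ` (T1 \<union> B)"
      have pT: "p \<in> T" using insert by auto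
      have "\<exists>\<psi>. order_auto \<psi> \<and> (\<forall>(q, q')\<in>insert (p \<rho>, p \<rho>') A. \<forall>y. sgn (poly q y) = sgn (poly q' (\<psi> y)))"
      proof (rule extend_sign_matching[OF _ \<phi>(1)])
        show "finite A" using insert B by (auto simp: A_def)
        show "sgn (poly q y) = sgn (poly q' (\<phi> y))" if "(q, q') \<in> A" for q q' y
          using that \<phi>(2) by (auto simp: A_def)
        have "(\<lambda>\<rho>. pderiv (p \<rho>)) \<in> B" using B(2) pT by (auto simp: T0_def)
        then show "(pderiv (p \<rho>), pderiv (p \<rho>')) \<in> A" by (force simp: A_def)
        show dp: "degree (p \<rho>) = degree (p \<rho>')" using deg pT by auto
        show "sgn (lead_coeff (p \<rho>)) = sgn (lead_coeff (p \<rho>'))" using coeffs pT dp by auto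
        fix q q' x assume H: "(q, q') \<in> A" "q \<noteq> 0" "poly q x = 0"
        then obtain s where s: "s \<in> T1 \<union> B" "q = s \<rho>" "q' = s \<rho>'" by (auto simp: A_def)
        then have sTB: "s \<in> T \<union> B" using insert by auto
        \<comment> \<open>A nonzero polynomial with a root is not constant, so its degree has the
          form \<open>Suc k\<close> for which a remainder is at hand.\<close>
        have "degree q \<noteq> 0" using H(2,3) by (metis degree_eq_zeroE mult_zero_right pCons_eq_0_iff poly_pCons add.right_neutral poly_0)
        then obtain k where k: "degree q = Suc k" using not0_implies_Suc by blast
        then have "k \<le> d" using TBd[OF sTB] s by (metis Suc_le_mono param_poly_def)
        then obtain r where r: "r \<in> B" "root_remainder p s (Suc k) r" using closed[OF pT sTB] by blast
        have "poly q' (\<phi> x) = 0" using \<phi>(2)[OF s(1), of x] s H(3) by (simp add: sgn_0_0)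
        moreover have "degree q' = Suc k" using deg[OF sTB] s k by auto
        ultimately have "sgn (poly (p \<rho>') (\<phi> x)) = sgn (poly (r \<rho>') (\<phi> x))"
          using r(2) s by (auto simp: root_remainder_def)
        also have "\<dots> = sgn (poly (r \<rho>) x)" using \<phi>(2) r(1) by auto
        also have "\<dots> = sgn (poly (p \<rho>) x)" using r(2) s H k by (auto simp: root_remainder_def)
        finally show "sgn (poly (p \<rho>) x) = sgn (poly (p \<rho>') (\<phi> x))" by simp
      qed
      then show ?case by (auto simp: A_def)
    qed
    from this[OF Suc.prems(1) order_refl] show ?thesis by blast
  qed
  ultimately show ?case by (intro exI[of _ C]) simp
qed

text \<open>Equivalently, \<open>Q\<close> is a Boolean combination of polynomial sign conditions.\<close>

definition semialg :: "(('v \<Rightarrow> real) \<Rightarrow> bool) \<Rightarrow> bool" where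
  "semialg Q \<longleftrightarrow> (\<exists>C. finite C \<and> (\<forall>c\<in>C. env_poly c) \<and>
     (\<forall>\<rho> \<rho>'. (\<forall>c\<in>C. sgn (c \<rho>) = sgn (c \<rho>')) \<longrightarrow> Q \<rho> = Q \<rho>'))"

text \<open>The projection step of Tarski-Seidenberg: when the parameters satisfy the same sign
  conditions, the automorphism carries a witness \<open>y\<close> at \<open>\<rho>\<close> to the
  witness \<open>\<phi> y\<close> at \<open>\<rho>'\<close>; the converse follows by exchanging the
  two.\<close>

theorem semialg_ex:
  assumes "semialg Q"
  shows "semialg (\<lambda>\<rho>. \<exists>y. Q (\<rho>(v := y)))"
proof -
  obtain C where C: "finite C" "\<And>c. c \<in> C \<Longrightarrow> env_poly c"
    "\<And>\<rho> \<rho>'. (\<forall>c\<in>C. sgn (c \<rho>) = sgn (c \<rho>')) \<Longrightarrow> Q \<rho> = Q \<rho>'"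
    using assms unfolding semialg_def by metis
  have "\<exists>dq. param_poly (fst dq) (snd dq) \<and> (\<forall>\<rho> y. c (\<rho>(v := y)) = poly (snd dq \<rho>) y)"
    if "c \<in> C" for c
    using param_poly_of_env_poly[OF C(2)[OF that], of v] by simp
  then obtain dq where dq: "\<And>c. c \<in> C \<Longrightarrow> param_poly (fst (dq c)) (snd (dq c)) \<and>
      (\<forall>\<rho> y. c (\<rho>(v := y)) = poly (snd (dq c) \<rho>) y)"
    by metis
  define D where "D c = fst (dq c)" for c
  define q where "q c = snd (dq c)" for c
  have q: "\<And>c. c \<in> C \<Longrightarrow> param_poly (D c) (q c)"
    "\<And>c \<rho> y. c \<in> C \<Longrightarrow> c (\<rho>(v := y)) = poly (q c \<rho>) y"
    using dq by (auto simp: D_def q_def)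
  have "param_poly (Max (D ` C)) r" if "r \<in> q ` C" for r
    using that q(1) C(1) by (auto intro!: param_poly_mono[OF q(1)])
  from sign_matching_exists[OF finite_imageI[OF C(1)] this]
  obtain C' where C': "finite C'" "\<forall>c\<in>C'. env_poly c"
    "\<And>\<rho> \<rho>'. (\<forall>c\<in>C'. sgn (c \<rho>) = sgn (c \<rho>')) \<Longrightarrow>
        (\<exists>\<phi>. order_auto \<phi> \<and> (\<forall>r\<in>q ` C. \<forall>y. sgn (poly (r \<rho>) y) = sgn (poly (r \<rho>') (\<phi> y))))"
    by metis
  have imp: "\<exists>y. Q (\<rho>'(v := y))"
    if agree: "\<forall>c\<in>C'. sgn (c \<rho>) = sgn (c \<rho>')" and Q: "Q (\<rho>(v := y))" for \<rho> \<rho>' y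
  proof -
    obtain \<phi> where "\<forall>r\<in>q ` C. \<forall>y. sgn (poly (r \<rho>) y) = sgn (poly (r \<rho>') (\<phi> y))"
      using C'(3)[OF agree] by blast
    then have "\<forall>c\<in>C. sgn (c (\<rho>(v := y))) = sgn (c (\<rho>'(v := \<phi> y)))"
      using q(2) by auto
    then show ?thesis using C(3) Q by blast
  qed
  have "(\<exists>y. Q (\<rho>(v := y))) = (\<exists>y. Q (\<rho>'(v := y)))" if "\<forall>c\<in>C'. sgn (c \<rho>) = sgn (c \<rho>')" for \<rho> \<rho>'
    using imp[of \<rho> \<rho>'] imp[of \<rho>' \<rho>] that by auto
  then show ?thesis unfolding semialg_def using C'(1,2) by blast
qed

lemma semialg_ex_finite:
  assumes "finite V" "semialg Q"
  shows "semialg (\<lambda>\<rho>. \<exists>\<sigma>. (\<forall>v. v \<notin> V \<longrightarrow> \<sigma> v = \<rho> v) \<and> Q \<sigma>)"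
  using assms(1)
proof (induction V rule: finite_induct)
  case empty
  have "(\<lambda>\<rho>. \<exists>\<sigma>. (\<forall>v. v \<notin> {} \<longrightarrow> \<sigma> v = \<rho> v) \<and> Q \<sigma>) = Q"
    by (auto simp: fun_eq_iff[symmetric])
  then show ?case using assms(2) by simp
next
  case (insert w V)
  have "(\<lambda>\<rho>. \<exists>\<sigma>. (\<forall>v. v \<notin> insert w V \<longrightarrow> \<sigma> v = \<rho> v) \<and> Q \<sigma>) =
    (\<lambda>\<rho>. \<exists>y. \<exists>\<sigma>. (\<forall>v. v \<notin> V \<longrightarrow> \<sigma> v = (\<rho>(w := y)) v) \<and> Q \<sigma>)"
    by (intro ext) (auto split: if_splits; metis)
  then show ?case using semialg_ex[OF insert.IH, of w] by simp
qed

section \<open>Newton polygons\<close>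

lemma affine_sign_const:
  fixes a b u v :: real
  assumes "u \<le> v" "a + b * u > 0" "\<And>e. e \<in> {u..v} \<Longrightarrow> a + b * e \<noteq> 0"
  shows "a + b * v > 0"
proof (rule ccontr)
  assume "\<not> ?thesis"
  moreover have "continuous_on {u..v} (\<lambda>e. a + b * e)" by (intro continuous_intros)
  ultimately obtain e where "u \<le> e" "e \<le> v" "a + b * e = 0"
    using IVT2'[of "\<lambda>e. a + b * e" v 0 u] assms by auto
  then show False using assms(3) by auto
qed

text \<open>Makes the gap between the weights of two monomials uniform in \<open>e\<close>: it need
  only be checked at the ends of the interval.\<close>

lemma affine_ge_min:
  fixes a b u v e :: real
  assumes "u \<le> e" "e \<le> v"
  shows "min (a + b * u) (a + b * v) \<le> a + b * e"
proof (cases "b \<ge> 0")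
  case True
  then have "b * u \<le> b * e" using assms by (simp add: mult_left_mono)
  then show ?thesis by auto
next
  case False
  then have "b * v \<le> b * e" using assms by (simp add: mult_left_mono_neg)
  then show ?thesis by auto
qed

text \<open>For an exponent \<open>e\<close> that is not a slope of the Newton polygon, one monomial dominates all
  others along \<open>h = s powr e\<close>, and it stays the same between two consecutive slopes.\<close>

lemma bivariate_sgn_eventually_const:
  fixes I :: "(nat \<times> nat) set"
  assumes "finite I"
  shows "\<exists>E::real set. finite E \<and> (\<forall>u v. \<forall>c::nat \<times> nat \<Rightarrow> real. u \<le> v \<and> {u..v} \<inter> E = {} \<longrightarrow>
    (\<exists>s0>0. \<exists>b. \<forall>s e. 0 < s \<and> s < s0 \<and> u \<le> e \<and> e \<le> v \<longrightarrow>
      sgn (\<Sum>m\<in>I. c m * s ^ fst m * (s powr e) ^ snd m) = b))"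
proof -
  \<comment> \<open>The exponents \<open>e\<close> at which the weights of two monomials of
    \<open>I\<close> coincide. Only \<open>I\<close> enters, not the coefficients \<open>c\<close>.
    A pair with equal second components contributes the harmless value 0, by division by
    zero.\<close>
  define E :: "real set" where "E = (\<lambda>(m, n). (real (fst m) - real (fst n)) / (real (snd n) - real (snd m))) ` (I \<times> I)"
  have cross: "e \<in> E"
    if "m \<in> I" "n \<in> I" "m \<noteq> n" "real (fst m) + real (snd m) * e = real (fst n) + real (snd n) * e" for m n e
  proof -
    have "snd m \<noteq> snd n" using that(3,4) by (auto simp: prod_eq_iff)
    then have "e = (real (fst m) - real (fst n)) / (real (snd n) - real (snd m))"
      using that(4) by (simp add: field_simps)
    then show ?thesis using that(1,2) unfolding E_def by force
  qed
  have "\<exists>s0>0. \<exists>b. \<forall>s e. 0 < s \<and> s < s0 \<and> u \<le> e \<and> e \<le> v \<longrightarrow>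
      sgn (\<Sum>m\<in>I. c m * s ^ fst m * (s powr e) ^ snd m) = b"
    if uv: "u \<le> v" "{u..v} \<inter> E = {}" for u v and c :: "nat \<times> nat \<Rightarrow> real"
  proof -
    define M where "M = {m\<in>I. c m \<noteq> 0}"
    define w where "w m e = real (fst m) + real (snd m) * e" for m :: "nat \<times> nat" and e
    have finM: "finite M" using assms by (auto simp: M_def)
    have sumM: "(\<Sum>m\<in>I. c m * s ^ fst m * (s powr e) ^ snd m) = (\<Sum>m\<in>M. c m * s powr (w m e))"
      if "s > 0" for s e
    proof -
      have "(\<Sum>m\<in>I. c m * s ^ fst m * (s powr e) ^ snd m) = (\<Sum>m\<in>M. c m * s ^ fst m * (s powr e) ^ snd m)"
        by (rule sum.mono_neutral_right) (auto simp: M_def assms)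
      also have "\<dots> = (\<Sum>m\<in>M. c m * s powr (w m e))"
        using that by (intro sum.cong)
          (auto simp: w_def powr_add powr_realpow[symmetric] powr_powr mult.commute)
      finally show ?thesis .
    qed
    show ?thesis
    proof (cases "M = {}")
      case True
      then show ?thesis using sumM by (intro exI[of _ 1]) auto
    next
      case False
      \<comment> \<open>The monomial of least weight at \<open>u\<close> dominates as
        \<open>s\<close> tends to 0; since no two weights of \<open>M\<close> meet in
        \<open>{u..v}\<close>, it stays the least up to \<open>v\<close>.\<close>
      obtain k where k: "k \<in> M" "\<And>m. m \<in> M \<Longrightarrow> w k u \<le> w m u"
        using finM False by (meson arg_min_if_finite(1) arg_min_least)
      define D where "D m e = w m e - w k e" for m e
      have D: "D m e = (real (fst m) - real (fst k)) + (real (snd m) - real (snd k)) * e" for m e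
        by (simp add: D_def w_def algebra_simps)
      have D0: "D m e \<noteq> 0" if "m \<in> M - {k}" "e \<in> {u..v}" for m e
        using cross[of m k e] that k(1) uv(2) unfolding D_def w_def M_def by auto
      have Du: "D m u > 0" if "m \<in> M - {k}" for m
        using D0[OF that, of u] k(2)[of m] that uv(1) by (auto simp: D_def)
      have Dv: "D m v > 0" if "m \<in> M - {k}" for m
        using affine_sign_const[OF uv(1) Du[OF that, unfolded D] D0[OF that, unfolded D]] unfolding D .
      define \<eta> where "\<eta> = Min (insert 1 ((\<lambda>m. min (D m u) (D m v)) ` (M - {k})))"
      have \<eta>: "\<eta> > 0" unfolding \<eta>_def using finM Du Dv by (auto simp: Min_gr_iff)
      have \<eta>_le: "\<eta> \<le> min (D m u) (D m v)" if "m \<in> M - {k}" for m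
        unfolding \<eta>_def by (rule Min_le) (use finM that in auto)
      define K where "K = (\<Sum>m\<in>M - {k}. \<bar>c m\<bar>) + 1"
      have K: "K > 0" unfolding K_def by (smt (verit) sum_nonneg abs_ge_zero)
      have ck: "c k \<noteq> 0" using k by (auto simp: M_def)
      \<comment> \<open>Below \<open>s0\<close> the other terms, after division by the dominant
        power of \<open>s\<close>, add up to at most \<open>s powr \<eta> * K\<close>, which is less
        than \<open>\<bar>c k\<bar>\<close>.\<close>
      define s0 where "s0 = min 1 ((\<bar>c k\<bar> / K) powr (1 / \<eta>))"
      have "s0 > 0" using ck K by (auto simp: s0_def)
      moreover have "sgn (\<Sum>m\<in>I. c m * s ^ fst m * (s powr e) ^ snd m) = sgn (c k)"
        if s: "0 < s" "s < s0" and e: "u \<le> e" "e \<le> v" for s e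
      proof -
        have s1: "s < 1" "s < (\<bar>c k\<bar> / K) powr (1 / \<eta>)" using s by (auto simp: s0_def)
        have "s powr \<eta> < ((\<bar>c k\<bar> / K) powr (1 / \<eta>)) powr \<eta>"
          using s1 s \<eta> by (intro powr_less_mono2) auto
        then have "s powr \<eta> * K < \<bar>c k\<bar>"
          using \<eta> K ck by (simp add: powr_powr field_simps)
        define R where "R = (\<Sum>m\<in>M - {k}. c m * s powr (D m e))"
        have "\<bar>R\<bar> \<le> (\<Sum>m\<in>M - {k}. \<bar>c m\<bar> * s powr \<eta>)"
          unfolding R_def
        proof (rule order_trans[OF sum_abs], rule sum_mono)
          fix m assume m: "m \<in> M - {k}"
          have "\<eta> \<le> D m e" using \<eta>_le[OF m] affine_ge_min[OF e] unfolding D by (rule order_trans)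
          then have "s powr D m e \<le> s powr \<eta>" using s s1 by (intro powr_mono') auto
          then show "\<bar>c m * s powr D m e\<bar> \<le> \<bar>c m\<bar> * s powr \<eta>"
            by (simp add: abs_mult mult_left_mono)
        qed
        also have "\<dots> \<le> s powr \<eta> * K" by (simp add: K_def sum_distrib_right[symmetric] algebra_simps)
        also have "\<dots> < \<bar>c k\<bar>" by fact
        finally have R: "\<bar>R\<bar> < \<bar>c k\<bar>" .
        have "(\<Sum>m\<in>M. c m * s powr (w m e)) = c k * s powr (w k e) + (\<Sum>m\<in>M - {k}. c m * s powr (w m e))"
          using k(1) finM by (subst sum.remove[of _ k]) auto
        also have "(\<Sum>m\<in>M - {k}. c m * s powr (w m e)) = s powr (w k e) * R"
          unfolding R_def sum_distrib_left D_def
          using s by (intro sum.cong) (auto simp: powr_diff)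
        finally have "(\<Sum>m\<in>M. c m * s powr (w m e)) = s powr (w k e) * (c k + R)"
          by (simp add: algebra_simps)
        moreover have "sgn (c k + R) = sgn (c k)" using R by (auto simp: sgn_if)
        ultimately show ?thesis using sumM[OF s(1)] s(1) by (simp add: sgn_mult)
      qed
      ultimately show ?thesis by blast
    qed
  qed
  moreover have "finite E" using assms by (auto simp: E_def)
  ultimately show ?thesis by (intro exI[of _ E]) simp
qed

text \<open>The point is that \<open>I\<close> is fixed before \<open>\<rho>\<close>: the remaining
  variables affect only the coefficients, so the slopes found for \<open>I\<close> serve all base
  points and radii.\<close>

lemma env_poly_bivariate_expansion:
  assumes "env_poly p"
  shows "\<exists>I. finite I \<and> (\<forall>\<rho>. \<exists>c. \<forall>s h. p (\<rho>(H := h, S := s)) = (\<Sum>m\<in>I. c m * s ^ fst m * h ^ snd m))"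
proof -
  obtain d q where q: "param_poly d q" "\<And>\<rho> y. p (\<rho>(S := y)) = poly (q \<rho>) y"
    using param_poly_of_env_poly[OF assms] by metis
  have "\<exists>er. param_poly (fst er) (snd er) \<and> (\<forall>\<rho> y. coeff (q (\<rho>(H := y))) j = poly (snd er \<rho>) y)" for j
    using param_poly_of_env_poly[of "\<lambda>\<rho>. coeff (q \<rho>) j" H] q(1) unfolding param_poly_def by simp
  then obtain er where er: "\<And>j. param_poly (fst (er j)) (snd (er j))"
    "\<And>j \<rho> y. coeff (q (\<rho>(H := y))) j = poly (snd (er j) \<rho>) y" by metis
  define e where "e = Max ((\<lambda>j. fst (er j)) ` {..d})"
  define r where "r j = snd (er j)" for j
  have r: "degree (r j \<rho>) \<le> e" if "j \<le> d" for j \<rho>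
  proof -
    have "fst (er j) \<le> e" unfolding e_def using that by (auto intro!: Max_ge)
    then show ?thesis using er(1)[of j] unfolding r_def param_poly_def using le_trans by blast
  qed
  have sum_bound: "poly f x = (\<Sum>i\<le>n. coeff f i * x ^ i)" if "degree f \<le> n" for f :: "real poly" and x n
    unfolding poly_altdef using that
    by (intro sum.mono_neutral_left) (auto simp: coeff_eq_0)
  have "p (\<rho>(H := h, S := s)) = (\<Sum>m\<in>{..d} \<times> {..e}. coeff (r (fst m) \<rho>) (snd m) * s ^ fst m * h ^ snd m)"
    for \<rho> s h
  proof -
    have "p (\<rho>(H := h, S := s)) = (\<Sum>i\<le>d. coeff (q (\<rho>(H := h))) i * s ^ i)"
      unfolding q(2) using q(1) by (intro sum_bound) (auto simp: param_poly_def)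
    also have "\<dots> = (\<Sum>i\<le>d. (\<Sum>j\<le>e. coeff (r i \<rho>) j * h ^ j) * s ^ i)"
      unfolding er(2) r_def[symmetric] using r by (intro sum.cong refl arg_cong2[where f = "(*)"] sum_bound) auto
    also have "\<dots> = (\<Sum>i\<le>d. \<Sum>j\<le>e. coeff (r i \<rho>) j * s ^ i * h ^ j)"
      by (simp add: sum_distrib_left sum_distrib_right mult_ac)
    finally show ?thesis by (simp add: sum.cartesian_product case_prod_unfold)
  qed
  then show ?thesis by (intro exI[of _ "{..d} \<times> {..e}"]) auto
qed

text \<open>\<open>E\<close> collects the slopes of the finitely many polynomials behind
  \<open>Q\<close>. Between slopes and for small \<open>s\<close>, all their signs are those at one
  reference point, and \<open>Q\<close> depends on nothing else. That \<open>E\<close> precedes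
  \<open>\<rho>\<close> is what makes the final exponent uniform.\<close>

theorem semialg_eventually_const:
  assumes "semialg Q"
  shows "\<exists>E::real set. finite E \<and> (\<forall>\<rho> u v. u \<le> v \<and> {u..v} \<inter> E = {} \<longrightarrow>
    (\<exists>s0>0. \<exists>b. \<forall>s e. 0 < s \<and> s < s0 \<and> u \<le> e \<and> e \<le> v \<longrightarrow> Q (\<rho>(H := s powr e, S := s)) = b))"
proof -
  obtain C where C: "finite C" "\<And>c. c \<in> C \<Longrightarrow> env_poly c"
    "\<And>\<rho> \<rho>'. (\<forall>c\<in>C. sgn (c \<rho>) = sgn (c \<rho>')) \<Longrightarrow> Q \<rho> = Q \<rho>'"
    using assms unfolding semialg_def by metis
  have "\<exists>E::real set. finite E \<and> (\<forall>\<rho> u v. u \<le> v \<and> {u..v} \<inter> E = {} \<longrightarrow>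
    (\<exists>s0>0. \<exists>b. \<forall>s e. 0 < s \<and> s < s0 \<and> u \<le> e \<and> e \<le> v \<longrightarrow> sgn (p (\<rho>(H := s powr e, S := s))) = b))"
    if p: "p \<in> C" for p
  proof -
    obtain I where I: "finite I"
      "\<And>\<rho>. \<exists>c. \<forall>s h. p (\<rho>(H := h, S := s)) = (\<Sum>m\<in>I. c m * s ^ fst m * h ^ snd m)"
      using env_poly_bivariate_expansion[OF C(2)[OF p]] by metis
    obtain E :: "real set" where E: "finite E" "\<And>u v. \<And>c::nat \<times> nat \<Rightarrow> real. u \<le> v \<and> {u..v} \<inter> E = {} \<Longrightarrow>
      \<exists>s0>0. \<exists>b. \<forall>s e. 0 < s \<and> s < s0 \<and> u \<le> e \<and> e \<le> v \<longrightarrow>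
        sgn (\<Sum>m\<in>I. c m * s ^ fst m * (s powr e) ^ snd m) = b"
      using bivariate_sgn_eventually_const[OF I(1)] by blast
    show ?thesis
    proof (intro exI[of _ E] conjI allI impI E(1))
      fix \<rho> u v assume uv: "u \<le> v \<and> {u..v} \<inter> E = {}"
      obtain c where c: "\<And>s h. p (\<rho>(H := h, S := s)) = (\<Sum>m\<in>I. c m * s ^ fst m * h ^ snd m)"
        using I(2) by blast
      show "\<exists>s0>0. \<exists>b. \<forall>s e. 0 < s \<and> s < s0 \<and> u \<le> e \<and> e \<le> v \<longrightarrow> sgn (p (\<rho>(H := s powr e, S := s))) = b"
        unfolding c by (rule E(2)[OF uv])
    qed
  qed
  then obtain E :: "_ \<Rightarrow> real set" where E: "\<forall>p\<in>C. finite (E p) \<and>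
    (\<forall>\<rho> u v. u \<le> v \<and> {u..v} \<inter> E p = {} \<longrightarrow> (\<exists>s0>0. \<exists>b. \<forall>s e. 0 < s \<and> s < s0 \<and> u \<le> e \<and> e \<le> v \<longrightarrow>
      sgn (p (\<rho>(H := s powr e, S := s))) = b))"
    by (rule bchoice[OF ballI, THEN exE])
  have main: "\<exists>s0>0. \<exists>b. \<forall>s e. 0 < s \<and> s < s0 \<and> u \<le> e \<and> e \<le> v \<longrightarrow> Q (\<rho>(H := s powr e, S := s)) = b"
    if uv: "u \<le> v" "{u..v} \<inter> (\<Union>p\<in>C. E p) = {}" for \<rho> u v
  proof -
    have "\<exists>s0>0. \<exists>b. \<forall>s e. 0 < s \<and> s < s0 \<and> u \<le> e \<and> e \<le> v \<longrightarrow> sgn (p (\<rho>(H := s powr e, S := s))) = b"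
      if "p \<in> C" for p
      using E[rule_format, OF that, THEN conjunct2, rule_format, of u v \<rho>] uv that by blast
    then obtain s0 where s0: "\<forall>p\<in>C. s0 p > (0::real) \<and> (\<exists>b. \<forall>s e. 0 < s \<and> s < s0 p \<and> u \<le> e \<and> e \<le> v \<longrightarrow>
        sgn (p (\<rho>(H := s powr e, S := s))) = b)"
      by (rule bchoice[OF ballI, THEN exE])
    define t where "t = Min (insert 1 (s0 ` C))"
    have t: "t > 0" "\<And>p. p \<in> C \<Longrightarrow> t \<le> s0 p" unfolding t_def using C(1) s0 by auto
    have "Q (\<rho>(H := s powr e, S := s)) = Q (\<rho>(H := (t/2) powr u, S := t/2))"
      if "0 < s" "s < t" "u \<le> e" "e \<le> v" for s e
    proof (rule C(3), rule ballI)
      fix p assume p: "p \<in> C"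
      obtain b where b: "\<And>s e. 0 < s \<Longrightarrow> s < s0 p \<Longrightarrow> u \<le> e \<Longrightarrow> e \<le> v \<Longrightarrow>
          sgn (p (\<rho>(H := s powr e, S := s))) = b"
        using s0[rule_format, OF p] by blast
      show "sgn (p (\<rho>(H := s powr e, S := s))) = sgn (p (\<rho>(H := (t/2) powr u, S := t/2)))"
        using b[of s e] b[of "t/2" u] t(1) t(2)[OF p] that uv(1) by simp
    qed
    then show ?thesis using t(1) by blast
  qed
  show ?thesis
  proof (rule exI[of _ "\<Union>p\<in>C. E p"], rule conjI)
    show "finite (\<Union>p\<in>C. E p)" using C(1) E by auto
    show "\<forall>\<rho> u v. u \<le> v \<and> {u..v} \<inter> (\<Union>p\<in>C. E p) = {} \<longrightarrow>
      (\<exists>s0>0. \<exists>b. \<forall>s e. 0 < s \<and> s < s0 \<and> u \<le> e \<and> e \<le> v \<longrightarrow> Q (\<rho>(H := s powr e, S := s)) = b)"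
    proof (rule allI, rule allI, rule allI, rule impI, elim conjE)
      fix \<rho> u v assume "u \<le> v" "{u..v} \<inter> (\<Union>p\<in>C. E p) = {}"
      then show "\<exists>s0>0. \<exists>b. \<forall>s e. 0 < s \<and> s < s0 \<and> u \<le> e \<and> e \<le> v \<longrightarrow> Q (\<rho>(H := s powr e, S := s)) = b"
        by (rule main)
    qed
  qed
qed

section \<open>Uniform Lojasiewicz exponents of polynomials\<close>

lemma semialg_less: "env_poly p \<Longrightarrow> env_poly q \<Longrightarrow> semialg (\<lambda>\<rho>. p \<rho> < q \<rho>)"
  unfolding semialg_def
  by (intro exI[of _ "{\<lambda>\<rho>. q \<rho> - p \<rho>}"]) (auto intro: env_diff simp: sgn_if split: if_splits)

lemma semialg_eq: "env_poly p \<Longrightarrow> env_poly q \<Longrightarrow> semialg (\<lambda>\<rho>. p \<rho> = q \<rho>)"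
  unfolding semialg_def
  by (intro exI[of _ "{\<lambda>\<rho>. q \<rho> - p \<rho>}"]) (auto intro: env_diff simp: sgn_if split: if_splits)

lemma semialg_conj:
  assumes "semialg P" "semialg Q"
  shows "semialg (\<lambda>\<rho>. P \<rho> \<and> Q \<rho>)"
proof -
  obtain C D where "finite C" "\<forall>c\<in>C. env_poly c" "finite D" "\<forall>c\<in>D. env_poly c"
    "\<forall>\<rho> \<rho>'. (\<forall>c\<in>C. sgn (c \<rho>) = sgn (c \<rho>')) \<longrightarrow> P \<rho> = P \<rho>'"
    "\<forall>\<rho> \<rho>'. (\<forall>c\<in>D. sgn (c \<rho>) = sgn (c \<rho>')) \<longrightarrow> Q \<rho> = Q \<rho>'"
    using assms unfolding semialg_def by blast
  then show ?thesis unfolding semialg_def by (intro exI[of _ "C \<union> D"]) (simp add: ball_Un, blast)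
qed

lemma env_poly_of_poly_fun:
  "poly_fun p \<Longrightarrow> env_poly (\<lambda>\<rho>. p (\<chi> i. \<rho> (e i)))"
  by (induction rule: poly_fun.induct) (auto intro: env_poly.intros)

lemma poly_fun_sum: "(\<And>i. i \<in> I \<Longrightarrow> poly_fun (f i)) \<Longrightarrow> poly_fun (\<lambda>x. \<Sum>i\<in>I. f i x)"
  by (induction I rule: infinite_finite_induct) (auto intro: poly_fun.intros)

lemma poly_fun_has_derivative:
  assumes "poly_fun p"
  shows "\<exists>q. (\<forall>i. poly_fun (q i)) \<and> (\<forall>x. (p has_derivative (\<lambda>h. \<Sum>i\<in>UNIV. q i x * h $ i)) (at x))"
  using assms
proof induction
  case (const c)
  show ?case
    by (intro exI[of _ "\<lambda>i x. 0"]) (auto intro: poly_fun.intros)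
next
  case (coord j)
  have eq: "(\<lambda>h::real^'a. \<Sum>i\<in>UNIV. (if i = j then 1 else 0) * h $ i) = (\<lambda>h. h $ j)"
    by (auto simp: if_distrib[of "\<lambda>c. c * _"] cong: if_cong)
  have "((\<lambda>x::real^'a. x $ j) has_derivative (\<lambda>h. h $ j)) (at x)" for x
    by (rule bounded_linear.has_derivative[OF bounded_linear_vec_nth has_derivative_ident])
  then show ?case
    by (intro exI[of _ "\<lambda>i x. if i = j then 1 else 0"]) (auto simp: eq intro: poly_fun.intros)
next
  case (add p q)
  then obtain p' q' where *: "\<forall>i. poly_fun (p' i)" "\<And>x. (p has_derivative (\<lambda>h. \<Sum>i\<in>UNIV. p' i x * h $ i)) (at x)"
    "\<forall>i. poly_fun (q' i)" "\<And>x. (q has_derivative (\<lambda>h. \<Sum>i\<in>UNIV. q' i x * h $ i)) (at x)" by blast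
  have "((\<lambda>x. p x + q x) has_derivative (\<lambda>h. \<Sum>i\<in>UNIV. (p' i x + q' i x) * h $ i)) (at x)" for x
    using has_derivative_add[OF *(2,4)] by (simp add: sum.distrib algebra_simps)
  then show ?case
    using * by (intro exI[of _ "\<lambda>i x. p' i x + q' i x"]) (auto intro: poly_fun.intros)
next
  case (mult p q)
  then obtain p' q' where *: "\<forall>i. poly_fun (p' i)" "\<And>x. (p has_derivative (\<lambda>h. \<Sum>i\<in>UNIV. p' i x * h $ i)) (at x)"
    "\<forall>i. poly_fun (q' i)" "\<And>x. (q has_derivative (\<lambda>h. \<Sum>i\<in>UNIV. q' i x * h $ i)) (at x)" by blast
  have "((\<lambda>x. p x * q x) has_derivative (\<lambda>h. \<Sum>i\<in>UNIV. (p x * q' i x + p' i x * q x) * h $ i)) (at x)" for x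
    using has_derivative_mult[OF *(2,4)]
    by (simp add: sum.distrib algebra_simps sum_distrib_left sum_distrib_right)
  moreover have "poly_fun (\<lambda>x. p x * q' i x + p' i x * q x)" for i
    by (intro poly_fun.add poly_fun.mult mult.hyps *(1)[rule_format] *(3)[rule_format])
  ultimately show ?case
    by (intro exI[of _ "\<lambda>i x. p x * q' i x + p' i x * q x"]) blast
qed

lemma poly_fun_grad:
  assumes "poly_fun p" shows "poly_fun (\<lambda>x. grad p x $ i)"
proof -
  obtain q where q: "\<forall>i. poly_fun (q i)" "\<And>x. (p has_derivative (\<lambda>h. \<Sum>i\<in>UNIV. q i x * h $ i)) (at x)"
    using poly_fun_has_derivative[OF assms] by blast
  have "grad p x $ i = q i x" for x
    unfolding grad_def frechet_derivative_at[OF q(2), symmetric]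
    by (simp add: axis_def if_distrib[of "\<lambda>c. _ * c"] cong: if_cong)
  then show ?thesis using q(1) by simp
qed

text \<open>\<open>Base\<close> carries the coordinates of \<open>a\<close>, \<open>Point\<close>
  those of the point \<open>x\<close> to be eliminated. \<open>Radius\<close>, \<open>Value\<close>
  and \<open>Slope\<close> carry squares: of the radius, of \<open>f x - f a\<close> and of the
  gradient norm.\<close>

datatype 'm loj_var = Base 'm | Point 'm | Radius | Value | Slope

text \<open>Suppose the exponent \<open>\<mu>\<close> known at \<open>a\<close> exceeds
  \<open>u\<close>, and take \<open>v\<close> between \<open>\<mu>\<close> and 1. For small
  \<open>s\<close> no point near \<open>a\<close> has squared value difference \<open>s\<close> and
  squared slope \<open>s powr v\<close>; as \<open>{u..v}\<close> misses \<open>E\<close>, the same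
  holds for \<open>s powr e\<close> with any \<open>e\<close> in \<open>{u..v}\<close>. A squared
  slope above \<open>s powr v\<close> is therefore at least \<open>s powr u\<close>, which is the
  inequality with exponent \<open>u\<close>.\<close>

theorem poly_fun_uniform_loj_exponent:
  fixes f :: "real^'m \<Rightarrow> real"
  assumes f: "poly_fun f" and loj: "\<And>a. critical_point f a \<Longrightarrow> lojasiewicz_at f a"
  shows "\<exists>u>0. u < 1 \<and> (\<forall>a. critical_point f a \<longrightarrow> loj_exponent f a \<le> u)"
proof -
  define pt where "pt \<rho> = (\<chi> i. \<rho> (Point i))" for \<rho> :: "'m loj_var \<Rightarrow> real"
  define bs where "bs \<rho> = (\<chi> i. \<rho> (Base i))" for \<rho> :: "'m loj_var \<Rightarrow> real"
  define Q0 where "Q0 \<rho> \<longleftrightarrow> ((\<Sum>i\<in>UNIV. (\<rho> (Point i) - \<rho> (Base i))\<^sup>2) < \<rho> Radius \<and>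
    (f (pt \<rho>) - f (bs \<rho>))\<^sup>2 = \<rho> Value) \<and> (\<Sum>i\<in>UNIV. (grad f (pt \<rho>) $ i)\<^sup>2) = \<rho> Slope" for \<rho>
  define Q1 where "Q1 \<rho> \<longleftrightarrow> (\<exists>\<sigma>. (\<forall>v. v \<notin> range Point \<longrightarrow> \<sigma> v = \<rho> v) \<and> Q0 \<sigma>)" for \<rho>
  have "semialg Q0"
    unfolding Q0_def pt_def bs_def
    by (intro semialg_conj semialg_less semialg_eq env_sum env_power env_diff env_var
        env_poly_of_poly_fun f poly_fun_grad)
  moreover have "finite (range (Point :: 'm \<Rightarrow> _))" by simp
  ultimately have "semialg Q1" unfolding Q1_def by (intro semialg_ex_finite)
  from semialg_eventually_const[OF this, of Slope Value]
  obtain E :: "real set" where "finite E \<and> (\<forall>\<rho> u v. u \<le> v \<and> {u..v} \<inter> E = {} \<longrightarrow>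
    (\<exists>s0>0. \<exists>b. \<forall>s e. 0 < s \<and> s < s0 \<and> u \<le> e \<and> e \<le> v \<longrightarrow> Q1 (\<rho>(Slope := s powr e, Value := s)) = b))"
    by (rule exE)
  then have E: "finite E" and Ec: "\<And>\<rho> u v. u \<le> v \<and> {u..v} \<inter> E = {} \<Longrightarrow>
    \<exists>s0>0. \<exists>b. \<forall>s e. 0 < s \<and> s < s0 \<and> u \<le> e \<and> e \<le> v \<longrightarrow> Q1 (\<rho>(Slope := s powr e, Value := s)) = b"
    by simp_all
  \<comment> \<open>No member of \<open>E\<close> lies strictly between \<open>\<alpha>\<close> and
    1; inserting 1/2 keeps the set nonempty and its maximum positive.\<close>
  define \<alpha> where "\<alpha> = Max (insert (1/2) {e\<in>E. e < 1})"
  have "finite (insert (1/2) {e\<in>E. e < 1})" using E by simp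
  from Max_ge[OF this, of "1/2"] Max_ge[OF this] Max_in[OF this]
  have \<alpha>: "1/2 \<le> \<alpha>" "\<alpha> < 1" "\<And>e. e \<in> E \<Longrightarrow> e < 1 \<Longrightarrow> e \<le> \<alpha>"
    unfolding \<alpha>_def[symmetric] by auto
  define u where "u = (\<alpha> + 1) / 2"
  have u: "\<alpha> < u" "u < 1" "0 < u" using \<alpha> by (auto simp: u_def)
  have "loj_exponent f a \<le> u" if a: "critical_point f a" for a
  proof -
    define L where "L = {\<mu>. 0 < \<mu> \<and> \<mu> < 1 \<and> (\<exists>U C. open U \<and> a \<in> U \<and> C > 0 \<and>
      (\<forall>x\<in>U. \<bar>f x - f a\<bar> powr \<mu> \<le> C * norm (grad f x)))}"
    have inL: "loj_exponent f a \<le> \<mu>" if "\<mu> \<in> L" for \<mu>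
      unfolding loj_exponent_def using that
      by (intro cInf_lower) (auto simp: L_def intro!: bdd_belowI[of _ 0])
    obtain U \<mu> C where U: "open U" "a \<in> U" "0 < \<mu>" "\<mu> < 1" "C > 0"
      "\<And>x. x \<in> U \<Longrightarrow> \<bar>f x - f a\<bar> powr \<mu> \<le> C * norm (grad f x)"
      using loj[OF a] unfolding lojasiewicz_at_def by blast
    show ?thesis
    proof (cases "\<mu> \<le> u")
      case True
      have "\<mu> \<in> L" unfolding L_def using U by blast
      then show ?thesis using inL True by force
    next
      case False
      \<comment> \<open>Strictly above \<open>\<mu>\<close>, so that the factor
        \<open>C\<^sup>2\<close> is beaten for small \<open>s\<close>; strictly below 1, so that
        \<open>{u..v}\<close> misses \<open>E\<close>.\<close>
      define v where "v = (\<mu> + 1) / 2"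
      have v: "\<mu> < v" "v < 1" "u < v" using U False by (auto simp: v_def)
      have uvE: "u \<le> v \<and> {u..v} \<inter> E = {}" using v u \<alpha>(3) by fastforce
      obtain r where r: "r > 0" "ball a r \<subseteq> U" using U(1,2) open_contains_ball by blast
      define \<rho> where "\<rho> w = (case w of Base i \<Rightarrow> a $ i | Radius \<Rightarrow> r\<^sup>2 | _ \<Rightarrow> 0)" for w
      \<comment> \<open>Squaring both sides of the inequality keeps the exponent: it applies to
        \<open>\<bar>f x - f a\<bar>\<close> and the norm before, and to their squares
        after.\<close>
      have sqU: "(\<bar>f x - f a\<bar> powr e)\<^sup>2 = ((f x - f a)\<^sup>2) powr e" for x e
      proof -
        have "(\<bar>f x - f a\<bar> * \<bar>f x - f a\<bar>) powr e = \<bar>f x - f a\<bar> powr e * \<bar>f x - f a\<bar> powr e"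
          by (rule powr_mult)
        then show ?thesis by (simp add: power2_eq_square)
      qed
      have ineq: "((f x - f a)\<^sup>2) powr \<mu> \<le> C\<^sup>2 * (norm (grad f x))\<^sup>2" if "x \<in> ball a r" for x
        using power_mono[OF U(6), of x 2] that r(2) unfolding sqU[symmetric]
        by (auto simp: power_mult_distrib)
      have sumnorm: "(\<Sum>i\<in>UNIV. (z $ i)\<^sup>2) = (norm z)\<^sup>2" for z :: "real^'m"
        unfolding power2_norm_eq_inner inner_vec_def by (simp add: power2_eq_square)
      define P where "P s h \<longleftrightarrow> (\<exists>x\<in>ball a r. (f x - f a)\<^sup>2 = s \<and> (norm (grad f x))\<^sup>2 = h)" for s h
      have P_iff: "Q1 (\<rho>(Slope := h, Value := s)) = P s h" for s h
        unfolding Q1_def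
      proof
        assume "\<exists>\<sigma>. (\<forall>v. v \<notin> range Point \<longrightarrow> \<sigma> v = (\<rho>(Slope := h, Value := s)) v) \<and> Q0 \<sigma>"
        then obtain \<sigma> where \<sigma>: "\<And>v. v \<notin> range Point \<Longrightarrow> \<sigma> v = (\<rho>(Slope := h, Value := s)) v" "Q0 \<sigma>" by blast
        have "\<And>i. \<sigma> (Base i) = a $ i" "\<sigma> Radius = r\<^sup>2" "\<sigma> Value = s" "\<sigma> Slope = h"
          by (subst \<sigma>(1); force simp: \<rho>_def)+
        moreover from this have "bs \<sigma> = a" by (simp add: bs_def vec_eq_iff)
        ultimately have "(norm (pt \<sigma> - a))\<^sup>2 < r\<^sup>2" "(f (pt \<sigma>) - f a)\<^sup>2 = s" "(norm (grad f (pt \<sigma>)))\<^sup>2 = h"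
          using \<sigma>(2) unfolding Q0_def sumnorm[symmetric] by (auto simp: pt_def)
        moreover from this(1) have "norm (pt \<sigma> - a) < r" using r(1) by (simp add: power_less_imp_less_base)
        ultimately show "P s h" unfolding P_def by (auto simp: dist_norm norm_minus_commute)
      next
        assume "P s h"
        then obtain x where x: "x \<in> ball a r" "(f x - f a)\<^sup>2 = s" "(norm (grad f x))\<^sup>2 = h"
          unfolding P_def by blast
        define \<sigma> where "\<sigma> w = (case w of Point i \<Rightarrow> x $ i | _ \<Rightarrow> (\<rho>(Slope := h, Value := s)) w)" for w
        have "pt \<sigma> = x" "bs \<sigma> = a" by (auto simp: \<sigma>_def \<rho>_def pt_def bs_def vec_eq_iff)
        moreover have "(norm (x - a))\<^sup>2 < r\<^sup>2"
          using x(1) r(1) by (auto simp: dist_norm norm_minus_commute intro!: power_strict_mono)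
        then have "(\<Sum>i\<in>UNIV. (\<sigma> (Point i) - \<sigma> (Base i))\<^sup>2) < \<sigma> Radius"
          unfolding sumnorm[symmetric] by (simp add: \<sigma>_def \<rho>_def)
        ultimately have "Q0 \<sigma>"
          unfolding Q0_def sumnorm using x(2,3) by (simp add: \<sigma>_def)
        moreover have "\<sigma> w = (\<rho>(Slope := h, Value := s)) w" if "w \<notin> range Point" for w
          using that by (cases w) (auto simp: \<sigma>_def)
        ultimately show "\<exists>\<sigma>. (\<forall>v. v \<notin> range Point \<longrightarrow> \<sigma> v = (\<rho>(Slope := h, Value := s)) v) \<and> Q0 \<sigma>" by blast
      qed
      from Ec[OF uvE, of \<rho>] obtain s0 where "s0 > 0 \<and> (\<exists>b. \<forall>s e. 0 < s \<and> s < s0 \<and> u \<le> e \<and> e \<le> v \<longrightarrow> P s (s powr e) = b)"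
        unfolding P_iff by (rule exE)
      then obtain b where s0: "s0 > 0" "\<And>s e. 0 < s \<Longrightarrow> s < s0 \<Longrightarrow> u \<le> e \<Longrightarrow> e \<le> v \<Longrightarrow> P s (s powr e) = b"
        by (elim conjE exE) simp
      \<comment> \<open>The bound 1 makes \<open>ln s\<close> negative later on; the last bound
        yields \<open>C\<^sup>2 * s powr v < s powr \<mu>\<close>.\<close>
      define s1 where "s1 = min s0 (min 1 ((1 / C\<^sup>2) powr (1 / (v - \<mu>))))"
      have s1: "s1 > 0" using s0(1) U(5) by (auto simp: s1_def)
      have below: "C\<^sup>2 * s powr v < s powr \<mu>" if "0 < s" "s < s1" for s
      proof -
        have "s powr (v - \<mu>) < ((1 / C\<^sup>2) powr (1 / (v - \<mu>))) powr (v - \<mu>)"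
          using that v by (intro powr_less_mono2) (auto simp: s1_def)
        also have "\<dots> = 1 / C\<^sup>2" using v U(5) by (simp add: powr_powr)
        finally show ?thesis
          using that U(5) by (simp add: powr_diff field_simps)
      qed
      have nP: "\<not> P s (s powr e)" if "0 < s" "s < s1" "u \<le> e" "e \<le> v" for s e
      proof -
        have "\<not> P s (s powr v)"
        proof
          assume "P s (s powr v)"
          then have "s powr \<mu> \<le> C\<^sup>2 * s powr v" using ineq unfolding P_def by metis
          then show False using below[OF that(1,2)] by simp
        qed
        then show ?thesis using s0(2)[of s e] s0(2)[of s v] that v by (auto simp: s1_def)
      qed
      define G where "G = {x. (f x - f a)\<^sup>2 < s1}"
      have "continuous_on UNIV f"
        using poly_fun_has_derivative[OF f] by (blast intro: continuous_at_imp_continuous_on has_derivative_continuous)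
      then have "open G" unfolding G_def by (intro open_Collect_less continuous_intros) 
      moreover have "a \<in> G" using s1 by (simp add: G_def)
      moreover have "\<bar>f x - f a\<bar> powr u \<le> 1 * norm (grad f x)" if x: "x \<in> ball a r \<inter> G" for x
      proof (cases "f x = f a")
        case False
        define s where "s = (f x - f a)\<^sup>2"
        define h where "h = (norm (grad f x))\<^sup>2"
        have s: "0 < s" "s < s1" using x False by (auto simp: s_def G_def)
        have s_lt1: "s < 1" using s by (auto simp: s1_def)
        have "s powr \<mu> \<le> C\<^sup>2 * h" using ineq x by (simp add: s_def h_def)
        then have "C\<^sup>2 * s powr v < C\<^sup>2 * h" using below[OF s] by linarith
        then have hv: "s powr v < h" using U(5) by simp
        have "s powr u \<le> h"
        proof (rule ccontr)
          assume hu: "\<not> s powr u \<le> h"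
          \<comment> \<open>The exponent with \<open>s powr e = h\<close>; division by the negative
            \<open>ln s\<close> turns \<open>s powr v < h < s powr u\<close> into
            \<open>u \<le> e \<le> v\<close>.\<close>
          define e where "e = ln h / ln s"
          have h0: "h > 0" using hv powr_gt_zero[of s v] s by linarith
          have lns: "ln s < 0" using s s_lt1 by simp
          have "ln (s powr v) < ln h" "ln h < ln (s powr u)"
            using hv hu h0 s by (auto simp del: ln_powr)
          then have "u \<le> e" "e \<le> v"
            using lns s by (auto simp: e_def ln_powr field_simps)
          moreover have "s powr e = h" using h0 s lns by (simp add: e_def powr_def)
          moreover have "P s h" using x unfolding P_def s_def h_def by blast
          ultimately show False using nP[OF s] by auto
        qed
        then have "(\<bar>f x - f a\<bar> powr u)\<^sup>2 \<le> (norm (grad f x))\<^sup>2"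
          unfolding sqU s_def h_def .
        then show ?thesis unfolding mult_1 by (rule power2_le_imp_le) simp
      qed simp
      moreover have "open (ball a r \<inter> G)" using \<open>open G\<close> by auto
      moreover have "a \<in> ball a r \<inter> G" using \<open>a \<in> G\<close> r by auto
      ultimately have "u \<in> L"
        unfolding L_def using u by (intro CollectI conjI exI[of _ "ball a r \<inter> G"] exI[of _ 1]) simp_all
      then show ?thesis by (rule inL)
    qed
  qed
  then show ?thesis using u by blast
qed

section \<open>Symmetric matrices\<close>

lemma symmetric_inner:
  fixes A :: "real^'n^'n"
  assumes "transpose A = A"
  shows "(A *v x) \<bullet> y = x \<bullet> (A *v y)"
  using assms by (metis dot_lmul_matrix vector_transpose_matrix)

lemma nonneg_quadratic_imp_linear_zero:
  fixes b c :: real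
  assumes "\<And>t. 0 \<le> 2 * t * c + t\<^sup>2 * b" "0 \<le> b"
  shows "c = 0"
proof -
  \<comment> \<open>The minimiser of the quadratic would be \<open>- c / b\<close>;
    \<open>b + 1\<close> in the denominator also covers \<open>b = 0\<close>.\<close>
  define t where "t = - c / (b + 1)"
  have c: "c = - t * (b + 1)" using assms(2) by (simp add: t_def)
  have "0 \<le> 2 * t * c + t\<^sup>2 * b" by (rule assms(1))
  also have "\<dots> = - (t\<^sup>2 * (b + 2))" by (simp add: c algebra_simps power2_eq_square)
  finally have "t\<^sup>2 * (b + 2) \<le> 0" by simp
  then have "t = 0" using assms(2) by (auto simp: mult_le_0_iff)
  then show ?thesis using c by simp
qed

text \<open>A minimiser \<open>e\<close> of the Rayleigh quotient on the unit sphere of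
  \<open>S\<close>. Its residual \<open>z = A *v e - l *\<^sub>R e\<close> lies in \<open>S\<close>
  by invariance, so \<open>e\<close> may be varied in the direction \<open>z\<close>, and the
  first-order condition reads \<open>z \<bullet> z = 0\<close>.\<close>

lemma min_eigenvector:
  fixes A :: "real^'n^'n"
  assumes sym: "transpose A = A" and S: "subspace S" "S \<noteq> {0}"
    and inv: "\<And>x. x \<in> S \<Longrightarrow> A *v x \<in> S"
  shows "\<exists>e l. e \<in> S \<and> norm e = 1 \<and> A *v e = l *\<^sub>R e \<and> (\<forall>x\<in>S. l * (x \<bullet> x) \<le> x \<bullet> (A *v x))"
proof -
  define K where "K = S \<inter> sphere 0 1"
  have "compact K" unfolding K_def by (intro closed_Int_compact closed_subspace S compact_sphere)
  moreover obtain x0 where "x0 \<in> S" "x0 \<noteq> 0" using S subspace_0 by blast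
  then have "x0 /\<^sub>R norm x0 \<in> K" unfolding K_def using S(1) by (auto simp: subspace_scale)
  moreover have "continuous_on K (\<lambda>x. x \<bullet> (A *v x))"
    by (intro continuous_intros linear_continuous_on matrix_vector_mul_bounded_linear)
  ultimately obtain e where e: "e \<in> K" "\<And>x. x \<in> K \<Longrightarrow> e \<bullet> (A *v e) \<le> x \<bullet> (A *v x)"
    using continuous_attains_inf[of K "\<lambda>x. x \<bullet> (A *v x)"] by auto
  define l where "l = e \<bullet> (A *v e)"
  have eS: "e \<in> S" "norm e = 1" using e(1) by (auto simp: K_def)
  then have ee: "e \<bullet> e = 1" by (simp add: dot_square_norm)
  have min: "l * (x \<bullet> x) \<le> x \<bullet> (A *v x)" if "x \<in> S" for x
  proof (cases "x = 0")
    case False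
    then have "x /\<^sub>R norm x \<in> K" unfolding K_def using S(1) that by (auto simp: subspace_scale)
    from e(2)[OF this] have "l \<le> (x \<bullet> (A *v x)) / (norm x)\<^sup>2"
      by (simp add: l_def matrix_vector_mult_scaleR power2_eq_square divide_inverse mult_ac)
    then show ?thesis using False by (simp add: field_simps power2_norm_eq_inner)
  qed simp
  define z where "z = A *v e - l *\<^sub>R e"
  have zS: "z \<in> S" unfolding z_def using S(1) eS inv by (intro subspace_diff subspace_scale) auto
  have "z \<bullet> z = 0"
  proof (rule nonneg_quadratic_imp_linear_zero)
    show "0 \<le> z \<bullet> (A *v z) - l * (z \<bullet> z)" using min[OF zS] by simp
    fix t :: real
    have "e + t *\<^sub>R z \<in> S" using S(1) eS zS by (intro subspace_add subspace_scale) auto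
    from min[OF this] have "0 \<le> (e + t *\<^sub>R z) \<bullet> (A *v (e + t *\<^sub>R z)) - l * ((e + t *\<^sub>R z) \<bullet> (e + t *\<^sub>R z))"
      by simp
    also have "\<dots> = 2 * t * (z \<bullet> (A *v e) - l * (z \<bullet> e)) + t\<^sup>2 * (z \<bullet> (A *v z) - l * (z \<bullet> z))"
      using symmetric_inner[OF sym, of z e] ee l_def
      by (simp add: inner_left_distrib inner_right_distrib matrix_vector_right_distrib matrix_vector_mult_scaleR
          algebra_simps power2_eq_square inner_commute)
    also have "z \<bullet> (A *v e) - l * (z \<bullet> e) = z \<bullet> z" by (simp add: z_def inner_diff_right)
    finally show "0 \<le> 2 * t * (z \<bullet> z) + t\<^sup>2 * (z \<bullet> (A *v z) - l * (z \<bullet> z))" .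
  qed
  then show ?thesis using eS min by (auto simp: z_def)
qed

lemma eigenvectors_orthogonal:
  fixes A :: "real^'n^'n"
  assumes "transpose A = A" "A *v u = l *\<^sub>R u" "A *v v = m *\<^sub>R v" "l \<noteq> m"
  shows "u \<bullet> v = 0"
  using symmetric_inner[OF assms(1), of u v] assms(2-4) by simp

lemma unit_eigenvalue: "norm e = 1 \<Longrightarrow> A *v e = l *\<^sub>R e \<Longrightarrow> l \<in> eigenvalues_of A"
  unfolding eigenvalues_of_def by (auto intro!: exI[of _ e])

text \<open>Eigenvectors of distinct eigenvalues are orthogonal, hence independent. This makes
  \<open>minsp\<close> a minimum over a finite nonempty set, and the cardinality feeds the
  pigeonhole argument for the shifts.\<close>

lemma eigenvalues_of_symmetric:
  fixes A :: "real^'n^'n"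
  assumes sym: "transpose A = A"
  shows "finite (eigenvalues_of A)" "card (eigenvalues_of A) \<le> CARD('n)" "eigenvalues_of A \<noteq> {}"
proof -
  define ev where "ev l = (SOME v. v \<noteq> 0 \<and> A *v v = l *\<^sub>R v)" for l
  have ev: "ev l \<noteq> 0" "A *v ev l = l *\<^sub>R ev l" if "l \<in> eigenvalues_of A" for l
    using someI_ex[of "\<lambda>v. v \<noteq> 0 \<and> A *v v = l *\<^sub>R v"] that by (auto simp: ev_def eigenvalues_of_def)
  have orth: "ev l \<bullet> ev m = 0" if "l \<in> eigenvalues_of A" "m \<in> eigenvalues_of A" "l \<noteq> m" for l m
    using eigenvectors_orthogonal[OF sym ev(2) ev(2)] that by blast
  have inj: "inj_on ev (eigenvalues_of A)"
    by (rule inj_onI) (metis ev(1) inner_eq_zero_iff orth)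
  have "pairwise orthogonal (ev ` eigenvalues_of A)"
    unfolding pairwise_def orthogonal_def using orth by (metis imageE)
  moreover have "0 \<notin> ev ` eigenvalues_of A" using ev(1) by auto
  ultimately have "independent (ev ` eigenvalues_of A)" by (rule pairwise_orthogonal_independent)
  from independent_bound[OF this] show "finite (eigenvalues_of A)" "card (eigenvalues_of A) \<le> CARD('n)"
    using inj by (auto simp: card_image dest: finite_imageD)
  have "(UNIV :: (real^'n) set) \<noteq> {0}"
  proof
    assume "(UNIV :: (real^'n) set) = {0}"
    then have "(axis undefined 1 :: real^'n) = 0" by blast
    then show False by (simp add: axis_eq_0_iff)
  qed
  from min_eigenvector[OF sym subspace_UNIV this UNIV_I]
  obtain e l where "norm e = 1" "A *v e = l *\<^sub>R e" by blast
  then have "l \<in> eigenvalues_of A" by (rule unit_eigenvalue)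
  then show "eigenvalues_of A \<noteq> {}" by blast
qed

lemma minsp_le_iff:
  fixes A :: "real^'n^'n"
  assumes "transpose A = A"
  shows "c \<le> minsp A \<longleftrightarrow> (\<forall>l\<in>eigenvalues_of A. c \<le> \<bar>l\<bar>)"
  unfolding minsp_def using eigenvalues_of_symmetric[OF assms] by (subst Min_ge_iff) auto

lemma eigenvalues_of_shift:
  fixes A :: "real^'n^'n"
  shows "eigenvalues_of (A + t *\<^sub>R mat 1) = (\<lambda>l. l + t) ` eigenvalues_of A"
proof -
  have *: "(A + t *\<^sub>R mat 1) *v v = l *\<^sub>R v \<longleftrightarrow> A *v v = (l - t) *\<^sub>R v" for v l
    by (simp add: matrix_vector_mult_add_rdistrib scaleR_matrix_vector_assoc[symmetric] algebra_simps eq_diff_eq)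
  show ?thesis
  proof (intro set_eqI iffI)
    fix l assume "l \<in> eigenvalues_of (A + t *\<^sub>R mat 1)"
    then have "l - t \<in> eigenvalues_of A" unfolding eigenvalues_of_def * by blast
    then show "l \<in> (\<lambda>l. l + t) ` eigenvalues_of A" by (intro image_eqI[of _ _ "l - t"]) auto
  next
    fix l assume "l \<in> (\<lambda>l. l + t) ` eigenvalues_of A"
    then show "l \<in> eigenvalues_of (A + t *\<^sub>R mat 1)" unfolding eigenvalues_of_def * by auto
  qed
qed

lemma transpose_shift: "transpose A = A \<Longrightarrow> transpose (A + t *\<^sub>R mat 1) = A + t *\<^sub>R (mat 1 :: real^'n^'n)"
  by (simp add: transpose_def vec_eq_iff mat_def)

lemma minsp_shift_ge:
  fixes A :: "real^'n^'n"
  assumes "transpose A = A"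
  shows "minsp A - \<bar>t\<bar> \<le> minsp (A + t *\<^sub>R mat 1)"
proof -
  have "minsp A \<le> \<bar>l\<bar>" if "l \<in> eigenvalues_of A" for l
    using minsp_le_iff[OF assms, of "minsp A"] that by blast
  then show ?thesis
    unfolding minsp_le_iff[OF transpose_shift[OF assms]] eigenvalues_of_shift by fastforce
qed

text \<open>The span of the positive eigenvectors is invariant, so the least Rayleigh quotient
  \<open>l\<close> on it is an eigenvalue. An eigenvector in the span with \<open>l \<le> 0\<close>
  would be orthogonal to all generators and hence to itself; so \<open>l\<close> is positive and at
  least \<open>minsp A\<close>.\<close>

lemma pos_eigenspace_quadratic_ge:
  fixes A :: "real^'n^'n"
  assumes sym: "transpose A = A" and c: "c \<le> minsp A" and p: "p \<in> pos_eigenspace A"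
  shows "c * (p \<bullet> p) \<le> p \<bullet> (A *v p)"
proof (cases "pos_eigenspace A = {0}")
  case True
  then show ?thesis using p by simp
next
  case False
  define W where "W = {v. \<exists>l>0. A *v v = l *\<^sub>R v}"
  have PW: "pos_eigenspace A = span W" by (simp add: pos_eigenspace_def W_def)
  have "A *v x \<in> span W" if "x \<in> span W" for x
    using that
  proof (induction rule: span_induct_alt)
    case (step k x y)
    then obtain l where "A *v x = l *\<^sub>R x" unfolding W_def by blast
    then have "A *v x \<in> span W" using step(1) by (simp add: span_scale span_base)
    then show ?case using step by (simp add: matrix_vector_right_distrib matrix_vector_mult_scaleR span_add span_scale)
  qed (simp add: span_zero)
  then obtain e l where e: "e \<in> span W" "norm e = 1" "A *v e = l *\<^sub>R e"
    "\<And>x. x \<in> span W \<Longrightarrow> l * (x \<bullet> x) \<le> x \<bullet> (A *v x)"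
    using min_eigenvector[OF sym, of "span W"] False PW subspace_span by metis
  have "l > 0"
  proof (rule ccontr)
    assume "\<not> l > 0"
    then have "orthogonal e w" if "w \<in> W" for w
      using eigenvectors_orthogonal[OF sym e(3)] that unfolding W_def orthogonal_def by force
    then have "orthogonal e e" using orthogonal_to_span e(1) by blast
    then show False using e(2) by (simp add: orthogonal_def)
  qed
  have "l \<in> eigenvalues_of A" using e(2,3) by (rule unit_eigenvalue)
  then have "c \<le> l" using minsp_le_iff[OF sym, of c] c \<open>l > 0\<close> by fastforce
  then have "c * (p \<bullet> p) \<le> l * (p \<bullet> p)" by (simp add: mult_right_mono)
  also have "\<dots> \<le> p \<bullet> (A *v p)" using e(4) p PW by auto
  finally show ?thesis .
qed

lemma eigen_uminus_iff: "(- A) *v v = l *\<^sub>R v \<longleftrightarrow> A *v v = (- l) *\<^sub>R (v :: real^'n)"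
proof -
  have "(- A) *v v = - (A *v v)"
    by (simp add: matrix_vector_mult_def vec_eq_iff sum_negf)
  then show ?thesis by (metis minus_minus scaleR_minus_left)
qed

lemma eigenvalues_of_uminus: "eigenvalues_of (- A) = uminus ` eigenvalues_of A"
proof (intro set_eqI iffI)
  fix l assume "l \<in> eigenvalues_of (- A)"
  then have "- l \<in> eigenvalues_of A" unfolding eigenvalues_of_def eigen_uminus_iff by blast
  then show "l \<in> uminus ` eigenvalues_of A" by (intro image_eqI[of _ _ "- l"]) auto
next
  fix l assume "l \<in> uminus ` eigenvalues_of A"
  then show "l \<in> eigenvalues_of (- A)" unfolding eigenvalues_of_def eigen_uminus_iff by auto
qed

lemma neg_eigenspace_quadratic_le:
  fixes A :: "real^'n^'n"
  assumes sym: "transpose A = A" and c: "c \<le> minsp A" and q: "q \<in> neg_eigenspace A"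
  shows "q \<bullet> (A *v q) \<le> - c * (q \<bullet> q)"
proof -
  have symn: "transpose (- A) = - A" using sym by (simp add: transpose_def vec_eq_iff)
  have "c \<le> minsp (- A)"
    using c unfolding minsp_le_iff[OF sym] minsp_le_iff[OF symn] eigenvalues_of_uminus by auto
  moreover have "q \<in> pos_eigenspace (- A)"
  proof -
    have "{v. \<exists>l>0. - A *v v = l *\<^sub>R v} = {v. \<exists>l<0. A *v v = l *\<^sub>R v}"
    proof (intro Collect_cong iffI)
      fix v assume "\<exists>l>0. - A *v v = l *\<^sub>R v"
      then obtain l where "l > 0" "A *v v = (- l) *\<^sub>R v" unfolding eigen_uminus_iff by blast
      then show "\<exists>l<0. A *v v = l *\<^sub>R v" by (intro exI[of _ "- l"]) simp
    next
      fix v assume "\<exists>l<0. A *v v = l *\<^sub>R v"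
      then obtain l where "l < 0" "A *v v = l *\<^sub>R v" by blast
      then show "\<exists>l>0. - A *v v = l *\<^sub>R v" unfolding eigen_uminus_iff by (intro exI[of _ "- l"]) simp
    qed
    then show ?thesis using q unfolding pos_eigenspace_def neg_eigenspace_def by simp
  qed
  ultimately have "c * (q \<bullet> q) \<le> q \<bullet> ((- A) *v q)"
    by (rule pos_eigenspace_quadratic_ge[OF symn])
  also have "(- A) *v q = - (A *v q)"
    by (simp add: matrix_vector_mult_def vec_eq_iff sum_negf)
  finally show ?thesis by simp
qed

text \<open>The orthogonal complement of all eigenvectors with nonzero eigenvalue is invariant. If
  it were nontrivial it would contain an eigenvector, whose eigenvalue is nonzero because
  \<open>minsp A\<close> is positive, and which would then be orthogonal to itself.\<close>

lemma eigenspace_decomposition: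
  fixes A :: "real^'n^'n"
  assumes sym: "transpose A = A" and pos: "0 < minsp A"
  shows "\<exists>p q. p \<in> pos_eigenspace A \<and> q \<in> neg_eigenspace A \<and> v = p + q"
proof -
  define W where "W = {v. \<exists>l>0. A *v v = l *\<^sub>R v} \<union> {v. \<exists>l<0. A *v v = l *\<^sub>R v}"
  obtain y z where yz: "y \<in> span W" "\<And>w. w \<in> span W \<Longrightarrow> orthogonal z w" "v = y + z"
    using orthogonal_subspace_decomp_exists by blast
  define S where "S = {z. \<forall>w\<in>W. z \<bullet> w = 0}"
  have "S = {0}"
  proof (rule ccontr)
    assume ne: "S \<noteq> {0}"
    have "subspace S" unfolding S_def subspace_def by (auto simp: inner_left_distrib)
    moreover have "A *v x \<in> S" if "x \<in> S" for x
    proof -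
      have "x \<bullet> (A *v w) = 0" if w: "w \<in> W" for w
      proof -
        obtain l where "A *v w = l *\<^sub>R w" using w unfolding W_def by blast
        then show ?thesis using \<open>x \<in> S\<close> w unfolding S_def by simp
      qed
      then show ?thesis unfolding S_def by (simp add: symmetric_inner[OF sym])
    qed
    ultimately obtain e l where e: "e \<in> S" "norm e = 1" "A *v e = l *\<^sub>R e"
      using min_eigenvector[OF sym _ ne] by blast
    have "l \<in> eigenvalues_of A" using e(2,3) by (rule unit_eigenvalue)
    then have "l \<noteq> 0" using minsp_le_iff[OF sym, of "minsp A"] pos by fastforce
    then have "e \<in> W" using e(3) unfolding W_def by (cases "l > 0") (auto intro!: exI[of _ l])
    then have "e \<bullet> e = 0" using e(1) unfolding S_def by blast
    then show False using e(2) by simp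
  qed
  moreover have "z \<in> S" using yz(2) span_base unfolding S_def orthogonal_def by blast
  ultimately have "v \<in> span W" using yz by auto
  then show ?thesis unfolding W_def span_Un pos_eigenspace_def neg_eigenspace_def by blast
qed

lemma pos_neg_eigenspace_orthogonal:
  fixes A :: "real^'n^'n"
  assumes sym: "transpose A = A" and "p \<in> pos_eigenspace A" "q \<in> neg_eigenspace A"
  shows "p \<bullet> q = 0"
proof -
  have *: "orthogonal w q" if "w \<in> {v. \<exists>l>0. A *v v = l *\<^sub>R v}" for w
  proof (rule orthogonal_to_span[OF assms(3)[unfolded neg_eigenspace_def]])
    fix y assume "y \<in> {v. \<exists>l<0. A *v v = l *\<^sub>R v}"
    then show "orthogonal w y"
      using that eigenvectors_orthogonal[OF sym] unfolding orthogonal_def by force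
  qed
  have "orthogonal q p"
    by (rule orthogonal_to_span[OF assms(2)[unfolded pos_eigenspace_def]])
      (use * orthogonal_commute in blast)
  then show ?thesis by (simp add: orthogonal_def inner_commute)
qed

lemma orth_proj_eqI:
  assumes "subspace S" "u \<in> S" "\<And>s. s \<in> S \<Longrightarrow> (v - u) \<bullet> s = 0"
  shows "orth_proj S v = u"
  unfolding orth_proj_def
proof (rule the_equality)
  fix u' assume u': "u' \<in> S \<and> (\<forall>s\<in>S. (v - u') \<bullet> s = 0)"
  then have "u - u' \<in> S" using assms subspace_diff by blast
  then have "(v - u') \<bullet> (u - u') - (v - u) \<bullet> (u - u') = 0" using assms(3) u' by simp
  then show "u' = u" by (simp add: inner_diff_left[symmetric])
qed (use assms in auto)

text \<open>With \<open>v = p + q\<close> and \<open>w = p - q\<close> the mixed terms of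
  \<open>w \<bullet> (A *v v)\<close> cancel by symmetry, and the negative part enters with its sign
  reversed. The second claim later bounds \<open>norm g\<close> by a multiple of
  \<open>norm w\<close>.\<close>

lemma reflected_direction:
  fixes A :: "real^'n^'n" and g :: "real^'n"
  assumes sym: "transpose A = A" and pos: "0 < minsp A"
  defines "w \<equiv> pr_pos A (matrix_inv A *v g) - pr_neg A (matrix_inv A *v g)"
  shows "minsp A * (w \<bullet> w) \<le> w \<bullet> g" "\<exists>v. A *v v = g \<and> norm v = norm w"
proof -
  define v where "v = matrix_inv A *v g"
  have "x = 0" if "A *v x = 0" for x
  proof (rule ccontr)
    assume "x \<noteq> 0"
    then have "0 \<in> eigenvalues_of A" using that unfolding eigenvalues_of_def by auto
    then show False using minsp_le_iff[OF sym, of "minsp A"] pos by auto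
  qed
  then have "invertible A"
    using invertible_left_inverse matrix_left_invertible_ker by blast
  then have "A ** matrix_inv A = mat 1"
    unfolding invertible_def matrix_inv_def by (rule someI2_ex) blast
  then have g: "A *v v = g"
    by (simp add: v_def matrix_vector_mul_assoc)
  obtain p q where pq: "p \<in> pos_eigenspace A" "q \<in> neg_eigenspace A" "v = p + q"
    using eigenspace_decomposition[OF sym pos] by blast
  have orth: "p' \<bullet> q' = 0" if "p' \<in> pos_eigenspace A" "q' \<in> neg_eigenspace A" for p' q'
    using pos_neg_eigenspace_orthogonal[OF sym that] .
  have "pr_pos A v = p"
    unfolding pr_pos_def using pq orth
    by (intro orth_proj_eqI) (auto simp: pos_eigenspace_def inner_commute)
  moreover have "pr_neg A v = q"
    unfolding pr_neg_def using pq orth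
    by (intro orth_proj_eqI) (auto simp: neg_eigenspace_def)
  ultimately have w: "w = p - q" by (simp add: w_def v_def)
  have pq0: "p \<bullet> q = 0" using orth pq by blast
  have ww: "w \<bullet> w = p \<bullet> p + q \<bullet> q" "v \<bullet> v = p \<bullet> p + q \<bullet> q"
    using pq0 by (auto simp: w pq(3) inner_diff_left inner_diff_right inner_left_distrib inner_right_distrib inner_commute)
  have "w \<bullet> g = p \<bullet> (A *v p) - q \<bullet> (A *v q)"
    using symmetric_inner[OF sym, of p q]
    by (simp add: w g[symmetric] pq(3) matrix_vector_right_distrib inner_diff_left inner_right_distrib)
      (simp add: inner_commute)
  then show "minsp A * (w \<bullet> w) \<le> w \<bullet> g"
    using pos_eigenspace_quadratic_ge[OF sym order_refl pq(1)] neg_eigenspace_quadratic_le[OF sym order_refl pq(2)]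
    by (simp add: ww algebra_simps)
  have "norm w = norm v" using ww by (simp add: norm_eq_sqrt_inner)
  then show "\<exists>v. A *v v = g \<and> norm v = norm w" using g by metis
qed

section \<open>The squared norm of a twice continuously differentiable map\<close>

lemma matrix_works_real: "linear f \<Longrightarrow> matrix f *v x = f (x :: real^'m)"
  by (simp add: matrix_works linear_matrix_vector_mul_eq)

lemma sqnorm_fun_grad:
  fixes F :: "real^'m \<Rightarrow> real^'k"
  assumes "F differentiable (at x)"
  shows "grad (sqnorm_fun F) x = 2 *\<^sub>R (transpose (jac F x) *v F x)"
    and "(sqnorm_fun F has_derivative (\<lambda>h. grad (sqnorm_fun F) x \<bullet> h)) (at x)"
proof -
  define G where "G = 2 *\<^sub>R (transpose (jac F x) *v F x)"
  have F': "(F has_derivative frechet_derivative F (at x)) (at x)"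
    using assms frechet_derivative_works by blast
  have J: "frechet_derivative F (at x) h = jac F x *v h" for h
    unfolding jac_def by (simp add: matrix_works_real[OF has_derivative_linear[OF F']])
  have eq: "sqnorm_fun F = (\<lambda>x. F x \<bullet> F x)" by (auto simp: sqnorm_fun_def power2_norm_eq_inner)
  have "F x \<bullet> (jac F x *v h) = (transpose (jac F x) *v F x) \<bullet> h" for h
    by (metis dot_lmul_matrix transpose_matrix_vector)
  then have der: "(sqnorm_fun F has_derivative (\<lambda>h. G \<bullet> h)) (at x)"
    using has_derivative_inner[OF F' F'] unfolding eq J by (simp add: G_def inner_commute)
  have "grad (sqnorm_fun F) x = G"
    unfolding grad_def frechet_derivative_at[OF der, symmetric]
    by (simp add: vec_eq_iff inner_axis)
  then show "grad (sqnorm_fun F) x = 2 *\<^sub>R (transpose (jac F x) *v F x)"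
    "(sqnorm_fun F has_derivative (\<lambda>h. grad (sqnorm_fun F) x \<bullet> h)) (at x)"
    using der by (simp_all add: G_def)
qed

lemma bounded_bilinear_transpose_mult:
  "bounded_bilinear (\<lambda>(A::real^'m^'k) y. transpose A *v y)"
proof -
  have t: "transpose (A + B) = transpose A + transpose B" "transpose (c *\<^sub>R A) = c *\<^sub>R transpose A" for A B :: "real^'m^'k" and c
    by (simp_all add: transpose_def vec_eq_iff)
  have "bilinear (\<lambda>(A::real^'m^'k) y. transpose A *v y)"
    unfolding bilinear_def
    by (auto intro!: linearI simp: t matrix_vector_mult_add_rdistrib matrix_vector_right_distrib
        matrix_vector_mult_scaleR scaleR_matrix_vector_assoc simp del: transpose_matrix_vector)
  then show ?thesis by (simp add: bilinear_conv_bounded_bilinear)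
qed

lemma C2_map_grad:
  fixes F :: "real^'m \<Rightarrow> real^'k"
  assumes C2: "C2_map F"
  shows "grad (sqnorm_fun F) differentiable (at x)"
    and "continuous_on UNIV (\<lambda>x. frechet_derivative (grad (sqnorm_fun F)) (at x) h)"
proof -
  interpret bb: bounded_bilinear "\<lambda>(A::real^'m^'k) y. transpose A *v y"
    by (rule bounded_bilinear_transpose_mult)
  have dF: "F differentiable (at x)" and dJ: "jac F differentiable (at x)"
    and cJ: "continuous_on UNIV (\<lambda>x. frechet_derivative (jac F) (at x) v)" for x v
    using C2 by (auto simp: C2_map_def)
  have F': "(F has_derivative (\<lambda>h. jac F x *v h)) (at x)" for x
  proof -
    have "(F has_derivative frechet_derivative F (at x)) (at x)" using dF frechet_derivative_works by blast
    moreover from this have "frechet_derivative F (at x) = (\<lambda>h. jac F x *v h)"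
      unfolding jac_def by (intro ext) (simp add: matrix_works_real[OF has_derivative_linear])
    ultimately show ?thesis by simp
  qed
  have J': "(jac F has_derivative frechet_derivative (jac F) (at x)) (at x)" for x
    using dJ frechet_derivative_works by blast
  have G: "grad (sqnorm_fun F) = (\<lambda>x. 2 *\<^sub>R (transpose (jac F x) *v F x))"
    using sqnorm_fun_grad(1)[OF dF] by auto
  have G': "(grad (sqnorm_fun F) has_derivative (\<lambda>h. 2 *\<^sub>R (transpose (jac F x) *v (jac F x *v h)
     + transpose (frechet_derivative (jac F) (at x) h) *v F x))) (at x)" for x
    unfolding G by (intro has_derivative_scaleR_right bb.FDERIV J' F')
  then show "grad (sqnorm_fun F) differentiable (at x)" unfolding differentiable_def by blast
  have cF: "continuous_on UNIV F" and cJF: "continuous_on UNIV (jac F)"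
    using differentiable_imp_continuous_within[OF dF] differentiable_imp_continuous_within[OF dJ]
    by (simp_all add: continuous_at_imp_continuous_on)
  have "linear (\<lambda>A::real^'m^'k. A *v h)"
    by (auto intro!: linearI simp: matrix_vector_mult_add_rdistrib scaleR_matrix_vector_assoc)
  then have cJh: "continuous_on UNIV (\<lambda>x. jac F x *v h)"
    using linear_continuous_on_compose[OF cJF] by blast
  show "continuous_on UNIV (\<lambda>x. frechet_derivative (grad (sqnorm_fun F)) (at x) h)"
    unfolding frechet_derivative_at[OF G', symmetric]
    by (intro continuous_intros bb.continuous_on cF cJF cJh cJ)
qed

text \<open>The second difference of \<open>f\<close> is symmetric in \<open>u\<close> and
  \<open>v\<close>, and divided by \<open>t\<^sup>2\<close> it tends to both sides of the equation.
  The mean value theorem reduces it to a difference of values of \<open>G\<close>, for which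
  differentiability at \<open>a\<close> alone suffices.\<close>

lemma second_derivative_symmetric:
  fixes f :: "'a::euclidean_space \<Rightarrow> real"
  assumes f: "\<And>x. (f has_derivative (\<lambda>h. G x \<bullet> h)) (at x)"
    and G: "(G has_derivative G') (at a)"
  shows "G' u \<bullet> v = G' v \<bullet> u"
proof -
  define D where "D t = f (a + t *\<^sub>R u + t *\<^sub>R v) - f (a + t *\<^sub>R u) - f (a + t *\<^sub>R v) + f a" for t
  \<comment> \<open>Proved for arbitrary \<open>u\<close> and \<open>v\<close>, to be applied a
    second time with the two exchanged.\<close>
  have lim: "((\<lambda>t. D t / t\<^sup>2) \<longlongrightarrow> G' v \<bullet> u) (at_right 0)"
    if D: "\<And>t. D t = f (a + t *\<^sub>R u + t *\<^sub>R v) - f (a + t *\<^sub>R u) - f (a + t *\<^sub>R v) + f a" for D u v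
  proof (rule tendstoI)
    fix e :: real assume e: "e > 0"
    \<comment> \<open>The remainders \<open>r1\<close> and \<open>r2\<close> contribute
      \<open>norm u + norm v\<close> and \<open>norm u\<close>; the added 1 keeps \<open>K\<close>
      positive when \<open>u = 0\<close>.\<close>
    define K where "K = norm u * (2 * norm u + norm v) + 1"
    have K: "K > 0" unfolding K_def by (simp add: add_nonneg_pos)
    define \<epsilon> where "\<epsilon> = e / (2 * K)"
    have \<epsilon>: "\<epsilon> > 0" using e K by (simp add: \<epsilon>_def)
    interpret G': bounded_linear G' by (rule has_derivative_bounded_linear[OF G])
    obtain d where d: "d > 0" "\<And>y. norm (y - a) < d \<Longrightarrow> norm (G y - G a - G' (y - a)) \<le> \<epsilon> * norm (y - a)"
      using G[unfolded has_derivative_at_alt] \<epsilon> by blast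
    have "dist (D t / t\<^sup>2) (G' v \<bullet> u) < e" if t: "t > 0" "t * (norm u + norm v + 1) < d" for t
    proof -
      define \<phi> where "\<phi> s = f (a + s *\<^sub>R u + t *\<^sub>R v) - f (a + s *\<^sub>R u)" for s
      have "(\<phi> has_derivative (\<lambda>h. G (a + s *\<^sub>R u + t *\<^sub>R v) \<bullet> (h *\<^sub>R u) - G (a + s *\<^sub>R u) \<bullet> (h *\<^sub>R u))) (at s)" for s
        unfolding \<phi>_def
        by (rule has_derivative_diff; rule has_derivative_compose[OF _ f]; auto intro!: derivative_eq_intros)
      then obtain s where s: "0 < s" "s < t"
        and "\<phi> t - \<phi> 0 = G (a + s *\<^sub>R u + t *\<^sub>R v) \<bullet> (t *\<^sub>R u) - G (a + s *\<^sub>R u) \<bullet> (t *\<^sub>R u)"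
        using mvt_simple[OF t(1), of \<phi> "\<lambda>s h. G (a + s *\<^sub>R u + t *\<^sub>R v) \<bullet> (h *\<^sub>R u) - G (a + s *\<^sub>R u) \<bullet> (h *\<^sub>R u)"]
          has_derivative_at_withinI by (metis (no_types, lifting) diff_zero greaterThanLessThan_iff)
      then have Dt: "D t = t * ((G (a + s *\<^sub>R u + t *\<^sub>R v) - G (a + s *\<^sub>R u)) \<bullet> u)"
        by (simp add: \<phi>_def D inner_diff_left right_diff_distrib)
      define r1 where "r1 = G (a + s *\<^sub>R u + t *\<^sub>R v) - G a - G' (s *\<^sub>R u + t *\<^sub>R v)"
      define r2 where "r2 = G (a + s *\<^sub>R u) - G a - G' (s *\<^sub>R u)"
      have n1: "norm (s *\<^sub>R u + t *\<^sub>R v) \<le> t * (norm u + norm v)"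
      proof -
        have "norm (s *\<^sub>R u + t *\<^sub>R v) \<le> s * norm u + t * norm v"
          using norm_triangle_ineq[of "s *\<^sub>R u" "t *\<^sub>R v"] s t by simp
        also have "\<dots> \<le> t * (norm u + norm v)" using s by (simp add: distrib_left mult_right_mono)
        finally show ?thesis .
      qed
      have n2: "norm (s *\<^sub>R u) \<le> t * norm u" using s by (simp add: mult_right_mono)
      have tv: "0 \<le> t * norm v" using t by simp
      have td: "t * (norm u + norm v) < d" "t * norm u < d"
        using t(1) t(2)[unfolded distrib_left] tv unfolding distrib_left by linarith+
      have r1: "norm r1 \<le> \<epsilon> * (t * (norm u + norm v))"
        using d(2)[of "a + s *\<^sub>R u + t *\<^sub>R v"] n1 td \<epsilon> unfolding r1_def
        by (smt (verit) add.assoc add_diff_cancel_left' mult_left_mono)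
      have r2: "norm r2 \<le> \<epsilon> * (t * norm u)"
        using d(2)[of "a + s *\<^sub>R u"] n2 td \<epsilon> unfolding r2_def
        by (smt (verit) add_diff_cancel_left' mult_left_mono)
      have *: "G (a + s *\<^sub>R u + t *\<^sub>R v) - G (a + s *\<^sub>R u) = t *\<^sub>R G' v + (r1 - r2)"
        by (simp add: r1_def r2_def G'.add G'.scaleR)
      have "D t / t\<^sup>2 - G' v \<bullet> u = ((r1 - r2) \<bullet> u) / t"
        unfolding Dt * inner_left_distrib using t(1) by (simp add: field_simps power2_eq_square)
      also have "\<bar>\<dots>\<bar> \<le> (norm (r1 - r2) * norm u) / t"
        using t Cauchy_Schwarz_ineq2[of "r1 - r2" u] by (simp add: divide_right_mono)
      also have "\<dots> \<le> (\<epsilon> * (t * (2 * norm u + norm v)) * norm u) / t"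
      proof -
        have "norm (r1 - r2) \<le> \<epsilon> * (t * (2 * norm u + norm v))"
          using norm_triangle_ineq4[of r1 r2] r1 r2 by (simp add: algebra_simps)
        then show ?thesis using t by (intro divide_right_mono mult_right_mono) auto
      qed
      also have "\<dots> = \<epsilon> * (norm u * (2 * norm u + norm v))" using t by simp
      also have "\<dots> \<le> \<epsilon> * K" using \<epsilon> by (intro mult_left_mono) (auto simp: K_def)
      also have "\<dots> < e" using K e by (simp add: \<epsilon>_def)
      finally show ?thesis by (simp add: dist_real_def)
    qed
    moreover have "norm u + norm v + 1 > 0" by (simp add: add_nonneg_pos)
    ultimately show "\<forall>\<^sub>F t in at_right 0. dist (D t / t\<^sup>2) (G' v \<bullet> u) < e"
      unfolding eventually_at_right_field using d(1)
      by (intro exI[of _ "d / (norm u + norm v + 1)"]) (simp add: pos_less_divide_eq)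
  qed
  have "((\<lambda>t. D t / t\<^sup>2) \<longlongrightarrow> G' v \<bullet> u) (at_right 0)" by (rule lim) (simp add: D_def)
  moreover have "((\<lambda>t. D t / t\<^sup>2) \<longlongrightarrow> G' u \<bullet> v) (at_right 0)" by (rule lim) (simp add: D_def algebra_simps)
  ultimately show ?thesis using tendsto_unique trivial_limit_at_right_real by blast
qed

lemma hess_symmetric:
  fixes F :: "real^'m \<Rightarrow> real^'k"
  assumes C2: "C2_map F"
  shows "transpose (hess (sqnorm_fun F) x) = hess (sqnorm_fun F) x"
proof -
  let ?G = "grad (sqnorm_fun F)"
  have "F differentiable (at y)" for y using C2 by (auto simp: C2_map_def)
  then have f: "(sqnorm_fun F has_derivative (\<lambda>h. ?G y \<bullet> h)) (at y)" for y
    by (rule sqnorm_fun_grad(2))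
  have "(?G has_derivative frechet_derivative ?G (at x)) (at x)"
    using C2_map_grad(1)[OF C2] frechet_derivative_works by blast
  from second_derivative_symmetric[OF f this, of "axis _ 1" "axis _ 1"]
  show ?thesis
    unfolding hess_def matrix_def transpose_def by (simp add: vec_eq_iff inner_axis)
qed

text \<open>Continuity of the second derivative is given for one direction at a time. Summing over
  the basis bounds the operator norm on the compact ball, and convexity of the ball then gives the
  Lipschitz estimate.\<close>

lemma C2_local_bound:
  fixes F :: "real^'m \<Rightarrow> real^'k"
  assumes C2: "C2_map F"
  shows "\<exists>L>0. (\<forall>x\<in>cball a R. \<forall>h. norm (hess (sqnorm_fun F) x *v h) \<le> L * norm h) \<and>
    (\<forall>x\<in>cball a R. \<forall>y\<in>cball a R. norm (grad (sqnorm_fun F) x - grad (sqnorm_fun F) y) \<le> L * norm (x - y))"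
proof -
  let ?G = "grad (sqnorm_fun F)" and ?G' = "\<lambda>x. frechet_derivative (grad (sqnorm_fun F)) (at x)"
  have G': "(?G has_derivative ?G' x) (at x)" for x
    using C2_map_grad(1)[OF C2] frechet_derivative_works by blast
  have "continuous_on (cball a R) (\<lambda>x. \<Sum>b\<in>Basis. norm (?G' x b))"
    using continuous_on_subset[OF C2_map_grad(2)[OF C2]] by (intro continuous_intros) auto
  then have "bounded ((\<lambda>x. \<Sum>b\<in>Basis. norm (?G' x b)) ` cball a R)"
    by (intro compact_imp_bounded compact_continuous_image compact_cball)
  then obtain B where "\<forall>y\<in>(\<lambda>x. \<Sum>b\<in>Basis. norm (?G' x b)) ` cball a R. norm y \<le> B"
    unfolding bounded_iff by blast
  then have B: "\<bar>\<Sum>b\<in>Basis. norm (?G' x b)\<bar> \<le> B" if "x \<in> cball a R" for x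
    using that by simp
  define L where "L = max B 1"
  have bd: "norm (?G' x h) \<le> L * norm h" if "x \<in> cball a R" for x h
  proof -
    interpret lin: bounded_linear "?G' x" by (rule has_derivative_bounded_linear[OF G'])
    have "norm (?G' x h) = norm (?G' x (\<Sum>b\<in>Basis. (h \<bullet> b) *\<^sub>R b))" by (simp add: euclidean_representation)
    also have "\<dots> = norm (\<Sum>b\<in>Basis. (h \<bullet> b) *\<^sub>R ?G' x b)" by (simp add: lin.sum lin.scaleR)
    also have "\<dots> \<le> (\<Sum>b\<in>Basis. norm h * norm (?G' x b))"
      by (rule sum_norm_le) (simp add: Basis_le_norm mult_right_mono)
    also have "\<dots> = norm h * (\<Sum>b\<in>Basis. norm (?G' x b))" by (simp add: sum_distrib_left)
    also have "\<dots> \<le> norm h * L"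
      using B[OF that] by (intro mult_left_mono) (auto simp: L_def)
    finally show ?thesis by (simp add: mult.commute)
  qed
  have "hess (sqnorm_fun F) x *v h = ?G' x h" for x h
    unfolding hess_def by (rule matrix_works_real[OF has_derivative_linear[OF G']])
  moreover have "norm (?G x - ?G y) \<le> L * norm (x - y)" if "x \<in> cball a R" "y \<in> cball a R" for x y
  proof (rule differentiable_bound[where S = "cball a R" and f' = ?G'])
    show "(?G has_derivative ?G' z) (at z within cball a R)" for z
      using G' has_derivative_at_withinI by blast
    show "onorm (?G' z) \<le> L" if "z \<in> cball a R" for z
      using bd[OF that] by (intro onorm_le) (simp add: mult.commute)
  qed (use that in auto)
  ultimately show ?thesis using bd by (intro exI[of _ L]) (simp add: L_def)
qed

text \<open>The mean value theorem on the segment, which stays in the convex ball. It yields the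
  constant \<open>L\<close> instead of the sharp \<open>L / 2\<close>, which is good enough for the
  backtracking estimate.\<close>

lemma descent_inequality:
  fixes f :: "'a::euclidean_space \<Rightarrow> real"
  assumes f: "\<And>x. (f has_derivative (\<lambda>h. G x \<bullet> h)) (at x)"
    and L: "\<And>x y. x \<in> cball a R \<Longrightarrow> y \<in> cball a R \<Longrightarrow> norm (G x - G y) \<le> L * norm (x - y)" "0 \<le> L"
    and x: "x \<in> cball a R" "x - d \<in> cball a R"
  shows "f (x - d) - f x \<le> - (G x \<bullet> d) + L * (norm d)\<^sup>2"
proof -
  have "((\<lambda>s. x - s *\<^sub>R d) has_derivative (\<lambda>h. - (h *\<^sub>R d))) (at s within {0..1})" for s
    by (auto intro!: derivative_eq_intros)
  from has_derivative_compose[OF this f]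
  have "\<exists>s\<in>{0<..<1}. f (x - 1 *\<^sub>R d) - f (x - 0 *\<^sub>R d) = G (x - s *\<^sub>R d) \<bullet> (- ((1 - 0) *\<^sub>R d))"
    by (intro mvt_simple[of 0 1 "\<lambda>s. f (x - s *\<^sub>R d)" "\<lambda>s h. G (x - s *\<^sub>R d) \<bullet> (- (h *\<^sub>R d))"]) auto
  then obtain s where s: "0 < s" "s < 1" "f (x - d) - f x = - (G (x - s *\<^sub>R d) \<bullet> d)" by auto
  have "x - s *\<^sub>R d = (1 - s) *\<^sub>R x + s *\<^sub>R (x - d)" by (simp add: algebra_simps)
  then have "x - s *\<^sub>R d \<in> cball a R"
    using convex_cball[of a R] x s unfolding convex_alt by (metis less_eq_real_def)
  then have "norm (G x - G (x - s *\<^sub>R d)) \<le> L * norm (s *\<^sub>R d)" using L(1)[OF x(1)] by force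
  also have "\<dots> \<le> L * norm d" using s L(2) by (intro mult_left_mono) (auto simp: mult_left_le_one_le)
  finally have "(G x - G (x - s *\<^sub>R d)) \<bullet> d \<le> L * norm d * norm d"
    using norm_cauchy_schwarz[of "G x - G (x - s *\<^sub>R d)" d] by (meson mult_right_mono norm_ge_zero order_trans)
  then show ?thesis unfolding s(3) by (simp add: inner_diff_left power2_eq_square mult.assoc)
qed

section \<open>Decrease in one step\<close>

lemma bnqn_kappa_bounds:
  assumes "inj_on \<delta> {0..m}" "m > 0"
  shows "bnqn_kappa m \<delta> > 0"
    and "i \<le> m \<Longrightarrow> j \<le> m \<Longrightarrow> i \<noteq> j \<Longrightarrow> 2 * bnqn_kappa m \<delta> \<le> \<bar>\<delta> i - \<delta> j\<bar>"
proof -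
  define D where "D = {\<bar>\<delta> i - \<delta> j\<bar> | i j. i \<le> m \<and> j \<le> m \<and> i \<noteq> j}"
  have "D \<subseteq> (\<lambda>(i, j). \<bar>\<delta> i - \<delta> j\<bar>) ` ({..m} \<times> {..m})" unfolding D_def by auto
  then have fin: "finite D" by (rule finite_subset) auto
  have "\<bar>\<delta> 0 - \<delta> m\<bar> \<in> D" unfolding D_def using assms(2) by force
  then have "D \<noteq> {}" by blast
  moreover have "d > 0" if "d \<in> D" for d
  proof -
    obtain i j where "d = \<bar>\<delta> i - \<delta> j\<bar>" "i \<le> m" "j \<le> m" "i \<noteq> j" using \<open>d \<in> D\<close> unfolding D_def by blast
    moreover from this have "\<delta> i \<noteq> \<delta> j" using inj_onD[OF assms(1), of i j] by auto
    ultimately show ?thesis by simp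
  qed
  ultimately show "bnqn_kappa m \<delta> > 0" unfolding bnqn_kappa_def D_def[symmetric] using fin by simp
  show "2 * bnqn_kappa m \<delta> \<le> \<bar>\<delta> i - \<delta> j\<bar>" if "i \<le> m" "j \<le> m" "i \<noteq> j"
  proof -
    have "\<bar>\<delta> i - \<delta> j\<bar> \<in> D" unfolding D_def using that by blast
    then have "Min D \<le> \<bar>\<delta> i - \<delta> j\<bar>" using fin by (rule Min_le[rotated])
    then show ?thesis unfolding bnqn_kappa_def D_def[symmetric] by simp
  qed
qed

text \<open>Pigeonhole: there are \<open>CARD('m) + 1\<close> shifts but at most
  \<open>CARD('m)\<close> eigenvalues. If every shift failed, two of them would bring the same
  eigenvalue within \<open>\<kappa> * t\<close> of 0, and \<open>\<delta> i\<close>,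
  \<open>\<delta> j\<close> would differ by less than \<open>2 * \<kappa>\<close>. Hence the
  \<open>LEAST\<close> in \<open>bnqn_A\<close> is attained.\<close>

lemma shift_exists:
  fixes B :: "real^'m^'m"
  assumes sym: "transpose B = B" and inj: "inj_on \<delta> {0..CARD('m)}" and t: "t > 0"
  shows "\<exists>j\<le>CARD('m). bnqn_kappa CARD('m) \<delta> * t \<le> minsp (B + (\<delta> j * t) *\<^sub>R mat 1)"
proof (rule ccontr)
  define \<kappa> where "\<kappa> = bnqn_kappa CARD('m) \<delta>"
  assume "\<not> ?thesis"
  then have "\<forall>j\<in>{..CARD('m)}. \<exists>l. l \<in> eigenvalues_of B \<and> \<bar>l + \<delta> j * t\<bar> < \<kappa> * t"
    unfolding minsp_le_iff[OF transpose_shift[OF sym]] eigenvalues_of_shift \<kappa>_def by force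
  then obtain l where l: "\<forall>j\<in>{..CARD('m)}. l j \<in> eigenvalues_of B \<and> \<bar>l j + \<delta> j * t\<bar> < \<kappa> * t"
    by (rule bchoice[THEN exE])
  have "\<not> inj_on l {..CARD('m)}"
  proof
    assume "inj_on l {..CARD('m)}"
    then have "card {..CARD('m)} \<le> card (eigenvalues_of B)"
      by (rule card_inj_on_le) (use l eigenvalues_of_symmetric[OF sym] in auto)
    then show False using eigenvalues_of_symmetric(2)[OF sym] by simp
  qed
  then obtain i j where ij: "i \<le> CARD('m)" "j \<le> CARD('m)" "i \<noteq> j" "l i = l j"
    unfolding inj_on_def by auto
  have "\<bar>\<delta> i - \<delta> j\<bar> * t = \<bar>(l i + \<delta> i * t) - (l j + \<delta> j * t)\<bar>"
    using ij(4) t by (simp add: left_diff_distrib[symmetric] abs_mult)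
  also have "\<dots> < 2 * \<kappa> * t" using l ij(1,2) by (smt (verit) atMost_iff distrib_right mult_2)
  finally have "\<bar>\<delta> i - \<delta> j\<bar> < 2 * \<kappa>" using t by simp
  then show False
    using bnqn_kappa_bounds(2)[OF inj zero_less_card_finite ij(1-3)] by (simp add: \<kappa>_def)
qed

text \<open>The branch with \<open>minsp H > n powr \<tau>\<close> guarantees only
  \<open>\<kappa> * n\<close> by its choice of \<open>j\<close>, too weak when \<open>n\<close> is
  small. There the spectral gap of the Hessian itself helps, since the shift costs at most
  \<open>\<Delta> * n\<close>. The two lower bounds \<open>\<kappa> * n\<close> and
  \<open>n powr \<tau> - \<Delta> * n\<close> meet where
  \<open>n powr \<tau> = (\<kappa> + \<Delta>) * n\<close>.\<close>

lemma bnqn_A_properties: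
  fixes F :: "real^'m \<Rightarrow> real^'k"
  assumes C2: "C2_map F" and params: "bnqn_params CARD('m) \<delta> \<tau>" and \<tau>: "\<tau> < 1"
  shows "\<exists>c>0. \<exists>\<Delta>>0. \<forall>x. F x \<noteq> 0 \<longrightarrow> (\<exists>t. bnqn_A F \<delta> \<tau> x = hess (sqnorm_fun F) x + t *\<^sub>R mat 1 \<and>
    0 \<le> t \<and> t \<le> \<Delta> * (1 + norm (F x)) \<and> c * norm (F x) powr \<tau> \<le> minsp (bnqn_A F \<delta> \<tau> x))"
proof -
  let ?m = "CARD('m)"
  define \<kappa> where "\<kappa> = bnqn_kappa ?m \<delta>"
  define \<Delta> where "\<Delta> = Max (\<delta> ` {..?m})"
  have inj: "inj_on \<delta> {0..?m}" and \<tau>0: "\<tau> > 0" and \<delta>0: "\<And>j. j \<le> ?m \<Longrightarrow> \<delta> j > 0"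
    using params by (auto simp: bnqn_params_def)
  have \<kappa>: "\<kappa> > 0" unfolding \<kappa>_def by (rule bnqn_kappa_bounds(1)[OF inj]) simp
  have \<Delta>: "\<delta> j \<le> \<Delta>" if "j \<le> ?m" for j unfolding \<Delta>_def using that by (intro Max_ge) auto
  have \<Delta>0: "\<Delta> > 0" using \<Delta>[of 0] \<delta>0[of 0] by simp
  \<comment> \<open>\<open>\<kappa> / (\<kappa> + \<Delta>)\<close> is the fraction of
    \<open>n powr \<tau>\<close> left where the two bounds of the first branch meet; the second
    branch gives \<open>\<kappa>\<close> itself.\<close>
  define c where "c = min \<kappa> (\<kappa> / (\<kappa> + \<Delta>))"
  have c: "c > 0" using \<kappa> \<Delta>0 by (simp add: c_def)
  have "\<exists>t. bnqn_A F \<delta> \<tau> x = hess (sqnorm_fun F) x + t *\<^sub>R mat 1 \<and>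
    0 \<le> t \<and> t \<le> \<Delta> * (1 + norm (F x)) \<and> c * norm (F x) powr \<tau> \<le> minsp (bnqn_A F \<delta> \<tau> x)"
    if Fx: "F x \<noteq> 0" for x
  proof -
    define H where "H = hess (sqnorm_fun F) x"
    define n where "n = norm (F x)"
    have n: "n > 0" "n powr \<tau> > 0" using Fx by (auto simp: n_def)
    have sym: "transpose H = H" unfolding H_def by (rule hess_symmetric[OF C2])
    show ?thesis
    proof (cases "minsp H > n powr \<tau>")
      case True
      define j where "j = (LEAST j. j \<le> ?m \<and> minsp (H + (\<delta> j * n) *\<^sub>R mat 1) \<ge> \<kappa> * n)"
      have j: "j \<le> ?m" "\<kappa> * n \<le> minsp (H + (\<delta> j * n) *\<^sub>R mat 1)"
        using LeastI_ex[OF shift_exists[OF sym inj n(1)]] unfolding j_def \<kappa>_def by auto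
      have A: "bnqn_A F \<delta> \<tau> x = H + (\<delta> j * n) *\<^sub>R mat 1"
        unfolding bnqn_A_def Let_def using True by (simp add: H_def n_def j_def \<kappa>_def)
      have "n powr \<tau> - \<delta> j * n \<le> minsp (H + (\<delta> j * n) *\<^sub>R mat 1)"
        using minsp_shift_ge[OF sym, of "\<delta> j * n"] True \<delta>0[OF j(1)] n by simp
      moreover have "\<delta> j * n \<le> \<Delta> * n" using \<Delta>[OF j(1)] n by simp
      ultimately have lo: "n powr \<tau> - \<Delta> * n \<le> minsp (H + (\<delta> j * n) *\<^sub>R mat 1)" by linarith
      have "\<kappa> / (\<kappa> + \<Delta>) * n powr \<tau> \<le> minsp (H + (\<delta> j * n) *\<^sub>R mat 1)"
      proof (cases "n powr \<tau> \<le> (\<kappa> + \<Delta>) * n")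
        case True
        then have "\<kappa> / (\<kappa> + \<Delta>) * n powr \<tau> \<le> \<kappa> / (\<kappa> + \<Delta>) * ((\<kappa> + \<Delta>) * n)"
          using \<kappa> \<Delta>0 by (intro mult_left_mono) auto
        also have "\<dots> = \<kappa> * n" using \<kappa> \<Delta>0 by simp
        finally show ?thesis using j(2) by linarith
      next
        case False
        then have "n < n powr \<tau> / (\<kappa> + \<Delta>)" using \<kappa> \<Delta>0 by (simp add: field_simps)
        then have "\<Delta> * n < \<Delta> * (n powr \<tau> / (\<kappa> + \<Delta>))" using \<Delta>0 by (rule mult_strict_left_mono)
        moreover have "\<kappa> / (\<kappa> + \<Delta>) * n powr \<tau> = n powr \<tau> - \<Delta> * (n powr \<tau> / (\<kappa> + \<Delta>))"
          using \<kappa> \<Delta>0 by (simp add: field_simps)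
        ultimately show ?thesis using lo by linarith
      qed
      moreover have "c * n powr \<tau> \<le> \<kappa> / (\<kappa> + \<Delta>) * n powr \<tau>"
        using n by (intro mult_right_mono) (auto simp: c_def)
      moreover have "\<delta> j * n \<le> \<Delta> * (1 + n)"
        using \<open>\<delta> j * n \<le> \<Delta> * n\<close> \<Delta>0 by (simp add: distrib_left)
      ultimately show ?thesis
        unfolding H_def[symmetric] n_def[symmetric] A using \<delta>0[OF j(1)] n
        by (intro exI[of _ "\<delta> j * n"]) auto
    next
      case False
      define j where "j = (LEAST j. j \<le> ?m \<and> minsp (H + (\<delta> j * n powr \<tau>) *\<^sub>R mat 1) \<ge> \<kappa> * n powr \<tau>)"
      have j: "j \<le> ?m" "\<kappa> * n powr \<tau> \<le> minsp (H + (\<delta> j * n powr \<tau>) *\<^sub>R mat 1)"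
        using LeastI_ex[OF shift_exists[OF sym inj n(2)]] unfolding j_def \<kappa>_def by auto
      have A: "bnqn_A F \<delta> \<tau> x = H + (\<delta> j * n powr \<tau>) *\<^sub>R mat 1"
        unfolding bnqn_A_def Let_def using False by (simp add: H_def n_def j_def \<kappa>_def)
      \<comment> \<open>By \<open>\<tau> < 1\<close>, a shift by a multiple of
        \<open>n powr \<tau>\<close> obeys the same linear bound as one by a multiple of
        \<open>n\<close>.\<close>
      have "n powr \<tau> \<le> 1 + n"
      proof (cases "n \<le> 1")
        case True
        then have "n powr \<tau> \<le> 1" using n \<tau>0 by (simp add: powr_le_one_le powr_le1)
        then show ?thesis using n by simp
      next
        case False
        then have "n powr \<tau> \<le> n powr 1" using \<tau> by (intro powr_mono) auto
        then show ?thesis using n by simp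
      qed
      then have "\<delta> j * n powr \<tau> \<le> \<Delta> * (1 + n)"
        using \<Delta>[OF j(1)] \<Delta>0 n by (intro mult_mono) auto
      moreover have "c * n powr \<tau> \<le> \<kappa> * n powr \<tau>"
        using n by (intro mult_right_mono) (auto simp: c_def)
      then have "c * n powr \<tau> \<le> minsp (H + (\<delta> j * n powr \<tau>) *\<^sub>R mat 1)" using j(2) by linarith
      ultimately show ?thesis
        unfolding H_def[symmetric] n_def[symmetric] A using \<delta>0[OF j(1)] n j(2)
        by (intro exI[of _ "\<delta> j * n powr \<tau>"]) auto
    qed
  qed
  then show ?thesis using c \<Delta>0 by blast
qed

text \<open>The gradient is \<open>2 *\<^sub>R g\<close>, while the test asks only for a decrease of
  \<open>\<gamma> * (d \<bullet> g x)\<close>, half of the first-order one; the other half absorbs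
  the quadratic error as soon as \<open>L * \<gamma> \<le> c\<close>. If the search stops at
  \<open>n > 0\<close>, the rejected step, twice as long, had \<open>L * \<gamma> > c\<close>.
  Radius \<open>R + 1\<close> covers all trial points since \<open>norm d \<le> 1\<close>.\<close>

lemma backtracking_step:
  fixes f :: "'a::euclidean_space \<Rightarrow> real"
  assumes f: "\<And>x. (f has_derivative (\<lambda>h. (2 *\<^sub>R g x) \<bullet> h)) (at x)"
    and L: "\<And>x y. x \<in> cball a (R + 1) \<Longrightarrow> y \<in> cball a (R + 1) \<Longrightarrow> norm (2 *\<^sub>R g x - 2 *\<^sub>R g y) \<le> L * norm (x - y)" "0 < L"
    and x: "x \<in> cball a R" and d: "norm d \<le> 1" and c: "0 < c" "c * (norm d)\<^sup>2 \<le> d \<bullet> g x"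
  defines "n \<equiv> (LEAST n::nat. f (x - ((1/2)^n) *\<^sub>R d) - f x \<le> - ((1/2)^n) * (d \<bullet> g x))"
  shows "f (x - ((1/2)^n) *\<^sub>R d) - f x \<le> - ((1/2)^n) * (d \<bullet> g x)" "min 1 (c / (2 * L)) \<le> (1/2)^n"
proof -
  let ?P = "\<lambda>n::nat. f (x - ((1/2)^n) *\<^sub>R d) - f x \<le> - ((1/2)^n) * (d \<bullet> g x)"
  have ok: "?P k" if k: "L * (1/2)^k \<le> c" for k
  proof -
    define \<gamma> :: real where "\<gamma> = (1/2)^k"
    have \<gamma>: "0 < \<gamma>" "\<gamma> \<le> 1" by (auto simp: \<gamma>_def power_le_one)
    have "norm (\<gamma> *\<^sub>R d) \<le> 1" using \<gamma> d by (simp add: mult_le_one)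
    then have "x - \<gamma> *\<^sub>R d \<in> cball a (R + 1)"
      using x norm_triangle_ineq4[of "x - a" "\<gamma> *\<^sub>R d"] by (simp add: dist_norm norm_minus_commute algebra_simps)
    from descent_inequality[OF f L(1) _ _ this] L(2) x
    have "f (x - \<gamma> *\<^sub>R d) - f x \<le> - ((2 *\<^sub>R g x) \<bullet> (\<gamma> *\<^sub>R d)) + L * (norm (\<gamma> *\<^sub>R d))\<^sup>2"
      by (auto simp: less_imp_le)
    also have "\<dots> = - 2 * \<gamma> * (d \<bullet> g x) + \<gamma> * ((L * \<gamma>) * (norm d)\<^sup>2)"
      by (simp add: inner_commute power_mult_distrib power2_eq_square)
    also have "\<dots> \<le> - 2 * \<gamma> * (d \<bullet> g x) + \<gamma> * (c * (norm d)\<^sup>2)"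
      using k \<gamma> by (intro add_left_mono mult_left_mono mult_right_mono) (auto simp: \<gamma>_def)
    also have "\<dots> \<le> - 2 * \<gamma> * (d \<bullet> g x) + \<gamma> * (d \<bullet> g x)"
      using c(2) \<gamma> by (intro add_left_mono mult_left_mono) auto
    finally show ?thesis by (simp add: \<gamma>_def mult.commute)
  qed
  obtain k where "(1/2)^k < c / L" using real_arch_pow_inv[of "c / L" "1/2"] c L by auto
  then have "?P k" using L by (intro ok) (simp add: field_simps)
  then show "?P n" unfolding n_def by (rule LeastI)
  show "min 1 (c / (2 * L)) \<le> (1/2)^n"
  proof (cases n)
    case (Suc k)
    then have "\<not> ?P k" using not_less_Least[of k ?P] unfolding n_def[symmetric] by simp
    then have "\<not> L * (1/2)^k \<le> c" using ok by blast
    then have "c / (2 * L) \<le> (1/2)^n" using Suc L(2) by (simp add: field_simps)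
    then show ?thesis by simp
  qed simp
qed

text \<open>\<open>w\<close> is comparable to \<open>g\<close> and makes an angle with it whose cosine is at least a multiple of
  \<open>minsp (bnqn_A F \<delta> \<tau> x)\<close>, hence of \<open>norm (F x) powr \<tau>\<close>.\<close>

lemma bnqn_step_decrease:
  fixes F :: "real^'m \<Rightarrow> real^'k" and a :: "real^'m"
  assumes C2: "C2_map F" and params: "bnqn_params CARD('m) \<delta> \<tau>" and \<tau>: "\<tau> < 1"
  defines "f \<equiv> sqnorm_fun F" and "g \<equiv> (\<lambda>x. transpose (jac F x) *v F x)"
  shows "\<exists>k>0. \<exists>c>0. \<exists>\<Lambda>>0. \<exists>L>0. \<forall>x\<in>cball a 1. g x \<noteq> 0 \<longrightarrow>
    k * norm (F x) powr \<tau> * norm (g x) * norm (bnqn_step F \<delta> \<tau> x - x) \<le> f x - f (bnqn_step F \<delta> \<tau> x) \<and>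
    min 1 (c * norm (F x) powr \<tau> / L) * (c * norm (F x) powr \<tau>) * min 1 (norm (g x) / \<Lambda>) * (norm (g x) / \<Lambda>)
      \<le> f x - f (bnqn_step F \<delta> \<tau> x)"
proof -
  have dF: "F differentiable (at x)" for x using C2 by (auto simp: C2_map_def)
  have grad: "grad f x = 2 *\<^sub>R g x" for x unfolding f_def g_def by (rule sqnorm_fun_grad(1)[OF dF])
  have f': "(f has_derivative (\<lambda>h. (2 *\<^sub>R g x) \<bullet> h)) (at x)" for x
    using sqnorm_fun_grad(2)[OF dF, of x] unfolding f_def[symmetric] grad .
  obtain L where L: "L > 0" "\<And>x h. x \<in> cball a (1 + 1) \<Longrightarrow> norm (hess f x *v h) \<le> L * norm h"
    "\<And>x y. x \<in> cball a (1 + 1) \<Longrightarrow> y \<in> cball a (1 + 1) \<Longrightarrow> norm (2 *\<^sub>R g x - 2 *\<^sub>R g y) \<le> L * norm (x - y)"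
    using C2_local_bound[OF C2, of a "1 + 1"] unfolding f_def[symmetric] grad by blast
  obtain c \<Delta> where c: "c > 0" and \<Delta>: "\<Delta> > 0"
    and A: "\<And>x. F x \<noteq> 0 \<Longrightarrow> \<exists>t. bnqn_A F \<delta> \<tau> x = hess f x + t *\<^sub>R mat 1 \<and>
      0 \<le> t \<and> t \<le> \<Delta> * (1 + norm (F x)) \<and> c * norm (F x) powr \<tau> \<le> minsp (bnqn_A F \<delta> \<tau> x)"
    using bnqn_A_properties[OF C2 params \<tau>] unfolding f_def[symmetric] by blast
  have "continuous_on (cball a 1) F"
    using differentiable_imp_continuous_within[OF dF] by (simp add: continuous_at_imp_continuous_on)
  then have "bounded (F ` cball a 1)"
    by (intro compact_imp_bounded compact_continuous_image compact_cball)
  then obtain M where "\<forall>y\<in>F ` cball a 1. norm y \<le> M" unfolding bounded_iff by blast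
  then have M: "norm (F x) \<le> M" if "x \<in> cball a 1" for x using that by blast
  have M0: "M \<ge> 0" using order_trans[OF norm_ge_zero M[of a]] by simp
  \<comment> \<open>Bounds the operator norm of \<open>bnqn_A\<close> on the ball, as Hessian plus
    shift.\<close>
  define \<Lambda> where "\<Lambda> = L + \<Delta> * (1 + M)"
  have \<Lambda>: "\<Lambda> > 0" using L(1) \<Delta> M0 by (simp add: \<Lambda>_def add_pos_nonneg)
  \<comment> \<open>The first inequality measures the decrease against the step length and feeds the
    length estimate; the second bounds it below by a continuous function of \<open>x\<close> alone
    and serves to exclude cluster points that are not critical.\<close>
  have "c / \<Lambda> * norm (F x) powr \<tau> * norm (g x) * norm (bnqn_step F \<delta> \<tau> x - x) \<le> f x - f (bnqn_step F \<delta> \<tau> x) \<and>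
    min 1 (c * norm (F x) powr \<tau> / (2 * L)) * (c * norm (F x) powr \<tau>) * min 1 (norm (g x) / \<Lambda>) * (norm (g x) / \<Lambda>)
      \<le> f x - f (bnqn_step F \<delta> \<tau> x)"
    if x: "x \<in> cball a 1" and gx: "g x \<noteq> 0" for x
  proof -
    have Fx: "F x \<noteq> 0" using gx by (auto simp: g_def)
    define B where "B = bnqn_A F \<delta> \<tau> x"
    define \<mu> where "\<mu> = c * norm (F x) powr \<tau>"
    have \<mu>: "\<mu> > 0" using c Fx by (simp add: \<mu>_def)
    obtain t where t: "B = hess f x + t *\<^sub>R mat 1" "0 \<le> t" "t \<le> \<Delta> * (1 + norm (F x))" "\<mu> \<le> minsp B"
      using A[OF Fx] unfolding B_def \<mu>_def by blast
    have symB: "transpose B = B"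
      unfolding t(1) f_def by (rule transpose_shift[OF hess_symmetric[OF C2]])
    define w where "w = pr_pos B (matrix_inv B *v g x) - pr_neg B (matrix_inv B *v g x)"
    have minB: "0 < minsp B" using t(4) \<mu> by linarith
    have wg: "minsp B * (w \<bullet> w) \<le> w \<bullet> g x" and "\<exists>v. B *v v = g x \<and> norm v = norm w"
      using reflected_direction[OF symB minB, of "g x"] unfolding w_def by auto
    then obtain v where v: "B *v v = g x" "norm v = norm w" by blast
    have "norm (g x) \<le> norm (hess f x *v v) + norm (t *\<^sub>R v)"
      unfolding v(1)[symmetric] t(1)
      by (simp add: matrix_vector_mult_add_rdistrib scaleR_matrix_vector_assoc[symmetric] norm_triangle_ineq
          del: norm_scaleR)
    also have "\<dots> \<le> L * norm w + \<Delta> * (1 + M) * norm w"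
    proof (rule add_mono)
      show "norm (hess f x *v v) \<le> L * norm w" using L(2)[of x v] x v(2) by simp
      have "t \<le> \<Delta> * (1 + M)" using t(3) M[OF x] \<Delta> by (smt (verit) mult_left_mono)
      then show "norm (t *\<^sub>R v) \<le> \<Delta> * (1 + M) * norm w" using t(2) v(2) by (simp add: mult_right_mono)
    qed
    finally have gw: "norm (g x) \<le> \<Lambda> * norm w" by (simp add: \<Lambda>_def distrib_right)
    then have gw': "norm (g x) / \<Lambda> \<le> norm w" using \<Lambda> by (simp add: field_simps)
    define m where "m = max 1 (norm w)"
    define d where "d = (1 / m) *\<^sub>R w"
    have m: "m \<ge> 1" "norm w \<le> m" by (auto simp: m_def)
    have nd: "norm d = norm w / m" using m by (simp add: d_def)
    have d1: "norm d \<le> 1" using m by (simp add: nd)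
    have wg': "\<mu> * (norm w)\<^sup>2 \<le> w \<bullet> g x"
      using wg t(4) mult_right_mono[OF t(4), of "w \<bullet> w"] by (simp add: power2_norm_eq_inner)
    \<comment> \<open>One factor \<open>norm w\<close> is kept unnormalised: being at least
      \<open>norm (g x) / \<Lambda>\<close> it supplies the gradient, while \<open>norm d\<close>
      supplies the step length.\<close>
    have dg: "\<mu> * norm w * norm d \<le> d \<bullet> g x"
      using wg' m by (simp add: d_def divide_right_mono power2_eq_square mult.assoc)
    have "\<mu> * (norm d)\<^sup>2 \<le> \<mu> * norm w * norm d"
    proof -
      have "norm d \<le> norm w" using m mult_left_mono[OF m(1), of "norm w"] by (simp add: nd divide_le_eq)
      then show ?thesis using \<mu> by (simp add: power2_eq_square mult_right_mono)
    qed
    then have dg2: "\<mu> * (norm d)\<^sup>2 \<le> d \<bullet> g x" using dg by linarith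
    define n where "n = (LEAST n::nat. f (x - ((1/2)^n) *\<^sub>R d) - f x \<le> - ((1/2)^n) * (d \<bullet> g x))"
    define \<gamma> :: real where "\<gamma> = (1/2)^n"
    have arm: "f (x - \<gamma> *\<^sub>R d) - f x \<le> - \<gamma> * (d \<bullet> g x)" and \<gamma>l: "min 1 (\<mu> / (2 * L)) \<le> \<gamma>"
      using backtracking_step[where R = 1, OF f' L(3) L(1) x d1 \<mu> dg2] unfolding n_def[symmetric] \<gamma>_def by auto
    have \<gamma>: "\<gamma> > 0" by (simp add: \<gamma>_def)
    have step: "bnqn_step F \<delta> \<tau> x = x - \<gamma> *\<^sub>R d"
      using gx unfolding bnqn_step_def Let_def \<gamma>_def n_def d_def m_def w_def B_def f_def g_def
      by (rule if_not_P)
    have dec: "\<gamma> * (\<mu> * norm w * norm d) \<le> f x - f (bnqn_step F \<delta> \<tau> x)"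
      using arm mult_left_mono[OF dg, of \<gamma>] \<gamma> unfolding step by linarith
    have "c / \<Lambda> * norm (F x) powr \<tau> * norm (g x) * norm (bnqn_step F \<delta> \<tau> x - x)
        = \<mu> * (norm (g x) / \<Lambda>) * (\<gamma> * norm d)"
      using \<gamma> by (simp add: step \<mu>_def)
    also have "\<dots> \<le> \<mu> * norm w * (\<gamma> * norm d)"
      using gw' \<mu> \<gamma> by (intro mult_right_mono mult_left_mono) auto
    also have "\<dots> \<le> f x - f (bnqn_step F \<delta> \<tau> x)" using dec by (simp add: mult_ac)
    finally have 1: "c / \<Lambda> * norm (F x) powr \<tau> * norm (g x) * norm (bnqn_step F \<delta> \<tau> x - x)
      \<le> f x - f (bnqn_step F \<delta> \<tau> x)" .
    \<comment> \<open>\<open>norm d\<close> equals \<open>min 1 (norm w)\<close>.\<close>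
    have "min 1 (norm (g x) / \<Lambda>) \<le> norm d"
      using gw' by (cases "norm w \<le> 1") (auto simp: nd m_def)
    then have "min 1 (\<mu> / (2 * L)) * \<mu> * min 1 (norm (g x) / \<Lambda>) * (norm (g x) / \<Lambda>)
        \<le> \<gamma> * \<mu> * norm d * norm w"
      using \<gamma>l \<mu> \<gamma> \<Lambda> L(1) gw' by (intro mult_mono) auto
    also have "\<dots> \<le> f x - f (bnqn_step F \<delta> \<tau> x)" using dec by (simp add: mult_ac)
    finally show ?thesis using 1 by (simp add: \<mu>_def)
  qed
  then show ?thesis
    using c \<Lambda> L(1)
    by (intro exI[of _ "c / \<Lambda>"] exI[of _ c] exI[of _ \<Lambda>] exI[of _ "2 * L"] conjI) simp_all
qed

section \<open>Convergence\<close>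

text \<open>Concavity of \<open>z powr (1 - \<theta>)\<close>. When \<open>a powr \<theta>\<close>
  times a step length is bounded by a multiple of \<open>a - b\<close>, this turns step lengths into
  telescoping differences.\<close>

lemma powr_diff_ge:
  fixes a b \<theta> :: real
  assumes "0 < b" "b \<le> a" "0 \<le> \<theta>" "\<theta> < 1"
  shows "(1 - \<theta>) * a powr (- \<theta>) * (a - b) \<le> a powr (1 - \<theta>) - b powr (1 - \<theta>)"
proof (cases "b = a")
  case False
  then have "b < a" using assms by simp
  moreover have "((\<lambda>z. z powr (1 - \<theta>)) has_real_derivative (1 - \<theta>) * z powr (1 - \<theta> - 1)) (at z)" if "b \<le> z" for z
    using that assms by (intro has_real_derivative_powr) auto
  ultimately obtain z where z: "b < z" "z < a"
    "a powr (1 - \<theta>) - b powr (1 - \<theta>) = (a - b) * ((1 - \<theta>) * z powr (1 - \<theta> - 1))"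
    using MVT2[of b a "\<lambda>z. z powr (1 - \<theta>)" "\<lambda>z. (1 - \<theta>) * z powr (1 - \<theta> - 1)"] by blast
  have "a powr (- \<theta>) \<le> z powr (- \<theta>)" using z assms by (intro powr_mono2') auto
  then have "(a - b) * ((1 - \<theta>) * a powr (- \<theta>)) \<le> (a - b) * ((1 - \<theta>) * z powr (- \<theta>))"
    using assms by (intro mult_left_mono) auto
  then show ?thesis unfolding z(3) by (simp add: mult_ac)
qed simp

text \<open>Once the sequence comes close enough to the cluster point, the remaining path is shorter than
  the distance to the boundary of the ball on which the length estimate holds.\<close>

lemma cluster_point_capture:
  fixes x :: "nat \<Rightarrow> 'a::real_normed_vector"
  assumes r: "r > 0" and \<phi>: "\<phi> \<longlonglongrightarrow> 0" "\<And>k. 0 \<le> \<phi> k"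
    and len: "\<And>k. x k \<in> cball a r \<Longrightarrow> norm (x (Suc k) - x k) \<le> \<phi> k - \<phi> (Suc k)"
    and s: "strict_mono s" "(x \<circ> s) \<longlonglongrightarrow> a"
  shows "x \<longlonglongrightarrow> a"
proof (rule LIMSEQ_I)
  fix e0 :: real assume "e0 > 0"
  define e where "e = min e0 r"
  have e: "e > 0" "e \<le> r" "e \<le> e0" using r \<open>e0 > 0\<close> by (auto simp: e_def)
  obtain N0 where N0: "\<And>n. n \<ge> N0 \<Longrightarrow> norm (\<phi> n - 0) < e / 2"
    using LIMSEQ_D[OF \<phi>(1), of "e / 2"] e by auto
  obtain N1 where N1: "\<And>n. n \<ge> N1 \<Longrightarrow> norm ((x \<circ> s) n - a) < e / 2"
    using LIMSEQ_D[OF s(2), of "e / 2"] e by auto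
  define n where "n = s (max N0 N1)"
  have "n \<ge> N0" using seq_suble[OF s(1), of "max N0 N1"] by (simp add: n_def)
  then have \<phi>n: "\<phi> n < e / 2" using N0[of n] by simp
  have xn: "norm (x n - a) < e / 2" using N1[of "max N0 N1"] by (simp add: n_def)
  \<comment> \<open>The telescoped bound also shows, at each stage, that the iterate is still in the
    ball where \<open>len\<close> applies.\<close>
  have close: "norm (x (n + k) - a) \<le> norm (x n - a) + (\<phi> n - \<phi> (n + k))" for k
  proof (induction k)
    case (Suc k)
    then have "norm (x (n + k) - a) < e" using \<phi>(2)[of "n + k"] \<phi>n xn by linarith
    then have "x (n + k) \<in> cball a r" using e by (simp add: dist_norm norm_minus_commute)
    from len[OF this] show ?case
      using Suc norm_triangle_ineq[of "x (Suc (n + k)) - x (n + k)" "x (n + k) - a"] by simp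
  qed simp
  have "norm (x k - a) < e0" if "k \<ge> n" for k
    using close[of "k - n"] that \<phi>(2)[of k] \<phi>n xn e by simp
  then show "\<exists>no. \<forall>n\<ge>no. norm (x n - a) < e0" by blast
qed

lemma bounded_subsequence_converges:
  fixes x :: "nat \<Rightarrow> 'a::euclidean_space"
  assumes "\<not> filterlim (\<lambda>n. norm (x n)) at_top sequentially"
  shows "\<exists>a s. strict_mono s \<and> (x \<circ> s) \<longlonglongrightarrow> a"
proof -
  obtain B where "\<not> eventually (\<lambda>n. B \<le> norm (x n)) sequentially"
    using assms unfolding filterlim_at_top by blast
  then have "\<forall>N. \<exists>n\<ge>N. norm (x n) < B"
    unfolding eventually_sequentially by (auto simp: not_le)
  then have "infinite {n. norm (x n) < B}" unfolding infinite_nat_iff_unbounded_le by simp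
  from infinite_enumerate[OF this] obtain r :: "nat \<Rightarrow> nat" where r: "strict_mono r" "\<forall>n. norm (x (r n)) < B"
    by auto
  then have "\<forall>n. (x \<circ> r) n \<in> cball 0 B" by (simp add: less_imp_le)
  then obtain a q where "strict_mono q" "((x \<circ> r) \<circ> q) \<longlonglongrightarrow> a"
    using compact_cball[of "0::'a" B] unfolding compact_def by blast
  then show ?thesis
    using strict_mono_o[OF r(1)] by (auto simp: comp_assoc)
qed

text \<open>The eigenvalue bound by \<open>norm F powr \<tau>\<close> degenerates near zeros of
  \<open>F\<close>. The loss is a factor \<open>f powr (\<tau> / 2)\<close>; since
  \<open>f a \<ge> 0\<close>, it is at least \<open>(f - f a) powr (\<tau> / 2)\<close> and can be
  charged to the Lojasiewicz exponent, whether or not \<open>f a = 0\<close>.\<close>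

lemma bnqn_convergence:
  fixes F :: "real^'m \<Rightarrow> real^'k"
  assumes C2: "C2_map F"
    and loj: "\<And>a. critical_point (sqnorm_fun F) a \<Longrightarrow> lojasiewicz_at (sqnorm_fun F) a"
    and params: "bnqn_params CARD('m) \<delta> \<tau>" and \<tau>: "\<tau> < 1" and seq: "bnqn_sequence F \<delta> \<tau> x"
    and exponent: "\<And>a. critical_point (sqnorm_fun F) a \<Longrightarrow> loj_exponent (sqnorm_fun F) a * (1 + \<tau>) < 1"
  shows "filterlim (\<lambda>n. norm (x n)) at_top sequentially \<or>
    (\<exists>a. critical_point (sqnorm_fun F) a \<and> x \<longlonglongrightarrow> a)"
proof -
  define f where "f = sqnorm_fun F"
  define g where "g y = transpose (jac F y) *v F y" for y
  have \<tau>0: "\<tau> > 0" using params by (simp add: bnqn_params_def)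
  have dF: "F differentiable (at x)" for x using C2 by (auto simp: C2_map_def)
  have grad: "grad f x = 2 *\<^sub>R g x" for x unfolding f_def g_def by (rule sqnorm_fun_grad(1)[OF dF])
  have crit: "critical_point f a \<longleftrightarrow> g a = 0" for a by (simp add: critical_point_def grad)
  have contF: "isCont F a" for a using differentiable_imp_continuous_within[OF dF] by blast
  have contf: "isCont f a" for a
    unfolding f_def sqnorm_fun_def by (intro continuous_intros contF)
  have "isCont (grad f) a" for a
    unfolding f_def using differentiable_imp_continuous_within[OF C2_map_grad(1)[OF C2]] by blast
  then have contg: "isCont g a" for a
    using isCont_scaleR[OF continuous_const[of _ "1/2"], of a "grad f"] by (simp add: grad)
  have step: "x (Suc k) = bnqn_step F \<delta> \<tau> (x k)" for k using seq by (simp add: bnqn_sequence_def)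
  have local_estimate: "\<exists>k>0. \<exists>c>0. \<exists>\<Lambda>>0. \<exists>L>0. \<forall>n. x n \<in> cball a 1 \<longrightarrow> g (x n) \<noteq> 0 \<longrightarrow>
    k * norm (F (x n)) powr \<tau> * norm (g (x n)) * norm (x (Suc n) - x n) \<le> f (x n) - f (x (Suc n)) \<and>
    min 1 (c * norm (F (x n)) powr \<tau> / L) * (c * norm (F (x n)) powr \<tau>) * min 1 (norm (g (x n)) / \<Lambda>) * (norm (g (x n)) / \<Lambda>)
      \<le> f (x n) - f (x (Suc n))" for a
    using bnqn_step_decrease[OF C2 params \<tau>, of a] unfolding f_def[symmetric] g_def[symmetric] step
    by (elim ex_forward conj_forward) simp_all
  show ?thesis unfolding f_def[symmetric]
  proof (cases "\<exists>k. g (x k) = 0")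
    case True
    then obtain k where k: "g (x k) = 0" by blast
    have "x (i + k) = x k" for i
    proof (induction i)
      case (Suc i)
      have "bnqn_step F \<delta> \<tau> (x k) = x k"
        using k unfolding bnqn_step_def Let_def g_def by (rule if_P)
      then show ?case using Suc step[of "i + k"] by simp
    qed simp
    then have "(\<lambda>i. x (i + k)) \<longlonglongrightarrow> x k" by simp
    then have "x \<longlonglongrightarrow> x k" by (rule LIMSEQ_offset)
    then show "filterlim (\<lambda>n. norm (x n)) at_top sequentially \<or> (\<exists>a. critical_point f a \<and> x \<longlonglongrightarrow> a)"
      using k crit by blast
  next
    case False
    then have g0: "g (x k) \<noteq> 0" for k by blast
    have g_zero: "g y = 0" if "F y = 0" for y using that by (simp add: g_def)
    have F0: "F (x k) \<noteq> 0" for k using g0[of k] g_zero by blast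
    have dec: "f (x (Suc n)) < f (x n)" for n
    proof -
      obtain c \<Lambda> L where cl: "c > 0" "\<Lambda> > 0" "L > 0"
        and le: "min 1 (c * norm (F (x n)) powr \<tau> / L) * (c * norm (F (x n)) powr \<tau>) * min 1 (norm (g (x n)) / \<Lambda>) * (norm (g (x n)) / \<Lambda>)
          \<le> f (x n) - f (x (Suc n))"
        using local_estimate[of "x n"] g0[of n] by (elim exE conjE) simp
      have "0 < min 1 (c * norm (F (x n)) powr \<tau> / L) * (c * norm (F (x n)) powr \<tau>) * min 1 (norm (g (x n)) / \<Lambda>) * (norm (g (x n)) / \<Lambda>)"
        using cl F0[of n] g0[of n] by (intro mult_pos_pos) auto
      then show ?thesis using le by linarith
    qed
    have fnn: "f a \<ge> 0" for a by (simp add: f_def sqnorm_fun_def)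
    have decseq: "decseq (\<lambda>n. f (x n))" using dec by (intro decseq_SucI) (simp add: less_imp_le)
    obtain l where l: "(\<lambda>n. f (x n)) \<longlonglongrightarrow> l" "\<And>n. l \<le> f (x n)"
      using decseq_convergent[OF decseq, of 0] fnn by blast
    show "filterlim (\<lambda>n. norm (x n)) at_top sequentially \<or> (\<exists>a. critical_point f a \<and> x \<longlonglongrightarrow> a)"
    proof (cases "filterlim (\<lambda>n. norm (x n)) at_top sequentially")
      case notinf: False
      obtain a s where s: "strict_mono s" "(x \<circ> s) \<longlonglongrightarrow> a"
        using bounded_subsequence_converges[OF notinf] by blast
      have "(\<lambda>n. f ((x \<circ> s) n)) \<longlonglongrightarrow> f a" by (rule isCont_tendsto_compose[OF contf s(2)])
      moreover have "((\<lambda>n. f (x n)) \<circ> s) \<longlonglongrightarrow> l" by (rule LIMSEQ_subseq_LIMSEQ[OF l(1) s(1)])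
      ultimately have la: "l = f a" using LIMSEQ_unique by (simp add: comp_def)
      obtain k c \<Lambda> L where k: "k > 0" and cl: "c > 0" "\<Lambda> > 0" "L > 0"
        and angle: "\<And>n. x n \<in> cball a 1 \<Longrightarrow>
          k * norm (F (x n)) powr \<tau> * norm (g (x n)) * norm (x (Suc n) - x n) \<le> f (x n) - f (x (Suc n))"
        and progress: "\<And>n. x n \<in> cball a 1 \<Longrightarrow>
          min 1 (c * norm (F (x n)) powr \<tau> / L) * (c * norm (F (x n)) powr \<tau>) * min 1 (norm (g (x n)) / \<Lambda>) * (norm (g (x n)) / \<Lambda>)
          \<le> f (x n) - f (x (Suc n))"
        using local_estimate[of a] g0 by (elim exE conjE) simp
      \<comment> \<open>Otherwise \<open>F a\<close> is nonzero too, so the lower bound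
        \<open>\<Psi>\<close> on the decrease is continuous and positive at \<open>a\<close>; but
        the decrease tends to 0 along the subsequence.\<close>
      have ga: "g a = 0"
      proof (rule ccontr)
        assume ga: "g a \<noteq> 0"
        then have Fa: "F a \<noteq> 0" using g_zero by blast
        define \<Psi> where "\<Psi> y = min 1 (c * norm (F y) powr \<tau> / L) * (c * norm (F y) powr \<tau>) * min 1 (norm (g y) / \<Lambda>) * (norm (g y) / \<Lambda>)" for y
        have "isCont \<Psi> a"
          unfolding \<Psi>_def using Fa cl by (intro continuous_intros contF contg) auto
        then have 1: "(\<lambda>n. \<Psi> ((x \<circ> s) n)) \<longlonglongrightarrow> \<Psi> a" by (rule isCont_tendsto_compose[OF _ s(2)])
        have "(\<lambda>n. f (x n) - f (x (Suc n))) \<longlonglongrightarrow> l - l"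
          by (intro tendsto_diff l(1) LIMSEQ_Suc[OF l(1)])
        then have 2: "(\<lambda>n. f ((x \<circ> s) n) - f (x (Suc (s n)))) \<longlonglongrightarrow> 0"
          using LIMSEQ_subseq_LIMSEQ[OF _ s(1)] by (force simp: comp_def)
        have "eventually (\<lambda>n. (x \<circ> s) n \<in> ball a 1) sequentially"
          by (rule topological_tendstoD[OF s(2)]) simp_all
        then have "eventually (\<lambda>n. \<Psi> ((x \<circ> s) n) \<le> f ((x \<circ> s) n) - f (x (Suc (s n)))) sequentially"
          by eventually_elim (use progress in \<open>auto simp: \<Psi>_def\<close>)
        from tendsto_le[OF sequentially_bot 2 1 this] have "\<Psi> a \<le> 0" .
        moreover have "0 < \<Psi> a" unfolding \<Psi>_def using cl Fa ga by (intro mult_pos_pos) auto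
        ultimately show False by simp
      qed
      then have ca: "critical_point f a" using crit by blast
      define M where "M = {\<mu>. 0 < \<mu> \<and> \<mu> < 1 \<and> (\<exists>U C. open U \<and> a \<in> U \<and> C > 0 \<and>
        (\<forall>x\<in>U. \<bar>f x - f a\<bar> powr \<mu> \<le> C * norm (grad f x)))}"
      have "M \<noteq> {}" using loj[of a] ca unfolding f_def lojasiewicz_at_def M_def by blast
      moreover have "Inf M < 1 / (1 + \<tau>)"
        using exponent[of a] ca \<tau>0 unfolding loj_exponent_def f_def[symmetric] M_def[symmetric]
        by (simp add: field_simps)
      \<comment> \<open>The infimum defining the exponent need not be attained, but some admissible
        \<open>\<mu>\<close> still lies strictly below \<open>1 / (1 + \<tau>)\<close>.\<close>
      ultimately obtain \<mu> where "\<mu> \<in> M" "\<mu> < 1 / (1 + \<tau>)" using cInf_lessD by blast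
      then obtain U C where \<mu>: "0 < \<mu>" "\<mu> < 1 / (1 + \<tau>)" and U: "open U" "a \<in> U" and C: "C > 0"
        and L\<mu>: "\<And>y. y \<in> U \<Longrightarrow> \<bar>f y - f a\<bar> powr \<mu> \<le> C * norm (grad f y)" unfolding M_def by blast
      define \<theta> where "\<theta> = \<mu> + \<tau> / 2"
      \<comment> \<open>For positive \<open>\<tau>\<close> this amounts to
        \<open>\<tau> \<le> 1\<close>, since \<open>(1 - \<tau> / 2) * (1 + \<tau>)\<close> equals
        \<open>1 + \<tau> * (1 - \<tau>) / 2\<close>.\<close>
      have "1 / (1 + \<tau>) \<le> 1 - \<tau> / 2"
      proof -
        have "\<tau> * \<tau> \<le> \<tau> * 1" using \<tau> \<tau>0 by (intro mult_left_mono) auto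
        then have "1 \<le> (1 - \<tau> / 2) * (1 + \<tau>)" by (simp add: algebra_simps)
        then show ?thesis using \<tau>0 by (simp add: divide_le_eq)
      qed
      then have \<theta>: "0 \<le> \<theta>" "\<theta> < 1" using \<mu> \<tau>0 by (auto simp: \<theta>_def)
      obtain r where r: "r > 0" "cball a r \<subseteq> U" using U open_contains_cball by blast
      \<comment> \<open>The 2 comes from \<open>grad f x = 2 *\<^sub>R g x\<close>.\<close>
      define K where "K = k / (2 * C)"
      have K: "K > 0" using k C by (simp add: K_def)
      define e where "e n = f (x n) - f a" for n
      have e0: "e n > 0" for n using dec[of n] l(2)[of "Suc n"] la by (simp add: e_def)
      \<comment> \<open>The potential whose decrease bounds the step length: an antiderivative of
        \<open>1 / (K * z powr \<theta>)\<close>, evaluated at \<open>e n\<close>.\<close>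
      define \<phi> where "\<phi> n = e n powr (1 - \<theta>) / (K * (1 - \<theta>))" for n
      have "x \<longlonglongrightarrow> a"
      proof (rule cluster_point_capture[OF _ _ _ _ s])
        show "min r 1 > 0" using r by simp
        have "e \<longlonglongrightarrow> 0" unfolding e_def using tendsto_diff[OF l(1) tendsto_const[of "f a"]] la by simp
        then have "(\<lambda>n. e n powr (1 - \<theta>)) \<longlonglongrightarrow> 0 powr (1 - \<theta>)"
          using \<theta> e0 by (intro tendsto_powr') (auto simp: less_imp_le)
        then show "\<phi> \<longlonglongrightarrow> 0" unfolding \<phi>_def using \<theta> by (intro tendsto_divide_zero) simp
        show "0 \<le> \<phi> n" for n using K \<theta> by (simp add: \<phi>_def)
        fix n assume xn: "x n \<in> cball a (min r 1)"
        then have xU: "x n \<in> U" "x n \<in> cball a 1" using r by auto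
        have "e n powr \<mu> \<le> 2 * C * norm (g (x n))"
          using L\<mu>[OF xU(1)] e0[of n] by (simp add: e_def grad)
        then have 1: "e n powr \<mu> / (2 * C) \<le> norm (g (x n))" using C by (simp add: field_simps)
        have "e n powr (\<tau> / 2) \<le> f (x n) powr (\<tau> / 2)"
          using e0[of n] fnn[of a] \<tau>0 by (intro powr_mono2) (auto simp: e_def)
        also have "\<dots> = norm (F (x n)) powr \<tau>"
        proof -
          have "(norm (F (x n)))\<^sup>2 = norm (F (x n)) powr 2" using F0[of n] by (simp add: powr_numeral)
          then show ?thesis by (simp only: f_def sqnorm_fun_def powr_powr) simp
        qed
        finally have 2: "e n powr (\<tau> / 2) \<le> norm (F (x n)) powr \<tau>" .
        have "K * e n powr \<theta> * norm (x (Suc n) - x n)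
            = k * (e n powr (\<tau> / 2)) * (e n powr \<mu> / (2 * C)) * norm (x (Suc n) - x n)"
          by (simp add: K_def \<theta>_def powr_add)
        also have "\<dots> \<le> k * norm (F (x n)) powr \<tau> * norm (g (x n)) * norm (x (Suc n) - x n)"
          using 1 2 k C by (intro mult_mono) auto
        also have "\<dots> \<le> e n - e (Suc n)" using angle[OF xU(2)] by (simp add: e_def)
        finally have main: "K * e n powr \<theta> * norm (x (Suc n) - x n) \<le> e n - e (Suc n)" .
        have "(1 - \<theta>) * K * norm (x (Suc n) - x n)
            = (1 - \<theta>) * e n powr (- \<theta>) * (K * e n powr \<theta> * norm (x (Suc n) - x n))"
          using e0[of n] by (simp add: powr_minus)
        also have "\<dots> \<le> (1 - \<theta>) * e n powr (- \<theta>) * (e n - e (Suc n))"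
          using main \<theta> by (intro mult_left_mono) auto
        also have "\<dots> \<le> e n powr (1 - \<theta>) - e (Suc n) powr (1 - \<theta>)"
          using e0 dec[of n] \<theta> by (intro powr_diff_ge) (auto simp: e_def)
        finally show "norm (x (Suc n) - x n) \<le> \<phi> n - \<phi> (Suc n)"
          using K \<theta> by (simp add: \<phi>_def diff_divide_distrib[symmetric] pos_le_divide_eq mult_ac)
      qed
      then show ?thesis using ca by blast
    qed blast
  qed
qed

lemma poly_fun_sqnorm_fun:
  assumes "poly_map F" shows "poly_fun (sqnorm_fun F)"
proof -
  have "sqnorm_fun F = (\<lambda>x. \<Sum>i\<in>UNIV. F x $ i * F x $ i)"
    by (auto simp: sqnorm_fun_def power2_norm_eq_inner inner_vec_def)
  then show ?thesis
    using assms unfolding poly_map_def by (auto intro!: poly_fun_sum poly_fun.mult)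
qed

theorem theorem11:
  fixes F :: "real^'m \<Rightarrow> real^'k"
  assumes C2: "C2_map F"
    and loj: "\<And>xs. critical_point (sqnorm_fun F) xs \<Longrightarrow> lojasiewicz_at (sqnorm_fun F) xs"
  shows
    "(\<forall>\<delta> \<tau> x. bnqn_params CARD('m) \<delta> \<tau> \<and> \<tau> < 1 \<and> bnqn_sequence F \<delta> \<tau> x \<and>
        (\<forall>xs. critical_point (sqnorm_fun F) xs \<longrightarrow> loj_exponent (sqnorm_fun F) xs * (1 + \<tau>) < 1)
       \<longrightarrow> filterlim (\<lambda>n. norm (x n)) at_top sequentially \<or>
           (\<exists>xs. critical_point (sqnorm_fun F) xs \<and> x \<longlonglongrightarrow> xs))
   \<and>
    (poly_map F \<longrightarrow>
      (\<exists>\<tau>0>0. \<forall>\<tau>. 0 < \<tau> \<and> \<tau> < \<tau>0 \<longrightarrow>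
         (\<forall>xs. critical_point (sqnorm_fun F) xs \<longrightarrow> loj_exponent (sqnorm_fun F) xs * (1 + \<tau>) < 1) \<and>
         (\<forall>\<delta> x. bnqn_params CARD('m) \<delta> \<tau> \<and> \<tau> < 1 \<and> bnqn_sequence F \<delta> \<tau> x
            \<longrightarrow> filterlim (\<lambda>n. norm (x n)) at_top sequentially \<or>
                (\<exists>xs. critical_point (sqnorm_fun F) xs \<and> x \<longlonglongrightarrow> xs))))"
proof (intro conjI allI impI; (elim conjE)?)
  fix \<delta> \<tau> and x :: "nat \<Rightarrow> real^'m"
  assume "bnqn_params CARD('m) \<delta> \<tau>" "\<tau> < 1" "bnqn_sequence F \<delta> \<tau> x"
    "\<forall>xs. critical_point (sqnorm_fun F) xs \<longrightarrow> loj_exponent (sqnorm_fun F) xs * (1 + \<tau>) < 1"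
  then show "filterlim (\<lambda>n. norm (x n)) at_top sequentially \<or>
      (\<exists>xs. critical_point (sqnorm_fun F) xs \<and> x \<longlonglongrightarrow> xs)"
    by (intro bnqn_convergence[OF C2 loj]) auto
next
  assume "poly_map F"
  then have "poly_fun (sqnorm_fun F)" by (rule poly_fun_sqnorm_fun)
  from poly_fun_uniform_loj_exponent[OF this loj]
  obtain u where u: "u > 0" "u < 1" "\<And>xs. critical_point (sqnorm_fun F) xs \<Longrightarrow> loj_exponent (sqnorm_fun F) xs \<le> u"
    by blast
  \<comment> \<open>The bound \<open>1 / u - 1\<close> on \<open>\<tau>\<close> is where
    \<open>u * (1 + \<tau>)\<close> reaches 1.\<close>
  have exponent: "loj_exponent (sqnorm_fun F) xs * (1 + \<tau>) < 1"
    if "0 < \<tau>" "\<tau> < 1 / u - 1" "critical_point (sqnorm_fun F) xs" for \<tau> xs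
  proof -
    have "loj_exponent (sqnorm_fun F) xs * (1 + \<tau>) \<le> u * (1 + \<tau>)"
      using u(3)[OF that(3)] that(1) by (intro mult_right_mono) auto
    also have "\<dots> < 1" using that(2) u(1) by (simp add: field_simps)
    finally show ?thesis .
  qed
  show "\<exists>\<tau>0>0. \<forall>\<tau>. 0 < \<tau> \<and> \<tau> < \<tau>0 \<longrightarrow>
         (\<forall>xs. critical_point (sqnorm_fun F) xs \<longrightarrow> loj_exponent (sqnorm_fun F) xs * (1 + \<tau>) < 1) \<and>
         (\<forall>\<delta> x. bnqn_params CARD('m) \<delta> \<tau> \<and> \<tau> < 1 \<and> bnqn_sequence F \<delta> \<tau> x
            \<longrightarrow> filterlim (\<lambda>n. norm (x n)) at_top sequentially \<or>
                (\<exists>xs. critical_point (sqnorm_fun F) xs \<and> x \<longlonglongrightarrow> xs))"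
  proof (intro exI[of _ "1 / u - 1"] conjI allI impI; (elim conjE)?)
    show "0 < 1 / u - 1" using u by simp
    fix \<tau> assume \<tau>: "0 < \<tau>" "\<tau> < 1 / u - 1"
    show "loj_exponent (sqnorm_fun F) xs * (1 + \<tau>) < 1" if "critical_point (sqnorm_fun F) xs" for xs
      using exponent \<tau> that by blast
    show "filterlim (\<lambda>n. norm (x n)) at_top sequentially \<or>
        (\<exists>xs. critical_point (sqnorm_fun F) xs \<and> x \<longlonglongrightarrow> xs)"
      if "bnqn_params CARD('m) \<delta> \<tau>" "\<tau> < 1" "bnqn_sequence F \<delta> \<tau> x" for \<delta> x
      using bnqn_convergence[OF C2 loj that] exponent \<tau> by blast
  qed
qed

end
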